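(* Let $r$ be a non-integral rational number and let $n>1$ be an integer or a half-integer. Then for any $s\in\hat{\mathbb Q}=\mathbb Q\cup\{\infty\}$ there is a unique $s_0\in\hat{\mathbb Q}$ with $s_0\in I(r;n)\cup\{\infty,r\}$ such that $s$ is contained in the $\Gamma(r;n)$-orbit of $s_0$. Moreover, $\alpha_s$ is homotopic to $\alpha_{s_0}$ in the Heckoid orbifold $\boldsymbol S(r;n)$. In particular, if $s_0=\infty$, then $\alpha_s$ is null-homotopic in $\boldsymbol S(r;n)$.
   Context: **Loops.** Let $H$ be the group of isometries of $\mathbb R^2$ generated by the $\pi$-rotations about the points of $\mathbb Z^2$, and $\hat H\supset H$ the group generated by the $\pi$-rotations about the points of $(\frac12\mathbb Z)^2$. The Conway sphere is $(\boldsymbol S^2,\boldsymbol P)=(\mathbb R^2,\mathbb Z^2)/H$; $\boldsymbol S=(\mathbb R^2-\mathbb Z^2)/H$ is a 4-punctured sphere, $\boldsymbol T=(\mathbb R^2-\mathbb Z^2)/\mathbb Z^2$ is a once-punctured torus, and $\boldsymbol O=(\mathbb R^2-\mathbb Z^2)/\hat H$ is an orbifold (a once-punctured sphere with three cone points of angle $\pi$). $\boldsymbol S$ and $\boldsymbol T$ are coverings of $\boldsymbol O$ with groups $(\mathbb Z/2)^2$ and $\mathbb Z/2$, so $\pi_1(\boldsymbol S),\pi_1(\boldsymbol T)\subset\pi_1(\boldsymbol O)$. For $s\in\hat{\mathbb Q}$, $\alpha_s$ and $\beta_s$ denote the unoriented simple loops in $\boldsymbol S$ and $\boldsymbol T$,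 respectively, that are images of a line of slope $s$ in $\mathbb R^2-\mathbb Z^2$, and also the corresponding conjugacy classes (up to inversion); in $\pi_1(\boldsymbol O)$ one has $\alpha_s=\beta_s^2$. **2-bridge links.** A rational tangle $(B^3,t(r))$ of slope $r\in\hat{\mathbb Q}$ is a 3-ball with a pair of trivial properly embedded arcs, with boundary identified with $(\boldsymbol S^2,\boldsymbol P)$ so that $\alpha_r$ bounds a disk in $B^3-t(r)$ separating the two arcs. The 2-bridge link of slope $r$ is $(S^3,K(r))=(B^3,t(\infty))\cup(B^3,t(r))$. **Heckoid orbifolds and groups.** Let $r\in\mathbb Q$. For an integer $n\ge2$, the even Heckoid orbifold $\boldsymbol S(r;n)$ is the 3-orbifold with underlying space the exterior of $K(r)$ and singular set, of index $n$, the lower tunnel of $K(r)$ (the core tunnel of $(B^3,t(r))$, an arc joining the two strings for which $\alpha_r$ is a meridian loop); its orbifold fundamental group is $G(r;n)=\pi_1(\boldsymbol S)/\langle\langle\alpha_\infty,\alpha_r^n\rangle\rangle$. For a non-integral half-integer $n>1$, put $m=2n$ (odd); there is an orbifold $\boldsymbol O(r;m)$, obtained from the quotient of $K(r)$ by its natural $(\mathbb Z/2)^2$-symmetry, with $\pi_1(\boldsymbol O(r;m))=\pi_1(\boldsymbol O)/\langle\langle\beta_\infty^2,\beta_r^m\rangle\rangle$; the odd Heckoid group $G(r;n)$ is the image of $\pi_1(\boldsymbol S)$ in $\pi_1(\boldsymbol O(r;m))$, and the odd Heckoid orbifold $\boldsymbol S(r;n)$ is the corresponding $\mathbb Z/2$-covering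 of $\boldsymbol O(r;m)$, so $\pi_1(\boldsymbol S(r;n))=G(r;n)$. In all cases there is a natural epimorphism $\pi_1(\boldsymbol S)\to G(r;n)$. The (unoriented) loops $\alpha_s,\alpha_{s'}$ are homotopic in $\boldsymbol S(r;n)$ if the images in $G(r;n)$ of elements representing them are conjugate up to inversion; $\alpha_s$ is null-homotopic if its image is trivial. **Groups acting on the Farey tessellation.** Let $\mathcal D$ be the Farey tessellation of $\mathbb H^2$ (ideal triangles obtained from the one with vertices $0,1,\infty$ by repeated reflection in edges); its ideal vertex set is $\hat{\mathbb Q}$. $\Gamma_\infty$ is the group generated by the reflections in the edges of $\mathcal D$ with endpoint $\infty$. For an integer $m$, $C_r(m)$ is the infinite cyclic group generated by the parabolic automorphism of $\mathcal D$ fixing $r$ that shifts the edges of $\mathcal D$ with endpoint $r$ by $m$ units (clockwise). $\Gamma(r;n)$ is the group generated by $\Gamma_\infty$ and $C_r(2n)$. **The set $I(r;n)$.** Let $k$ be the integer with $k<r<k+1$. Choose Farey neighbours $r_1,r_2$ of $r$ (endpoints of edges of $\mathcal D$ whose other endpoint is $r$) with $k\le r_1<r<r_2\le k+1$ such that $r_2$ is the image of $r_1$ under a generator of $C_r(2n)$. The region $R$ bounded by the Farey edges joining $\infty$ to $k$ and to $k+1$ and joining $r$ to $r_1$ and to $r_2$ is a fundamental domain for $\Gamma(r;n)$. Set $\bar I(r;n)=[k,r_1]\cup[r_2,k+1]$ and $I(r;n)=\bar I(r;n)-\{r_i\}$ for $i=1$ or $2$ (either fixed choice). *)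

theory Defs
  imports "HOL-Analysis.Analysis" "HOL-Algebra.Bij" "HOL-Algebra.Generated_Groups" "HOL-Algebra.Coset"
begin

section \<open>The Farey tessellation and the groups acting on it\<close>

text \<open>
  The extended rationals. All isometries of the hyperbolic plane below preserve the Farey
  tessellation, hence its set of ideal vertices, on which they act faithfully; they are
  represented by their action on the ideal vertices.
\<close>

datatype qhat = Fin rat | Infty

text \<open>
  Reflection in the geodesic of the upper half-plane with the two given (distinct) endpoints, as it
  acts on the ideal boundary: inversion in the circle with diameter \<open>[a, b]\<close>, or the
  Euclidean reflection in the vertical line through \<open>a\<close>. The last equation is a dummy.
\<close>

fun hyp_reflection :: "qhat \<Rightarrow> qhat \<Rightarrow> qhat \<Rightarrow> qhat" where
  "hyp_reflection (Fin a) (Fin b) Infty = Fin ((a + b) / 2)"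
| "hyp_reflection (Fin a) (Fin b) (Fin x) =
     (if x = (a + b) / 2 then Infty
      else Fin ((a + b) / 2 + ((b - a) / 2)\<^sup>2 / (x - (a + b) / 2)))"
| "hyp_reflection (Fin a) Infty Infty = Infty"
| "hyp_reflection (Fin a) Infty (Fin x) = Fin (2 * a - x)"
| "hyp_reflection Infty (Fin a) Infty = Infty"
| "hyp_reflection Infty (Fin a) (Fin x) = Fin (2 * a - x)"
| "hyp_reflection Infty Infty x = x"

inductive farey_triangle :: "qhat set \<Rightarrow> bool" where
  base: "farey_triangle {Fin 0, Fin 1, Infty}"
| reflect: "farey_triangle T \<Longrightarrow> a \<in> T \<Longrightarrow> b \<in> T \<Longrightarrow> a \<noteq> b \<Longrightarrow>
    farey_triangle (hyp_reflection a b ` T)"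

definition farey_edge :: "qhat \<Rightarrow> qhat \<Rightarrow> bool" where
  "farey_edge a b \<longleftrightarrow> a \<noteq> b \<and> (\<exists>T. farey_triangle T \<and> a \<in> T \<and> b \<in> T)"

definition Gamma_inf :: "(qhat \<Rightarrow> qhat) set" where
  "Gamma_inf = generate (BijGroup UNIV) {hyp_reflection Infty a | a. farey_edge Infty a}"

fun moebius :: "rat \<Rightarrow> rat \<Rightarrow> rat \<Rightarrow> rat \<Rightarrow> qhat \<Rightarrow> qhat" where
  "moebius a b c d Infty = (if c = 0 then Infty else Fin (a / c))"
| "moebius a b c d (Fin x) =
     (if c * x + d = 0 then Infty else Fin ((a * x + b) / (c * x + d)))"

text \<open>
  Rational coefficients suffice: an orientation preserving isometry that preserves the tessellation
  maps \<open>0, 1, \<infinity>\<close> to extended rationals. Being parabolic with fixed point \<open>r\<close>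
  means that \<open>r\<close> is the only fixed point on the ideal boundary; as \<open>r\<close> is
  rational, a second fixed point would be rational too.
\<close>

definition farey_parabolic :: "qhat \<Rightarrow> (qhat \<Rightarrow> qhat) \<Rightarrow> bool" where
  "farey_parabolic r f \<longleftrightarrow>
     (\<exists>a b c d. a * d - b * c > 0 \<and> f = moebius a b c d) \<and>
     (\<forall>T. farey_triangle (f ` T) \<longleftrightarrow> farey_triangle T) \<and>
     {s. f s = s} = {r}"

text \<open>
  An enumeration, in clockwise or in anticlockwise order, of the edges with endpoint \<open>r\<close>:
  edges are consecutive if they bound a common triangle.
\<close>

definition farey_fan :: "qhat \<Rightarrow> (int \<Rightarrow> qhat) \<Rightarrow> bool" where
  "farey_fan r e \<longleftrightarrow>
     bij_betw e UNIV {a. farey_edge r a} \<and> (\<forall>i. farey_triangle {r, e i, e (i + 1)})"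

text \<open>
  The generating set consists of the shift by \<open>m\<close> units in either direction, that is, of the
  clockwise shift and its inverse. Only used for \<open>m \<noteq> 0\<close>.
\<close>

definition C_group :: "qhat \<Rightarrow> int \<Rightarrow> (qhat \<Rightarrow> qhat) set" where
  "C_group r m = generate (BijGroup UNIV)
     {f. farey_parabolic r f \<and> (\<exists>e. farey_fan r e \<and> (\<forall>i. f (e i) = e (i + m)))}"

text \<open>
  Throughout, \<open>n\<close> is a rational number such that \<open>2 * n\<close> is an integer.
\<close>

definition Gamma_group :: "rat \<Rightarrow> rat \<Rightarrow> (qhat \<Rightarrow> qhat) set" where
  "Gamma_group r n = generate (BijGroup UNIV) (Gamma_inf \<union> C_group (Fin r) \<lfloor>2 * n\<rfloor>)"

definition Gamma_orbit :: "rat \<Rightarrow> rat \<Rightarrow> qhat \<Rightarrow> qhat set" where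
  "Gamma_orbit r n s = (\<lambda>\<gamma>. \<gamma> s) ` Gamma_group r n"

text \<open>
  The admissible choices of the Farey neighbours \<open>r1\<close>, \<open>r2\<close> of the non-integral
  number \<open>r\<close>; here \<open>\<lfloor>r\<rfloor>\<close> is the integer \<open>k\<close> with
  \<open>k < r < k + 1\<close>.
\<close>

definition admissible_neighbours :: "rat \<Rightarrow> rat \<Rightarrow> rat \<Rightarrow> rat \<Rightarrow> bool" where
  "admissible_neighbours r n r1 r2 \<longleftrightarrow>
     farey_edge (Fin r) (Fin r1) \<and> farey_edge (Fin r) (Fin r2) \<and>
     of_int \<lfloor>r\<rfloor> \<le> r1 \<and> r1 < r \<and> r < r2 \<and> r2 \<le> of_int \<lfloor>r\<rfloor> + 1 \<and>
     (\<exists>f \<in> C_group (Fin r) \<lfloor>2 * n\<rfloor>.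
        generate (BijGroup UNIV) {f} = C_group (Fin r) \<lfloor>2 * n\<rfloor> \<and> f (Fin r1) = Fin r2)"

text \<open>
  The rational points of \<open>I(r;n)\<close>, where \<open>ri\<close> is the removed endpoint
  (\<open>r1\<close> or \<open>r2\<close>).
\<close>

definition I_set :: "rat \<Rightarrow> rat \<Rightarrow> rat \<Rightarrow> rat \<Rightarrow> qhat set" where
  "I_set r r1 r2 ri = Fin ` (({of_int \<lfloor>r\<rfloor>..r1} \<union> {r2..of_int \<lfloor>r\<rfloor> + 1}) - {ri})"

section \<open>Orbifold fundamental groups\<close>

text \<open>
  The orbifold fundamental group of the quotient \<open>X/G\<close>, where the group \<open>G\<close> of
  homeomorphisms of \<open>X\<close> acts properly discontinuously. Its elements are pairs of some
  \<open>g \<in> G\<close> and a homotopy class (relative to the endpoints) of paths in \<open>X\<close> from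
  the base point \<open>x0\<close> to \<open>g x0\<close>. If the action is free, this is the ordinary
  fundamental group of \<open>X/G\<close>, by unique lifting of loops to \<open>X\<close>. For a subgroup
  \<open>K \<subseteq> G\<close>, the group of the covering \<open>X/K\<close> of \<open>X/G\<close> is
  literally contained in that of \<open>X/G\<close>.
\<close>

type_synonym plane = "real \<times> real"

definition path_class :: "'a::topological_space set \<Rightarrow> (real \<Rightarrow> 'a) \<Rightarrow> (real \<Rightarrow> 'a) set" where
  "path_class X p = {q. homotopic_paths X p q}"

definition orbifold_pi1 ::
  "'a::topological_space set \<Rightarrow> ('a \<Rightarrow> 'a) set \<Rightarrow> 'a \<Rightarrow> (('a \<Rightarrow> 'a) \<times> (real \<Rightarrow> 'a) set) monoid" where
  "orbifold_pi1 X G x0 =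
     \<lparr>carrier = {(g, path_class X p) | g p. g \<in> G \<and> path p \<and> path_image p \<subseteq> X \<and>
                   pathstart p = x0 \<and> pathfinish p = g x0},
      mult = (\<lambda>(g, C) (h, D). (g \<circ> h, \<Union>p\<in>C. \<Union>q\<in>D. path_class X (p +++ (g \<circ> q)))),
      one = (id, path_class X (\<lambda>_. x0))\<rparr>"

definition punctured_plane :: "plane set" where
  "punctured_plane = UNIV - \<int> \<times> \<int>"

definition pi_rotation :: "plane \<Rightarrow> plane \<Rightarrow> plane" where
  "pi_rotation a = (\<lambda>z. 2 *\<^sub>R a - z)"

definition H_group :: "(plane \<Rightarrow> plane) set" where
  "H_group = generate (BijGroup UNIV) (pi_rotation ` (\<int> \<times> \<int>))"

definition H_hat_group :: "(plane \<Rightarrow> plane) set" where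
  "H_hat_group = generate (BijGroup UNIV) (pi_rotation ` {a. 2 *\<^sub>R a \<in> \<int> \<times> \<int>})"

definition Z2_group :: "(plane \<Rightarrow> plane) set" where
  "Z2_group = (\<lambda>v z. z + v) ` (\<int> \<times> \<int>)"

abbreviation pi1_S :: "plane \<Rightarrow> ((plane \<Rightarrow> plane) \<times> (real \<Rightarrow> plane) set) monoid" where
  "pi1_S \<equiv> orbifold_pi1 punctured_plane H_group"

abbreviation pi1_O :: "plane \<Rightarrow> ((plane \<Rightarrow> plane) \<times> (real \<Rightarrow> plane) set) monoid" where
  "pi1_O \<equiv> orbifold_pi1 punctured_plane H_hat_group"

section \<open>The loops\<close>

fun lines_of_slope :: "qhat \<Rightarrow> plane set set" where
  "lines_of_slope (Fin s) = {{(x, y). y = of_rat s * x + c} | c. True}"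
| "lines_of_slope Infty = {{(x, y). x = c} | c. True}"

text \<open>
  The elements represented by the simple loop in \<open>X/G\<close> that is the image of a line
  \<open>L\<close> in the punctured plane \<open>X\<close>. This image is the quotient of \<open>L\<close>
  by its stabiliser in \<open>G\<close>, which is infinite cyclic; if \<open>g\<close> is one of its two
  generators, the loop is the image of the segment from a point of \<open>L\<close> to its image under
  \<open>g\<close>. It is joined to the base point by an arbitrary path \<open>c\<close>. Letting the
  line, the generator and \<open>c\<close> vary one obtains a conjugacy class and its inverse.
\<close>

definition line_loop :: "(plane \<Rightarrow> plane) set \<Rightarrow> plane \<Rightarrow> qhat \<Rightarrow>
    ((plane \<Rightarrow> plane) \<times> (real \<Rightarrow> plane) set) set" where
  "line_loop G x0 s =
     {(g, path_class punctured_plane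
            (c +++ linepath (pathfinish c) (g (pathfinish c)) +++ reversepath (g \<circ> c))) | g c L.
        L \<in> lines_of_slope s \<and> L \<subseteq> punctured_plane \<and>
        path c \<and> path_image c \<subseteq> punctured_plane \<and> pathstart c = x0 \<and> pathfinish c \<in> L \<and>
        g \<in> G \<and> generate (BijGroup UNIV) {g} = {h \<in> G. h ` L = L}}"

definition alpha :: "plane \<Rightarrow> qhat \<Rightarrow> ((plane \<Rightarrow> plane) \<times> (real \<Rightarrow> plane) set) set" where
  "alpha = line_loop H_group"

definition beta :: "plane \<Rightarrow> qhat \<Rightarrow> ((plane \<Rightarrow> plane) \<times> (real \<Rightarrow> plane) set) set" where
  "beta = line_loop Z2_group"

section \<open>Heckoid groups\<close>

definition normal_closure :: "('a, 'b) monoid_scheme \<Rightarrow> 'a set \<Rightarrow> 'a set" where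
  "normal_closure G A = \<Inter>{N. N \<lhd> G \<and> A \<subseteq> N}"

definition even_kernel :: "plane \<Rightarrow> rat \<Rightarrow> nat \<Rightarrow> ((plane \<Rightarrow> plane) \<times> (real \<Rightarrow> plane) set) set" where
  "even_kernel x0 r n = normal_closure (pi1_S x0)
     (alpha x0 Infty \<union> (\<lambda>a. a [^]\<^bsub>pi1_S x0\<^esub> n) ` alpha x0 (Fin r))"

definition odd_kernel :: "plane \<Rightarrow> rat \<Rightarrow> nat \<Rightarrow> ((plane \<Rightarrow> plane) \<times> (real \<Rightarrow> plane) set) set" where
  "odd_kernel x0 r m = normal_closure (pi1_O x0)
     ((\<lambda>b. b [^]\<^bsub>pi1_O x0\<^esub> (2::nat)) ` beta x0 Infty \<union>
      (\<lambda>b. b [^]\<^bsub>pi1_O x0\<^esub> m) ` beta x0 (Fin r))"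

text \<open>The natural epimorphism from the group of the 4-punctured sphere to \<open>G(r;n)\<close>.\<close>

definition heckoid_proj :: "plane \<Rightarrow> rat \<Rightarrow> rat \<Rightarrow> (plane \<Rightarrow> plane) \<times> (real \<Rightarrow> plane) set
    \<Rightarrow> ((plane \<Rightarrow> plane) \<times> (real \<Rightarrow> plane) set) set" where
  "heckoid_proj x0 r n a =
     (if n \<in> \<int> then even_kernel x0 r (nat \<lfloor>n\<rfloor>) #>\<^bsub>pi1_S x0\<^esub> a
      else odd_kernel x0 r (nat \<lfloor>2 * n\<rfloor>) #>\<^bsub>pi1_O x0\<^esub> a)"

definition heckoid_group :: "plane \<Rightarrow> rat \<Rightarrow> rat \<Rightarrow>
    ((plane \<Rightarrow> plane) \<times> (real \<Rightarrow> plane) set) set monoid" where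
  "heckoid_group x0 r n =
     (if n \<in> \<int> then pi1_S x0 Mod even_kernel x0 r (nat \<lfloor>n\<rfloor>)
      else (pi1_O x0 Mod odd_kernel x0 r (nat \<lfloor>2 * n\<rfloor>))
             \<lparr>carrier := heckoid_proj x0 r n ` carrier (pi1_S x0)\<rparr>)"

definition conj_up_to_inv :: "('a, 'b) monoid_scheme \<Rightarrow> 'a \<Rightarrow> 'a \<Rightarrow> bool" where
  "conj_up_to_inv G x y \<longleftrightarrow>
     (\<exists>g \<in> carrier G. y = g \<otimes>\<^bsub>G\<^esub> x \<otimes>\<^bsub>G\<^esub> inv\<^bsub>G\<^esub> g \<or>
                      y = g \<otimes>\<^bsub>G\<^esub> inv\<^bsub>G\<^esub> x \<otimes>\<^bsub>G\<^esub> inv\<^bsub>G\<^esub> g)"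

definition homotopic_in_heckoid :: "plane \<Rightarrow> rat \<Rightarrow> rat \<Rightarrow> qhat \<Rightarrow> qhat \<Rightarrow> bool" where
  "homotopic_in_heckoid x0 r n s s' \<longleftrightarrow>
     (\<exists>a \<in> alpha x0 s. \<exists>b \<in> alpha x0 s'.
        conj_up_to_inv (heckoid_group x0 r n) (heckoid_proj x0 r n a) (heckoid_proj x0 r n b))"

definition null_homotopic_in_heckoid :: "plane \<Rightarrow> rat \<Rightarrow> rat \<Rightarrow> qhat \<Rightarrow> bool" where
  "null_homotopic_in_heckoid x0 r n s \<longleftrightarrow>
     (\<exists>a \<in> alpha x0 s. heckoid_proj x0 r n a = \<one>\<^bsub>heckoid_group x0 r n\<^esub>)"

end

(* Topology.  A line of slope s = b/a in the punctured plane meets the lattice lines of slope r = p/q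
   (direction u = (q,p)) in gaps between consecutive lattice points.  Modulo the kernel of the Heckoid
   group, the loops of direction u with translation part 2n u are trivial, so in each strip between two
   such lattice lines one may translate by multiples of 2n u.  Hence two lines whose gaps differ by such
   multiples represent the same element; this applies to the vectors v and v + 2n l det(u,v) u, that is,
   to a slope and its image under the parabolic group at r.  For r = infinity, where the loop with
   translation part 2(0,1) is killed, it also applies to a line and to the mirror image, reflected
   within a gap, of its slope in an integer vertical line.

   Combinatorics.  The reflections in the vertical edges fold the line into [k,k+1], and the parabolic
   group at r folds it into the complement of (r1,r2); at most one of the two moves a given point.  So
   the elementary moves towards the domain form a deterministic rewriting system, points of one orbit
   have a common successor, and normal forms are unique.  They exist because a reflection towards
   [k,k+1] decreases |det(u,v)|, which the parabolic group preserves. *)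

theory Submission
  imports Defs
begin

section \<open>Homotopy classes of paths and orbifold fundamental groups\<close>

text \<open>The translations inserted in successive strips accumulate, and each of them costs an
  element of the kernel, so the two loops cannot be compared by one homotopy. The comparison is
  instead a relation \<open>rel\<close> between initial pieces of the two lines, which is extended
  across one strip at a time and becomes an equality of cosets only when both lines close up. Apart
  from the groupoid laws, every homotopy that occurs is linear inside a convex set: a line, or a
  strip with one gap on either side. Both parities of \<open>2 * n\<close> fit one scheme: the deck
  group is \<open>H_group\<close> for integral \<open>n\<close> and \<open>H_hat_group\<close>
  otherwise, and killed loops enter only through their translation parts. The reflection works with
  the translation part \<open>2 (0, 1)\<close> because mirroring within a gap alters the numbers of
  the gaps by even amounts. On the Farey side, triangles are used mainly through a necessary
  condition on determinants; that a parabolic generator exists is read off from the admissible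
  neighbours.\<close>

lemma carrier_BijGroup_UNIV: "f \<in> carrier (BijGroup UNIV) \<longleftrightarrow> bij f"
  by (simp add: BijGroup_def Bij_def)

lemma mult_BijGroup_UNIV: "bij f \<Longrightarrow> bij g \<Longrightarrow> f \<otimes>\<^bsub>BijGroup UNIV\<^esub> g = f \<circ> g"
  by (auto simp: BijGroup_def Bij_def compose_def)

lemma one_BijGroup_UNIV: "\<one>\<^bsub>BijGroup UNIV\<^esub> = id"
  by (auto simp: BijGroup_def)

lemma inv_BijGroup_UNIV: 
  assumes "bij f" shows "inv\<^bsub>BijGroup UNIV\<^esub> f = inv_into UNIV f"
proof -
  interpret group "BijGroup UNIV" by (rule group_BijGroup)
  have "bij (inv_into UNIV f)" using assms by (rule bij_imp_bij_inv)
  moreover have "inv_into UNIV f \<circ> f = id" using assms by (simp add: bij_is_inj)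
  ultimately show ?thesis
    by (intro inv_equality)
      (auto simp: assms mult_BijGroup_UNIV one_BijGroup_UNIV carrier_BijGroup_UNIV)
qed

text \<open>Only matching pairs of paths are joined (\<open>p +++ q\<close> can be a path without \<open>q\<close> being
  one); this makes the operation associative on arbitrary sets, so that concatenations can be
  rewritten without side conditions.\<close>

definition class_join :: "'a::real_normed_vector set \<Rightarrow> (real \<Rightarrow> 'a) set \<Rightarrow> (real \<Rightarrow> 'a) set \<Rightarrow> (real \<Rightarrow> 'a) set"
  where "class_join X C D = {r. \<exists>p\<in>C. \<exists>q\<in>D. path p \<and> path q \<and> pathfinish p = pathstart q \<and>
     homotopic_paths X (p +++ q) r}"

lemma class_joinI:
  "p \<in> C \<Longrightarrow> q \<in> D \<Longrightarrow> path p \<Longrightarrow> path q \<Longrightarrow> pathfinish p = pathstart q \<Longrightarrow>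
     homotopic_paths X (p +++ q) r \<Longrightarrow> r \<in> class_join X C D"
  by (auto simp: class_join_def)

lemma path_class_eqI: "homotopic_paths X p q \<Longrightarrow> path_class X p = path_class X q"
  unfolding path_class_def using homotopic_paths_sym homotopic_paths_trans by blast

lemma path_class_eq_iff:
  "path p \<Longrightarrow> path_image p \<subseteq> X \<Longrightarrow> path_class X p = path_class X q \<longleftrightarrow> homotopic_paths X p q"
  by (metis (mono_tags, lifting) homotopic_paths_refl homotopic_paths_sym mem_Collect_eq
      path_class_def path_class_eqI)

text \<open>A path that leaves \<open>X\<close> has an empty class, and then both sides are empty.
  The equation can therefore rewrite concatenations without regard to their images.\<close>

lemma path_class_join:
  assumes "path p" "path q" "pathfinish p = pathstart q"
  shows "path_class X (p +++ q) = class_join X (path_class X p) (path_class X q)"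
proof (intro Set.set_eqI iffI)
  fix r assume "r \<in> path_class X (p +++ q)"
  then have h: "homotopic_paths X (p +++ q) r" by (simp add: path_class_def)
  then have "path_image p \<subseteq> X" "path_image q \<subseteq> X"
    using assms homotopic_paths_imp_subset[OF h] by (auto simp: path_image_join)
  then show "r \<in> class_join X (path_class X p) (path_class X q)"
    using assms h by - (rule class_joinI[of p _ q], auto simp: path_class_def)
next
  fix r assume "r \<in> class_join X (path_class X p) (path_class X q)"
  then obtain p' q' where *: "homotopic_paths X p p'" "homotopic_paths X q q'"
      "pathfinish p' = pathstart q'" "homotopic_paths X (p' +++ q') r"
    by (auto simp: class_join_def path_class_def)
  then have "homotopic_paths X (p +++ q) (p' +++ q')"
    using assms by (intro homotopic_paths_join) auto
  with * show "r \<in> path_class X (p +++ q)"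
    unfolding path_class_def using homotopic_paths_trans by blast
qed

lemma class_join_assoc: "class_join X (class_join X C D) E = class_join X C (class_join X D E)"
proof (intro Set.set_eqI iffI)
  fix r assume "r \<in> class_join X (class_join X C D) E"
  then obtain c d e s where *: "c \<in> C" "d \<in> D" "e \<in> E" "path c" "path d" "pathfinish c = pathstart d"
      "homotopic_paths X (c +++ d) s" "path e" "pathfinish s = pathstart e" "homotopic_paths X (s +++ e) r"
    by (auto simp: class_join_def)
  have im: "path_image c \<subseteq> X" "path_image d \<subseteq> X" "path_image e \<subseteq> X"
    using homotopic_paths_imp_subset[OF *(7)] homotopic_paths_imp_subset[OF *(10)] *
    by (auto simp: path_image_join homotopic_paths_imp_path[OF *(7)])
  have f: "pathfinish d = pathstart e" 
    using homotopic_paths_imp_pathfinish[OF *(7)] * by simp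
  have "homotopic_paths X (c +++ (d +++ e)) ((c +++ d) +++ e)"
    by (intro homotopic_paths_assoc) (auto simp: * im f)
  also have "homotopic_paths X ((c +++ d) +++ e) (s +++ e)"
    using * f im by (intro homotopic_paths_join) auto
  also note *(10)
  finally have "homotopic_paths X (c +++ (d +++ e)) r" .
  moreover have "d +++ e \<in> class_join X D E" using * f im
    by - (rule class_joinI[of d _ e], auto simp: subset_path_image_join)
  ultimately show "r \<in> class_join X C (class_join X D E)"
    using * f by - (rule class_joinI[of c _ "d +++ e"], auto)
next
  fix r assume "r \<in> class_join X C (class_join X D E)"
  then obtain c d e s where *: "c \<in> C" "d \<in> D" "e \<in> E" "path d" "path e" "pathfinish d = pathstart e"
      "homotopic_paths X (d +++ e) s" "path c" "pathfinish c = pathstart s" "homotopic_paths X (c +++ s) r"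
    by (auto simp: class_join_def)
  have im: "path_image c \<subseteq> X" "path_image d \<subseteq> X" "path_image e \<subseteq> X"
    using homotopic_paths_imp_subset[OF *(7)] homotopic_paths_imp_subset[OF *(10)] *
    by (auto simp: path_image_join homotopic_paths_imp_path[OF *(7)])
  have f: "pathfinish c = pathstart d" 
    using homotopic_paths_imp_pathstart[OF *(7)] * by (metis pathstart_join)
  have "homotopic_paths X ((c +++ d) +++ e) (c +++ (d +++ e))"
    using * im f by (intro homotopic_paths_sym[OF homotopic_paths_assoc]) auto
  also have "homotopic_paths X (c +++ (d +++ e)) (c +++ s)"
    using * f im by (intro homotopic_paths_join) auto
  also note *(10)
  finally have "homotopic_paths X ((c +++ d) +++ e) r" .
  moreover have "c +++ d \<in> class_join X C D" using * f im
    by - (rule class_joinI[of c _ d], auto simp: subset_path_image_join)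
  ultimately show "r \<in> class_join X (class_join X C D) E"
    using * f by - (rule class_joinI[of "c +++ d" _ e], auto)
qed

lemma class_join_cancel:
  assumes "path p" "path_image p \<subseteq> X" "path q" "pathstart q = pathstart p"
  shows "class_join X (path_class X p) (class_join X (path_class X (reversepath p)) (path_class X q)) = path_class X q"
proof (cases "path_image q \<subseteq> X")
  case True
  have "path_class X ((p +++ reversepath p) +++ q) = path_class X (linepath (pathstart p) (pathstart p) +++ q)"
    using assms True by (intro path_class_eqI homotopic_paths_join homotopic_paths_rinv) auto
  also have "\<dots> = path_class X q"
    using assms True by (intro path_class_eqI homotopic_paths_lid') auto
  finally show ?thesis using assms by (simp add: path_class_join class_join_assoc)
next
  case False
  then have "path_class X q = {}"
    unfolding path_class_def using homotopic_paths_imp_subset by blast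
  then show ?thesis by (simp add: class_join_def)
qed

lemma class_join_cancel':
  assumes "path p" "path_image p \<subseteq> X" "path q" "pathstart q = pathfinish p"
  shows "class_join X (path_class X (reversepath p)) (class_join X (path_class X p) (path_class X q)) = path_class X q"
  using class_join_cancel[of "reversepath p" X q] assms by simp

lemma class_join_cancel_assoc':
  assumes "path p" "path_image p \<subseteq> X" "path q" "pathstart q = pathfinish p"
  shows "class_join X (path_class X (reversepath p)) (class_join X (path_class X p) (class_join X (path_class X q) C)) =
     class_join X (path_class X q) C"
  using class_join_cancel'[OF assms] by (simp flip: class_join_assoc)

lemma class_join_rid:
  assumes "path q" "pathfinish q = a"
  shows "class_join X (path_class X q) (path_class X (linepath a a)) = path_class X q"
proof (cases "path_image q \<subseteq> X")
  case True
  then have "path_class X (q +++ linepath a a) = path_class X q"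
    using assms by (intro path_class_eqI homotopic_paths_rid') auto
  then show ?thesis using assms by (simp add: path_class_join)
next
  case False
  then have "path_class X q = {}"
    unfolding path_class_def using homotopic_paths_imp_subset by blast
  then show ?thesis by (simp add: class_join_def)
qed

lemma path_class_rinv:
  assumes "path p" "path_image p \<subseteq> X"
  shows "class_join X (path_class X p) (path_class X (reversepath p)) = path_class X (linepath (pathstart p) (pathstart p))"
    using assms path_class_eqI[OF homotopic_paths_rinv[of p X]] by (simp add: path_class_join)

lemma class_join_lid:
  assumes "path q" "pathstart q = a"
  shows "class_join X (path_class X (linepath a a)) (path_class X q) = path_class X q"
proof (cases "path_image q \<subseteq> X")
  case True
  then have "path_class X (linepath a a +++ q) = path_class X q"
    using assms by (intro path_class_eqI homotopic_paths_lid') auto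
  then show ?thesis using assms by (simp add: path_class_join)
next
  case False
  then have "path_class X q = {}"
    unfolding path_class_def using homotopic_paths_imp_subset by blast
  then show ?thesis by (simp add: class_join_def)
qed

text \<open>The straight-line homotopy inside \<open>S\<close>. It is applied with lines and strips
  as \<open>S\<close>, and is the source of all geometric homotopies below.\<close>

lemma class_join_linepath:
  assumes "convex S" "S \<subseteq> X" "a \<in> S" "b \<in> S" "c \<in> S"
  shows "class_join X (path_class X (linepath a b)) (path_class X (linepath b c)) = path_class X (linepath a c)"
proof -
  have sub: "closed_segment a b \<subseteq> S" "closed_segment b c \<subseteq> S" "closed_segment a c \<subseteq> S"
    using assms by (auto simp: closed_segment_subset)
  have "path_image (linepath a b +++ linepath b c) \<subseteq> S" "path_image (linepath a c) \<subseteq> S"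
    using sub by (auto simp: path_image_join)
  then have "homotopic_paths S (linepath a b +++ linepath b c) (linepath a c)"
    using assms unfolding path_image_def
    by (intro homotopic_paths_linear) (auto dest!: closed_segment_subset[OF _ _ \<open>convex S\<close>, THEN subsetD, rotated 2] simp: image_subset_iff)
  then have "homotopic_paths X (linepath a b +++ linepath b c) (linepath a c)"
    using assms homotopic_paths_subset by blast
  then show ?thesis by (simp add: path_class_eqI flip: path_class_join)
qed

lemma path_class_image:
  assumes "path_class X p = path_class X q" "path p" "path_image p \<subseteq> X" "continuous_on X g" "g ` X \<subseteq> X"
  shows "path_class X (g \<circ> p) = path_class X (g \<circ> q)"
  using assms by (intro path_class_eqI homotopic_paths_continuous_image[of X p q]) (auto simp: path_class_eq_iff)

section \<open>Orbifold fundamental groups of quotients by a group of homeomorphisms\<close>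

locale orbifold =
  fixes X :: "'a::real_normed_vector set" and G :: "('a \<Rightarrow> 'a) set" and x0 :: 'a
  assumes base_in: "x0 \<in> X"
    and subgroup_G: "subgroup G (BijGroup UNIV)"
    and continuous_G: "g \<in> G \<Longrightarrow> continuous_on X g"
    and image_G: "g \<in> G \<Longrightarrow> g ` X \<subseteq> X"
begin

abbreviation "pi1 \<equiv> orbifold_pi1 X G x0"

lemma bij_G: "g \<in> G \<Longrightarrow> bij g"
  using subgroup.subset[OF subgroup_G] carrier_BijGroup_UNIV by auto

lemma id_G: "id \<in> G"
  using subgroup.one_closed[OF subgroup_G] by (simp add: one_BijGroup_UNIV)

lemma comp_G: "g \<in> G \<Longrightarrow> h \<in> G \<Longrightarrow> g \<circ> h \<in> G"
  using subgroup.m_closed[OF subgroup_G, of g h] by (simp add: mult_BijGroup_UNIV bij_G)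

lemma inv_G: "g \<in> G \<Longrightarrow> inv_into UNIV g \<in> G"
  using subgroup.m_inv_closed[OF subgroup_G, of g] by (simp add: inv_BijGroup_UNIV bij_G)

definition lift_path :: "('a \<Rightarrow> 'a) \<Rightarrow> (real \<Rightarrow> 'a) \<Rightarrow> bool" where
  "lift_path g p \<longleftrightarrow> g \<in> G \<and> path p \<and> path_image p \<subseteq> X \<and> pathstart p = x0 \<and> pathfinish p = g x0"

lemma carrier_pi1: "carrier pi1 = {(g, path_class X p) | g p. lift_path g p}"
  by (simp add: orbifold_pi1_def lift_path_def)

lemma path_G: "g \<in> G \<Longrightarrow> path p \<Longrightarrow> path_image p \<subseteq> X \<Longrightarrow> path (g \<circ> p)"
  using continuous_G[of g] by (meson continuous_on_subset path_continuous_image)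

lemma path_image_G: "g \<in> G \<Longrightarrow> path_image p \<subseteq> X \<Longrightarrow> path_image (g \<circ> p) \<subseteq> X"
  using image_G[of g] by (auto simp: path_image_compose)

lemma path_class_G: "g \<in> G \<Longrightarrow> path_class X p = path_class X q \<Longrightarrow> path p \<Longrightarrow> path_image p \<subseteq> X \<Longrightarrow>
    path_class X (g \<circ> p) = path_class X (g \<circ> q)"
  using path_class_image image_G continuous_G by blast

lemma lift_path_comp: 
  "lift_path g p \<Longrightarrow> lift_path h q \<Longrightarrow> lift_path (g \<circ> h) (p +++ (g \<circ> q))"
  unfolding lift_path_def
  by (intro conjI subset_path_image_join)
     (simp_all add: comp_G path_G path_image_G pathstart_compose pathfinish_compose)

text \<open>As \<open>g\<close> is continuous on \<open>X\<close>, homotopic representatives have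
  homotopic concatenations, so all members of the union in the definition coincide.\<close>

lemma mult_pi1:
  assumes "lift_path g p" "lift_path h q"
  shows "(g, path_class X p) \<otimes>\<^bsub>pi1\<^esub> (h, path_class X q) = (g \<circ> h, path_class X (p +++ (g \<circ> q)))"
proof -
  have p: "path p" "path_image p \<subseteq> X" "path q" "path_image q \<subseteq> X" "g \<in> G" 
    "pathfinish p = g (pathstart q)"
    using assms by (simp_all add: lift_path_def)
  have "path_class X (p' +++ (g \<circ> q')) = path_class X (p +++ (g \<circ> q))"
    if "p' \<in> path_class X p" "q' \<in> path_class X q" for p' q'
  proof -
    have h: "homotopic_paths X p p'" "homotopic_paths X q q'"
      using that by (auto simp: path_class_def)
    have "homotopic_paths X (g \<circ> q) (g \<circ> q')"
      using h(2) continuous_G[OF p(5)] image_G[OF p(5)]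
      by (intro homotopic_paths_continuous_image[of X q]) (simp_all add: image_subset_iff_funcset)
    then have "homotopic_paths X (p +++ (g \<circ> q)) (p' +++ (g \<circ> q'))"
      using h(1) p(6) by (intro homotopic_paths_join) (simp_all add: pathstart_compose)
    then show ?thesis by (simp add: path_class_eqI)
  qed
  moreover have "p \<in> path_class X p" "q \<in> path_class X q"
    using p by (simp_all add: path_class_def)
  ultimately have "(\<Union>p'\<in>path_class X p. \<Union>q'\<in>path_class X q. path_class X (p' +++ (g \<circ> q'))) =
      path_class X (p +++ (g \<circ> q))"
    by blast
  then show ?thesis
    by (simp add: orbifold_pi1_def)
qed

lemma one_pi1: "\<one>\<^bsub>pi1\<^esub> = (id, path_class X (linepath x0 x0))"
  by (simp add: orbifold_pi1_def linepath_refl)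

lemma lift_path_one: "lift_path id (linepath x0 x0)"
  using base_in by (simp add: lift_path_def id_G)

text \<open>The inverse element: \<open>p\<close> leads from \<open>x0\<close> to
  \<open>g x0\<close>, so its reverse, carried back by the inverse of \<open>g\<close>, leads from
  \<open>x0\<close> to the image of \<open>x0\<close> under that inverse.\<close>

lemma lift_path_inv:
  assumes "lift_path g p"
  shows "lift_path (inv_into UNIV g) (inv_into UNIV g \<circ> reversepath p)"
  using assms bij_G[of g] unfolding lift_path_def
  by (auto simp: path_G path_image_G inv_G pathstart_compose pathfinish_compose bij_is_inj)

lemma group_pi1: "group pi1"
proof (rule groupI)
  show "\<one>\<^bsub>pi1\<^esub> \<in> carrier pi1"
    using lift_path_one by (auto simp: one_pi1 carrier_pi1)
next
  fix x y assume "x \<in> carrier pi1" "y \<in> carrier pi1"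
  then show "x \<otimes>\<^bsub>pi1\<^esub> y \<in> carrier pi1"
    using lift_path_comp by (force simp: carrier_pi1 mult_pi1)
next
  fix x y z assume "x \<in> carrier pi1" "y \<in> carrier pi1" "z \<in> carrier pi1"
  then obtain g p h q k r where xyz: "x = (g, path_class X p)" "lift_path g p"
    "y = (h, path_class X q)" "lift_path h q" "z = (k, path_class X r)" "lift_path k r"
    by (auto simp: carrier_pi1)
  have G: "g \<in> G" "h \<in> G" "k \<in> G" using xyz by (auto simp: lift_path_def)
  have "path p" "path (g \<circ> q)" "path (g \<circ> (h \<circ> r))"
    "pathfinish p = pathstart (g \<circ> q)" "pathfinish (g \<circ> q) = pathstart (g \<circ> (h \<circ> r))"
    using xyz(2,4,6) G unfolding lift_path_def
    by (simp_all add: path_G path_image_G pathstart_compose pathfinish_compose)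
  then have "path_class X ((p +++ (g \<circ> q)) +++ (g \<circ> (h \<circ> r))) = path_class X (p +++ (g \<circ> q) +++ (g \<circ> (h \<circ> r)))"
    by (simp add: path_class_join class_join_assoc)
  then show "x \<otimes>\<^bsub>pi1\<^esub> y \<otimes>\<^bsub>pi1\<^esub> z = x \<otimes>\<^bsub>pi1\<^esub> (y \<otimes>\<^bsub>pi1\<^esub> z)"
    unfolding xyz mult_pi1[OF xyz(2) xyz(4)] mult_pi1[OF xyz(4) xyz(6)]
      mult_pi1[OF lift_path_comp[OF xyz(2) xyz(4)] xyz(6)] mult_pi1[OF xyz(2) lift_path_comp[OF xyz(4) xyz(6)]]
    by (simp add: path_compose_join comp_assoc)
next
  fix x assume "x \<in> carrier pi1"
  then obtain g p where x: "x = (g, path_class X p)" "lift_path g p"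
    by (auto simp: carrier_pi1)
  then show "\<one>\<^bsub>pi1\<^esub> \<otimes>\<^bsub>pi1\<^esub> x = x"
    by (simp add: one_pi1 mult_pi1 lift_path_one) (simp add: path_class_join class_join_lid lift_path_def)
  have [simp]: "inv_into UNIV g \<circ> g = id"
    using x bij_G[of g] by (auto simp: lift_path_def bij_is_inj)
  have p: "path p" "path_image p \<subseteq> X" "g \<in> G" "pathstart p = x0" "pathfinish p = g x0"
    using x by (auto simp: lift_path_def)
  have "path_class X (reversepath p +++ p) = path_class X (linepath (g x0) (g x0))"
    using homotopic_paths_linv[of p X] p by (intro path_class_eqI) auto
  then have "path_class X (inv_into UNIV g \<circ> (reversepath p +++ p)) = path_class X (inv_into UNIV g \<circ> linepath (g x0) (g x0))"
    using p by (intro path_class_G) (auto simp: inv_G subset_path_image_join)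
  also have "inv_into UNIV g \<circ> linepath (g x0) (g x0) = linepath x0 x0"
    using p bij_G[of g] by (simp add: linepath_refl fun_eq_iff bij_is_inj)
  finally have "(inv_into UNIV g, path_class X (inv_into UNIV g \<circ> reversepath p)) \<otimes>\<^bsub>pi1\<^esub> x = \<one>\<^bsub>pi1\<^esub>"
    unfolding x(1) mult_pi1[OF lift_path_inv[OF x(2)] x(2)] one_pi1
    by (simp add: path_compose_join linepath_refl)
  then show "\<exists>y\<in>carrier pi1. y \<otimes>\<^bsub>pi1\<^esub> x = \<one>\<^bsub>pi1\<^esub>"
    using lift_path_inv[OF x(2)] by (intro bexI) (auto simp: carrier_pi1)
qed

text \<open>The paths \<open>p\<close> and \<open>q\<close> stand for points of the universal covering; the relation says that
  \<open>g\<close> identifies their images in its quotient by \<open>N\<close>.\<close>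

definition rel :: "(('a \<Rightarrow> 'a) \<times> (real \<Rightarrow> 'a) set) set \<Rightarrow> ('a \<Rightarrow> 'a) \<Rightarrow> (real \<Rightarrow> 'a) \<Rightarrow> (real \<Rightarrow> 'a) \<Rightarrow> bool"
  where "rel N g p q \<longleftrightarrow> g \<in> G \<and> path p \<and> path_image p \<subseteq> X \<and> pathstart p = x0 \<and>
     path q \<and> path_image q \<subseteq> X \<and> pathstart q = x0 \<and> pathfinish p = g (pathfinish q) \<and>
     (g, path_class X (p +++ reversepath (g \<circ> q))) \<in> N"

lemma path_class_eqD:
  assumes "path_class X p = path_class X q" "path p" "path_image p \<subseteq> X"
  shows "path q" "path_image q \<subseteq> X" "pathstart q = pathstart p" "pathfinish q = pathfinish p"
    "path_class X (reversepath q) = path_class X (reversepath p)"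
proof -
  have h: "homotopic_paths X p q" using assms by (simp add: path_class_eq_iff)
  show "path q" "path_image q \<subseteq> X" "pathstart q = pathstart p" "pathfinish q = pathfinish p"
    using homotopic_paths_imp_path[OF h] homotopic_paths_imp_subset[OF h]
      homotopic_paths_imp_pathstart[OF h] homotopic_paths_imp_pathfinish[OF h] by simp_all
  show "path_class X (reversepath q) = path_class X (reversepath p)"
    using homotopic_paths_reversepath_D[OF h] by (simp add: path_class_eqI)
qed

lemma rel_cong:
  assumes rel: "rel N g p q" and p: "path_class X p = path_class X p'" and q: "path_class X q = path_class X q'"
  shows "rel N g p' q'"
proof -
  have r: "g \<in> G" "path p" "path_image p \<subseteq> X" "pathstart p = x0" "path q" "path_image q \<subseteq> X"
     "pathstart q = x0" "pathfinish p = g (pathfinish q)" 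
     "(g, path_class X (p +++ reversepath (g \<circ> q))) \<in> N"
    using rel by (simp_all add: rel_def)
  note p' = path_class_eqD[OF p r(2,3)] and q' = path_class_eqD[OF q r(5,6)]
  have gq: "path_class X (g \<circ> q) = path_class X (g \<circ> q')"
    by (rule path_class_G) (use r q in simp_all)
  have "path_class X (p +++ reversepath (g \<circ> q)) = path_class X (p' +++ reversepath (g \<circ> q'))"
    using r p' q' path_class_eqD(5)[OF gq] p
    by (simp add: path_class_join path_G path_image_G pathfinish_compose)
  then show ?thesis using r p' q' by (simp add: rel_def)
qed

text \<open>In the witnessing element the new piece \<open>g \<circ> c\<close> is traversed and at
  once retraced, so it is the same element of \<open>N\<close> as before.\<close>

lemma rel_extend:
  assumes rel: "rel N g p q" and c: "path c" "path_image c \<subseteq> X" "pathstart c = pathfinish q"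
  shows "rel N g (p +++ (g \<circ> c)) (q +++ c)"
proof -
  have r: "g \<in> G" "path p" "path_image p \<subseteq> X" "pathstart p = x0" "path q" "path_image q \<subseteq> X"
     "pathstart q = x0" "pathfinish p = g (pathfinish q)" 
     "(g, path_class X (p +++ reversepath (g \<circ> q))) \<in> N"
    using rel by (simp_all add: rel_def)
  have "path_class X ((p +++ (g \<circ> c)) +++ reversepath (g \<circ> (q +++ c))) = path_class X (p +++ reversepath (g \<circ> q))"
    using r c by (simp add: path_compose_join reversepath_joinpaths path_class_join path_G path_image_G 
      pathfinish_compose pathstart_compose class_join_assoc class_join_cancel)
  then show ?thesis using r c
    by (simp add: rel_def path_G path_image_G pathfinish_compose pathstart_compose subset_path_image_join)
qed

text \<open>The new witness is the product of the two old ones, in which the pieces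
  \<open>g \<circ> q\<close> and its reverse cancel.\<close>

lemma rel_trans:
  assumes N: "subgroup N pi1" and rel1: "rel N g p q" and rel2: "rel N h q s"
  shows "rel N (g \<circ> h) p s"
proof -
  have r: "g \<in> G" "path p" "path_image p \<subseteq> X" "pathstart p = x0" "path q" "path_image q \<subseteq> X"
     "pathstart q = x0" "pathfinish p = g (pathfinish q)" 
     "(g, path_class X (p +++ reversepath (g \<circ> q))) \<in> N"
    using rel1 by (simp_all add: rel_def)
  have r': "h \<in> G" "path s" "path_image s \<subseteq> X" "pathstart s = x0" "pathfinish q = h (pathfinish s)" 
     "(h, path_class X (q +++ reversepath (h \<circ> s))) \<in> N"
    using rel2 by (simp_all add: rel_def)
  have l: "lift_path g (p +++ reversepath (g \<circ> q))" "lift_path h (q +++ reversepath (h \<circ> s))"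
    unfolding lift_path_def using r r'
    by (simp_all add: path_G path_image_G pathfinish_compose pathstart_compose subset_path_image_join)
  have "path_class X ((p +++ reversepath (g \<circ> q)) +++ (g \<circ> (q +++ reversepath (h \<circ> s)))) =
      path_class X (p +++ reversepath (g \<circ> h \<circ> s))"
    using r r' by (simp add: path_compose_join path_compose_reversepath path_class_join path_G path_image_G 
      pathfinish_compose pathstart_compose class_join_assoc class_join_cancel' comp_assoc)
  then have "(g \<circ> h, path_class X (p +++ reversepath (g \<circ> h \<circ> s))) \<in> N"
    using subgroup.m_closed[OF N r(9) r'(6)] by (simp add: mult_pi1[OF l])
  then show ?thesis using r r' by (simp add: rel_def comp_G)
qed

text \<open>How the relation ends in an equality of cosets: \<open>s\<close> completes
  \<open>q\<close> to a group element, and the element on the left is the witness in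
  \<open>N\<close> times the one on the right.\<close>

lemma rel_coset:
  assumes N: "subgroup N pi1" and rel: "rel N g p q" 
    and s: "path s" "path_image s \<subseteq> X" "pathstart s = pathfinish q" "pathfinish s = h x0" and h: "h \<in> G"
  shows "N #>\<^bsub>pi1\<^esub> (g \<circ> h, path_class X (p +++ (g \<circ> s))) = N #>\<^bsub>pi1\<^esub> (h, path_class X (q +++ s))"
proof -
  interpret group pi1 by (rule group_pi1)
  have r: "g \<in> G" "path p" "path_image p \<subseteq> X" "pathstart p = x0" "path q" "path_image q \<subseteq> X"
     "pathstart q = x0" "pathfinish p = g (pathfinish q)" 
     "(g, path_class X (p +++ reversepath (g \<circ> q))) \<in> N"
    using rel by (simp_all add: rel_def)
  have l: "lift_path g (p +++ reversepath (g \<circ> q))" "lift_path h (q +++ s)"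
    unfolding lift_path_def using r s h
    by (simp_all add: path_G path_image_G pathfinish_compose pathstart_compose subset_path_image_join)
  have "path_class X ((p +++ reversepath (g \<circ> q)) +++ (g \<circ> (q +++ s))) = path_class X (p +++ (g \<circ> s))"
    using r s by (simp add: path_compose_join path_class_join path_G path_image_G 
      pathfinish_compose pathstart_compose class_join_assoc class_join_cancel')
  then have "(g \<circ> h, path_class X (p +++ (g \<circ> s))) =
      (g, path_class X (p +++ reversepath (g \<circ> q))) \<otimes>\<^bsub>pi1\<^esub> (h, path_class X (q +++ s))"
    by (simp add: mult_pi1[OF l])
  also have "N #>\<^bsub>pi1\<^esub> \<dots> = N #>\<^bsub>pi1\<^esub> (g, path_class X (p +++ reversepath (g \<circ> q))) #>\<^bsub>pi1\<^esub> (h, path_class X (q +++ s))"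
    using subgroup.subset[OF N] l by (intro coset_mult_assoc[symmetric]) (auto simp: carrier_pi1)
  also have "N #>\<^bsub>pi1\<^esub> (g, path_class X (p +++ reversepath (g \<circ> q))) = N"
    using N r(9) by (rule subgroup.rcos_const[OF _ group_pi1])
  finally show ?thesis .
qed

end

section \<open>Translations and straight loops\<close>

definition shift :: "'a::real_normed_vector \<Rightarrow> 'a \<Rightarrow> 'a" where
  "shift w = (\<lambda>z. z + w)"

lemma shift_apply [simp]: "shift w z = z + w"
  by (simp add: shift_def)

lemma shift_comp: "shift v \<circ> shift w = shift (v + w)"
  by (auto simp: shift_def algebra_simps)

lemma shift_comp_assoc: "shift v \<circ> (shift w \<circ> f) = shift (v + w) \<circ> f"
  by (auto simp: shift_def algebra_simps)

lemma shift_0: "shift 0 = id"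
  by (auto simp: shift_def)

lemma shift_linepath: "shift w \<circ> linepath a b = linepath (a + w) (b + w)"
  by (auto simp: linepath_def algebra_simps fun_eq_iff simp flip: scaleR_add_left)

lemma path_shift [simp]: "path p \<Longrightarrow> path (shift w \<circ> p)"
  by (intro path_continuous_image) (auto simp: shift_def intro!: continuous_intros)

definition line :: "'a::real_normed_vector \<Rightarrow> 'a \<Rightarrow> 'a set" where
  "line z w = range (\<lambda>t. z + t *\<^sub>R w)"

lemma convex_line: "convex (line z w)"
proof (rule convexI)
  fix x y and u v :: real
  assume "x \<in> line z w" "y \<in> line z w" and uv: "u + v = 1"
  then obtain s t where st: "x = z + s *\<^sub>R w" "y = z + t *\<^sub>R w" by (auto simp: line_def)
  have "u *\<^sub>R x + v *\<^sub>R y = (u + v) *\<^sub>R z + (u * s + v * t) *\<^sub>R w"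
    by (simp add: st algebra_simps)
  then show "u *\<^sub>R x + v *\<^sub>R y \<in> line z w" using uv by (auto simp: line_def)
qed

lemma in_line: "z + t *\<^sub>R w \<in> line z w" "z \<in> line z w" "z + w \<in> line z w"
  unfolding line_def using rangeI[of "\<lambda>t. z + t *\<^sub>R w" 0] rangeI[of "\<lambda>t. z + t *\<^sub>R w" 1] by auto

context orbifold
begin

text \<open>The element represented by the image of the segment from the endpoint of \<open>c\<close> to its
  translate by \<open>w\<close>, joined to the base point by \<open>c\<close>.\<close>

definition seg_loop :: "'a \<Rightarrow> (real \<Rightarrow> 'a) \<Rightarrow> ('a \<Rightarrow> 'a) \<times> (real \<Rightarrow> 'a) set" where
  "seg_loop w c = (shift w, path_class X (c +++ linepath (pathfinish c) (pathfinish c + w) +++ reversepath (shift w \<circ> c)))"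

text \<open>The conditions on \<open>c\<close> under which all segments in direction \<open>w\<close> from its endpoint avoid the
  punctures.\<close>

definition tail :: "'a \<Rightarrow> (real \<Rightarrow> 'a) \<Rightarrow> bool" where
  "tail w c \<longleftrightarrow> shift w \<in> G \<and> path c \<and> path_image c \<subseteq> X \<and> pathstart c = x0 \<and>
     (\<forall>t. pathfinish c + t *\<^sub>R w \<in> X)"

lemma shift_image: "shift w \<in> G \<Longrightarrow> path_image c \<subseteq> X \<Longrightarrow> path_image (shift w \<circ> c) \<subseteq> X"
  by (rule path_image_G)

lemma closed_segment_tail:
  assumes "tail w c" shows "closed_segment (pathfinish c + s *\<^sub>R w) (pathfinish c + t *\<^sub>R w) \<subseteq> X"
proof
  fix z assume "z \<in> closed_segment (pathfinish c + s *\<^sub>R w) (pathfinish c + t *\<^sub>R w)"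
  then obtain u where "z = (1 - u) *\<^sub>R (pathfinish c + s *\<^sub>R w) + u *\<^sub>R (pathfinish c + t *\<^sub>R w)"
    by (auto simp: in_segment)
  then have "z = pathfinish c + ((1 - u) * s + u * t) *\<^sub>R w" by (simp add: algebra_simps)
  then show "z \<in> X" using assms by (simp add: tail_def)
qed

lemma lift_path_seg_loop:
  assumes "tail w c"
  shows "lift_path (shift w) (c +++ linepath (pathfinish c) (pathfinish c + w) +++ reversepath (shift w \<circ> c))"
  using assms closed_segment_tail[OF assms, of 0 1] unfolding lift_path_def tail_def
  by (simp add: shift_image pathfinish_compose pathstart_compose subset_path_image_join)

lemma seg_loop_carrier: "tail w c \<Longrightarrow> seg_loop w c \<in> carrier pi1"
  using lift_path_seg_loop[of w c] by (auto simp: seg_loop_def carrier_pi1)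

lemma line_tail: "tail w c \<Longrightarrow> line (pathfinish c) w \<subseteq> X"
  by (auto simp: line_def tail_def)

text \<open>The added pieces and the segment all lie on one line inside \<open>X\<close>, which is
  convex, so they merge. This frees the starting point, which is later placed on a chosen lattice
  line.\<close>

lemma tail_slide:
  assumes "tail w c" 
  shows "tail w (c +++ linepath (pathfinish c) (pathfinish c + t *\<^sub>R w))"
    and "seg_loop w (c +++ linepath (pathfinish c) (pathfinish c + t *\<^sub>R w)) = seg_loop w c"
proof -
  let ?z = "pathfinish c"
  show "tail w (c +++ linepath ?z (?z + t *\<^sub>R w))"
    using assms closed_segment_tail[OF assms, of 0 t]
    by (auto simp: tail_def subset_path_image_join add.assoc simp flip: scaleR_add_left)
  have c: "path c" "path_image c \<subseteq> X" "pathstart c = x0" "shift w \<in> G"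
    using assms by (simp_all add: tail_def)
  have l: "?z + (t *\<^sub>R w + w) \<in> line ?z w"
    using in_line(1)[of ?z "t + 1" w] by (simp add: scaleR_add_left)
  note L = class_join_linepath[OF convex_line line_tail[OF assms]]
  have "class_join X (path_class X (linepath ?z (?z + t *\<^sub>R w)))
     (class_join X (path_class X (linepath (?z + t *\<^sub>R w) (?z + (t *\<^sub>R w + w))))
       (path_class X (linepath (?z + (t *\<^sub>R w + w)) (?z + w)))) = path_class X (linepath ?z (?z + w))"
    by (simp add: L in_line l)
  then have "class_join X (path_class X (linepath ?z (?z + t *\<^sub>R w)))
     (class_join X (path_class X (linepath (?z + t *\<^sub>R w) (?z + (t *\<^sub>R w + w))))
       (class_join X (path_class X (linepath (?z + (t *\<^sub>R w + w)) (?z + w))) C)) = 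
       class_join X (path_class X (linepath ?z (?z + w))) C" for C
    by (simp flip: class_join_assoc)
  with c show "seg_loop w (c +++ linepath ?z (?z + t *\<^sub>R w)) = seg_loop w c"
    by (simp add: seg_loop_def path_compose_join reversepath_joinpaths path_class_join pathfinish_compose
        pathstart_compose shift_linepath class_join_assoc add.assoc)
qed

text \<open>The return path of the first factor cancels against the translated outgoing path of the
  second, and the two segments join on the common line.\<close>

lemma seg_loop_mult:
  assumes c: "tail w c" and G: "shift (a *\<^sub>R w) \<in> G" "shift (b *\<^sub>R w) \<in> G"
  shows "seg_loop (a *\<^sub>R w) c \<otimes>\<^bsub>pi1\<^esub> seg_loop (b *\<^sub>R w) c = seg_loop ((a + b) *\<^sub>R w) c"
proof -
  let ?z = "pathfinish c"
  have t: "tail (s *\<^sub>R w) c" if "shift (s *\<^sub>R w) \<in> G" for s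
    using c that by (simp add: tail_def)
  note L = class_join_linepath[OF convex_line line_tail[OF c]]
  have e: "?z + (a + b) *\<^sub>R w = ?z + (b *\<^sub>R w + a *\<^sub>R w)" by (simp add: algebra_simps)
  have l: "?z + a *\<^sub>R w \<in> line ?z w" "?z + (b *\<^sub>R w + a *\<^sub>R w) \<in> line ?z w"
    using in_line(1)[of ?z "a + b" w] unfolding e by (simp_all add: in_line)
  have *: "class_join X (path_class X (linepath ?z (?z + a *\<^sub>R w)))
     (class_join X (path_class X (linepath (?z + a *\<^sub>R w) (?z + (b *\<^sub>R w + a *\<^sub>R w)))) C) =
      class_join X (path_class X (linepath ?z (?z + (b *\<^sub>R w + a *\<^sub>R w)))) C" for C
    by (subst L[symmetric, of ?z "?z + a *\<^sub>R w"]) (simp_all add: in_line l class_join_assoc)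
  have cc: "path c" "path_image c \<subseteq> X" "pathstart c = x0" using c by (simp_all add: tail_def)
  show ?thesis
    unfolding seg_loop_def mult_pi1[OF lift_path_seg_loop[OF t[OF G(1)]] lift_path_seg_loop[OF t[OF G(2)]]]
    using cc G
    by (simp add: e path_compose_join path_compose_reversepath path_class_join pathfinish_compose
        pathstart_compose shift_linepath class_join_assoc add.assoc shift_comp shift_comp_assoc * shift_image
        class_join_cancel_assoc' scaleR_add_left add.commute[of "a *\<^sub>R w" "b *\<^sub>R w"])
qed

lemma shift_scale_G:
  assumes "shift w \<in> G" shows "shift (real j *\<^sub>R w) \<in> G"
proof (induction j)
  case 0 then show ?case using id_G by (simp add: shift_0 id_def)
next
  case (Suc j)
  then have "shift w \<circ> shift (real j *\<^sub>R w) \<in> G" using assms comp_G by blast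
  moreover have "w + real j *\<^sub>R w = real (Suc j) *\<^sub>R w" by (simp add: scaleR_add_left)
  ultimately show ?case by (simp only: shift_comp)
qed

lemma seg_loop_pow:
  assumes c: "tail w c"
  shows "seg_loop w c [^]\<^bsub>pi1\<^esub> j = seg_loop (real j *\<^sub>R w) c"
proof (induction j)
  case 0
  have "path c" "path_image c \<subseteq> X" "pathstart c = x0" using c by (simp_all add: tail_def)
  then have "path_class X (c +++ linepath (pathfinish c) (pathfinish c) +++ reversepath c) = path_class X (linepath x0 x0)"
    by (simp add: path_class_join class_join_lid path_class_rinv)
  then show ?case by (simp add: one_pi1 seg_loop_def shift_0)
next
  case (Suc j)
  have "seg_loop (real j *\<^sub>R w) c \<otimes>\<^bsub>pi1\<^esub> seg_loop (1 *\<^sub>R w) c = seg_loop ((real j + 1) *\<^sub>R w) c"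
    using c by (intro seg_loop_mult) (simp_all add: tail_def shift_scale_G)
  then show ?case using Suc
    by (simp add: add.commute)
qed

text \<open>One step of the comparison of two lines: a segment of the first line is moved by \<open>a\<close> up to its
  interior point \<open>y\<close> and by \<open>b\<close> from there on; the jump at \<open>y\<close> costs an element of \<open>N\<close>, and
  everything else happens in the convex set \<open>C\<close>.\<close>

lemma rel_step:
  assumes N: "subgroup N pi1"
    and rel: "rel N (shift a) (c' +++ linepath z0' z' +++ linepath z' (z + a)) (c +++ linepath z0 z)"
    and c: "path c" "pathfinish c = z0" and c': "path c'" "pathfinish c' = z0'"
    and L: "convex L" "L \<subseteq> X" "z0 \<in> L" "z \<in> L" "y \<in> L" "z1 \<in> L"
    and L': "convex L'" "L' \<subseteq> X" "z0' \<in> L'" "z' \<in> L'" "z1' \<in> L'"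
    and C: "convex C" "C \<subseteq> X" "z' \<in> C" "z + a \<in> C" "y + a \<in> C" "y + b \<in> C" "z1 + b \<in> C" "z1' \<in> C"
    and vert: "\<And>p. path p \<Longrightarrow> path_image p \<subseteq> X \<Longrightarrow> pathstart p = x0 \<Longrightarrow> pathfinish p = y + a \<Longrightarrow>
       rel N (shift (b - a)) (p +++ linepath (y + a) (y + b)) p"
  shows "rel N (shift b) (c' +++ linepath z0' z1' +++ linepath z1' (z1 + b)) (c +++ linepath z0 z1)"
proof -
  let ?p = "c' +++ linepath z0' z' +++ linepath z' (z + a)" and ?q = "c +++ linepath z0 z"
  let ?p1 = "?p +++ linepath (z + a) (y + a)" and ?q1 = "?q +++ linepath z y"
  let ?p2 = "?p1 +++ linepath (y + a) (y + b)"
  have "rel N (shift a) (?p +++ (shift a \<circ> linepath z y)) ?q1"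
    by (rule rel_extend[OF rel]) (use L closed_segment_subset[of z L y] in simp_all)
  then have r1: "rel N (shift a) ?p1 ?q1" by (simp add: shift_linepath)
  have "rel N (shift (b - a)) ?p2 ?p1"
    by (rule vert) (use r1 in \<open>simp_all add: rel_def\<close>)
  from rel_trans[OF N this r1] have r2: "rel N (shift b) ?p2 ?q1"
    by (simp add: shift_comp)
  have "rel N (shift b) (?p2 +++ (shift b \<circ> linepath y z1)) (?q1 +++ linepath y z1)"
    by (rule rel_extend[OF r2]) (use L closed_segment_subset[of y L z1] in simp_all)
  then have r3: "rel N (shift b) (?p2 +++ linepath (y + b) (z1 + b)) (?q1 +++ linepath y z1)"
    by (simp add: shift_linepath)
  note jL = class_join_linepath[OF L(1,2)] and jL' = class_join_linepath[OF L'(1,2)]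
    and jC = class_join_linepath[OF C(1,2)]
  show ?thesis
  proof (rule rel_cong[OF r3])
    show "path_class X (?q1 +++ linepath y z1) = path_class X (c +++ linepath z0 z1)"
      using c L by (simp add: path_class_join class_join_assoc jL)
    \<comment> \<open>The broken path from \<open>z'\<close> to \<open>z1 + b\<close> stays in
      \<open>C\<close>, so it collapses to one segment. This segment is rerouted through
      \<open>z1'\<close>, and the piece from \<open>z0'\<close> through \<open>z'\<close> to
      \<open>z1'\<close> straightens on \<open>L'\<close>.\<close>
    have "class_join X (path_class X (linepath z0' z')) (path_class X (linepath z' (z1 + b)))
      = class_join X (path_class X (linepath z0' z1')) (path_class X (linepath z1' (z1 + b)))"
      using jC[of z' z1' "z1 + b"] jL'[of z0' z' z1'] C L' by (metis class_join_assoc)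
    then show "path_class X (?p2 +++ linepath (y + b) (z1 + b)) = 
        path_class X (c' +++ linepath z0' z1' +++ linepath z1' (z1 + b))"
      using c' C by (simp add: path_class_join class_join_assoc jC)
  qed
qed

end

section \<open>Twisting lines in the punctured plane\<close>

definition cross :: "plane \<Rightarrow> plane \<Rightarrow> real" where
  "cross z w = fst z * snd w - snd z * fst w"

lemma cross_simps [simp]:
  "cross z (a + b) = cross z a + cross z b" "cross (a + b) z = cross a z + cross b z"
  "cross z (a - b) = cross z a - cross z b" "cross (a - b) z = cross a z - cross b z"
  "cross z (t *\<^sub>R a) = t * cross z a" "cross (t *\<^sub>R a) z = t * cross a z" "cross z z = 0"
  "cross z (- a) = - cross z a" "cross (- a) z = - cross a z" "cross z 0 = 0" "cross 0 z = 0"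
  by (simp_all add: cross_def algebra_simps)

text \<open>Cramer's rule. Throughout, \<open>cross z w\<close> is the coordinate of
  \<open>z\<close> along \<open>u\<close>, which locates the gaps, and \<open>cross u z\<close> is
  the one along \<open>w\<close>, whose integral values number the lattice lines parallel to
  \<open>u\<close>.\<close>

lemma cross_decomp:
  assumes "cross u w = 1"
  shows "z = cross z w *\<^sub>R u + cross u z *\<^sub>R w"
proof (cases z, cases u, cases w)
  fix z1 z2 u1 u2 w1 w2 assume z: "z = (z1, z2)" "u = (u1, u2)" "w = (w1, w2)"
  have 1: "u1 * w2 - u2 * w1 = 1" using assms z by (simp add: cross_def)
  have "(z1 * w2 - z2 * w1) * u1 + (u1 * z2 - u2 * z1) * w1 = z1 * (u1 * w2 - u2 * w1)"
    "(z1 * w2 - z2 * w1) * u2 + (u1 * z2 - u2 * z1) * w2 = z2 * (u1 * w2 - u2 * w1)"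
    by algebra+
  then show ?thesis using 1 z by (simp add: cross_def)
qed

lemma Ints_cross: "u \<in> \<int> \<times> \<int> \<Longrightarrow> w \<in> \<int> \<times> \<int> \<Longrightarrow> cross u w \<in> \<int>"
  by (auto simp: cross_def)

lemma lattice_scale: "t \<in> \<int> \<Longrightarrow> (u::plane) \<in> \<int> \<times> \<int> \<Longrightarrow> t *\<^sub>R u \<in> \<int> \<times> \<int>"
  by (auto simp: mem_Times_iff)

lemma lattice_add: "(u::plane) \<in> \<int> \<times> \<int> \<Longrightarrow> w \<in> \<int> \<times> \<int> \<Longrightarrow> u + w \<in> \<int> \<times> \<int>"
  by (auto simp: mem_Times_iff)

lemma in_lattice_iff:
  assumes "cross u w = 1" "u \<in> \<int> \<times> \<int>" "w \<in> \<int> \<times> \<int>"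
  shows "z \<in> \<int> \<times> \<int> \<longleftrightarrow> cross u z \<in> \<int> \<and> cross z w \<in> \<int>"
proof
  assume "z \<in> \<int> \<times> \<int>"
  then show "cross u z \<in> \<int> \<and> cross z w \<in> \<int>" using Ints_cross assms by blast
next
  assume "cross u z \<in> \<int> \<and> cross z w \<in> \<int>"
  then have "cross z w *\<^sub>R u + cross u z *\<^sub>R w \<in> \<int> \<times> \<int>"
    using assms by (intro lattice_add lattice_scale) simp_all
  then show "z \<in> \<int> \<times> \<int>" using cross_decomp[OF assms(1), of z] by simp
qed

text \<open>The open strip between two consecutive lattice lines parallel to \<open>u\<close>, together with an open
  gap between consecutive lattice points on either of them.\<close>

definition strip :: "plane \<Rightarrow> plane \<Rightarrow> real \<Rightarrow> real \<Rightarrow> int \<Rightarrow> int \<Rightarrow> plane set" where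
  "strip u w e d f g = {z. 0 \<le> e * cross u z - d \<and> e * cross u z - d \<le> 1 \<and>
     (e * cross u z - d = 0 \<longrightarrow> of_int f < cross z w \<and> cross z w < of_int f + 1) \<and>
     (e * cross u z - d = 1 \<longrightarrow> of_int g < cross z w \<and> cross z w < of_int g + 1)}"

text \<open>The height over the lower boundary line is affine with values in \<open>[0, 1]\<close>.
  A proper convex combination can reach 0 or 1 only if both points do, and then both lie in the same
  gap, an interval.\<close>

lemma convex_strip: "convex (strip u w e d f g)"
proof (rule convexI)
  fix x y and a b :: real
  assume xy: "x \<in> strip u w e d f g" "y \<in> strip u w e d f g" and ab: "0 \<le> a" "0 \<le> b" "a + b = 1"
  define t where "t z = e * cross u z - d" for z
  have t: "t (a *\<^sub>R x + b *\<^sub>R y) = a * t x + b * t y"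
  proof -
    have "d = (a + b) * d" using ab(3) by simp
    then show ?thesis unfolding t_def by (simp add: algebra_simps)
  qed
  have S: "z \<in> strip u w e d f g \<longleftrightarrow> 0 \<le> t z \<and> t z \<le> 1 \<and> (t z = 0 \<longrightarrow> of_int f < cross z w \<and> cross z w < of_int f + 1) \<and>
     (t z = 1 \<longrightarrow> of_int g < cross z w \<and> cross z w < of_int g + 1)" for z
    by (simp add: strip_def t_def)
  consider "a = 0" "b = 1" | "b = 0" "a = 1" | "a > 0" "b > 0" using ab by fastforce
  then show "a *\<^sub>R x + b *\<^sub>R y \<in> strip u w e d f g"
  proof cases
    case 3
    have mix: "l < a * p + b * q \<and> a * p + b * q < h" if "l < p" "p < h" "l < q" "q < h" for l h p q
    proof -
      have "a * l < a * p" "b * l < b * q" "a * p < a * h" "b * q < b * h" using 3 that by simp_all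
      moreover have "a * l + b * l = l" "a * h + b * h = h" using ab(3) by (simp_all flip: distrib_right)
      ultimately show ?thesis by linarith
    qed
    have *: "0 \<le> a * t x" "0 \<le> b * t y" "a * t x \<le> a" "b * t y \<le> b"
      using xy 3 by (simp_all add: S)
    have z: "t x = 0 \<and> t y = 0" if "a * t x + b * t y = 0"
    proof -
      have "a * t x = 0 \<and> b * t y = 0" using * that by linarith
      then show ?thesis using 3 by simp
    qed
    have o: "t x = 1 \<and> t y = 1" if "a * t x + b * t y = 1"
    proof -
      have "a * t x = a \<and> b * t y = b" using * that ab(3) by linarith
      then show ?thesis using 3 by simp
    qed
    have "0 \<le> a * t x + b * t y" "a * t x + b * t y \<le> 1" using * ab(3) by linarith+
    moreover have "of_int f < cross (a *\<^sub>R x + b *\<^sub>R y) w \<and> cross (a *\<^sub>R x + b *\<^sub>R y) w < of_int f + 1"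
      if "a * t x + b * t y = 0"
      using z[OF that] xy mix[of "of_int f" "cross x w" "of_int f + 1" "cross y w"] by (simp add: S)
    moreover have "of_int g < cross (a *\<^sub>R x + b *\<^sub>R y) w \<and> cross (a *\<^sub>R x + b *\<^sub>R y) w < of_int g + 1"
      if "a * t x + b * t y = 1"
      using o[OF that] xy mix[of "of_int g" "cross x w" "of_int g + 1" "cross y w"] by (simp add: S)
    ultimately show ?thesis
      unfolding S t by blast
  qed (use xy in simp_all)
qed

text \<open>A lattice point has integral height, so it would lie on one of the two boundary lines;
  but there the coordinate along \<open>u\<close> is strictly between consecutive integers.\<close>

lemma strip_subset_punctured:
  assumes "cross u w = 1" "u \<in> \<int> \<times> \<int>" "w \<in> \<int> \<times> \<int>" "e \<in> \<int>" "d \<in> \<int>"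
  shows "strip u w e d f g \<subseteq> punctured_plane"
proof
  fix z assume z: "z \<in> strip u w e d f g"
  have "z \<notin> \<int> \<times> \<int>"
  proof
    assume "z \<in> \<int> \<times> \<int>"
    then have i: "cross u z \<in> \<int>" "cross z w \<in> \<int>" using assms Ints_cross by simp_all
    have "e * cross u z - d \<in> \<int>" using i assms by simp
    then obtain k where k: "e * cross u z - d = of_int k" by (auto elim: Ints_cases)
    then have "k = 0 \<or> k = 1" using z by (auto simp: strip_def)
    moreover from i obtain l where l: "cross z w = of_int l" by (auto elim: Ints_cases)
    ultimately show False using z k by (auto simp: strip_def)
  qed
  then show "z \<in> punctured_plane" by (simp add: punctured_plane_def)
qed

context orbifold begin
lemma shift_int_G:
  assumes u: "shift u \<in> G" shows "shift (of_int l *\<^sub>R u) \<in> G"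
proof (cases "l \<ge> 0")
  case True
  then have "of_int l *\<^sub>R u = real (nat l) *\<^sub>R u" by simp
  then show ?thesis using shift_scale_G[OF u, of "nat l"] by presburger
next
  case False
  have "inv_into UNIV (shift u) = shift (- u)"
    by (rule Hilbert_Choice.inv_equality) simp_all
  then have u': "shift (- u) \<in> G" using inv_G[OF u] by presburger
  have "of_int l *\<^sub>R u = real (nat (- l)) *\<^sub>R (- u)" using False by simp
  then show ?thesis using shift_scale_G[OF u', of "nat (- l)"] by presburger
qed

text \<open>The bridge from elements of \<open>N\<close> to the relation: a point may be pushed once
  around a killed loop.\<close>

lemma rel_seg_loop:
  assumes t: "tail v p" and N: "seg_loop v p \<in> N"
  shows "rel N (shift v) (p +++ linepath (pathfinish p) (pathfinish p + v)) p"
proof -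
  have p: "path p" "path_image p \<subseteq> X" "pathstart p = x0" "shift v \<in> G"
    using t by (simp_all add: tail_def)
  have "path_class X ((p +++ linepath (pathfinish p) (pathfinish p + v)) +++ reversepath (shift v \<circ> p)) =
     path_class X (p +++ linepath (pathfinish p) (pathfinish p + v) +++ reversepath (shift v \<circ> p))"
    using p by (simp add: path_class_join class_join_assoc pathfinish_compose)
  then have "(shift v, path_class X ((p +++ linepath (pathfinish p) (pathfinish p + v)) +++ reversepath (shift v \<circ> p))) \<in> N"
    using N by (simp only: seg_loop_def)
  then show ?thesis
    unfolding rel_def using p closed_segment_tail[OF t, of 0 1]
    by (simp add: subset_path_image_join)
qed

lemma rel_refl:
  assumes "subgroup N pi1" "path p" "path_image p \<subseteq> X" "pathstart p = x0"
  shows "rel N id p p"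
  using assms subgroup.one_closed[OF assms(1)]
  unfolding rel_def by (simp add: one_pi1 id_G path_class_join path_class_rinv)

end

text \<open>The situation in which the loop of direction \<open>u\<close>, run through until it has translation part
  \<open>m u\<close>, is killed by \<open>N\<close>.\<close>

locale twist = orbifold punctured_plane G x0 for G x0 +
  fixes N :: "((plane \<Rightarrow> plane) \<times> (real \<Rightarrow> plane) set) set" and u w :: plane and m :: int
  assumes subgroup_N: "subgroup N pi1"
    and lattice_u: "u \<in> \<int> \<times> \<int>" and lattice_w: "w \<in> \<int> \<times> \<int>" and cross_u_w: "cross u w = 1"
    and shift_u: "shift (of_int m *\<^sub>R u) \<in> G"
    and seg_loop_u: "\<And>c l. tail (of_int (l * m) *\<^sub>R u) c \<Longrightarrow> cross u (pathfinish c) \<notin> \<int> \<Longrightarrow>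
          seg_loop (of_int (l * m) *\<^sub>R u) c \<in> N"
begin

text \<open>Off the lattice lines, the whole parallel to \<open>u\<close> through the endpoint
  avoids the punctures, so the segment runs along a killed loop. This supplies the jump in
  \<open>rel_step\<close>.\<close>

lemma rel_vertical:
  assumes p: "path p" "path_image p \<subseteq> punctured_plane" "pathstart p = x0" and y: "cross u (pathfinish p) \<notin> \<int>"
  shows "rel N (shift (of_int (l * m) *\<^sub>R u)) (p +++ linepath (pathfinish p) (pathfinish p + of_int (l * m) *\<^sub>R u)) p"
proof -
  have "pathfinish p + t *\<^sub>R v \<in> punctured_plane" if "v = of_int (l * m) *\<^sub>R u" for t v
    using y Ints_cross[OF lattice_u, of "pathfinish p + t *\<^sub>R v"] that by (auto simp: punctured_plane_def)
  moreover have "shift (of_int (l * m) *\<^sub>R u) \<in> G"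
    using shift_int_G[OF shift_u, of l] by simp
  ultimately have t: "tail (of_int (l * m) *\<^sub>R u) p" using p unfolding tail_def by blast
  from rel_seg_loop[OF t seg_loop_u[OF t y]] show ?thesis .
qed

end

section \<open>Comparison of two lines modulo the kernel\<close>

context twist
begin

lemma cross_not_Ints:
  "p \<in> punctured_plane \<Longrightarrow> cross u p \<in> \<int> \<Longrightarrow> cross p w \<notin> \<int>"
  using in_lattice_iff[OF cross_u_w lattice_u lattice_w] by (auto simp: punctured_plane_def)

lemma floor_gap:
  assumes "p \<in> punctured_plane" "cross u p \<in> \<int>"
  shows "of_int \<lfloor>cross p w\<rfloor> < cross p w" "cross p w < of_int \<lfloor>cross p w\<rfloor> + 1"
proof -
  have "cross p w \<noteq> of_int \<lfloor>cross p w\<rfloor>" using cross_not_Ints[OF assms] by (metis Ints_of_int)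
  then show "of_int \<lfloor>cross p w\<rfloor> < cross p w" using of_int_floor_le[of "cross p w"] by linarith
  show "cross p w < of_int \<lfloor>cross p w\<rfloor> + 1" by linarith
qed

text \<open>Travelling along two lines that cross the lattice lines parallel to \<open>u\<close> through gaps which
  differ by multiples of \<open>m\<close>: in each strip one may insert a translation by a multiple of
  \<open>m u\<close>, as the corresponding loops lie in \<open>N\<close>.\<close>

lemma rel_twist:
  assumes V: "cross u V' = cross u V" "cross u V \<noteq> 0" "cross u V \<in> \<int>"
    and c: "path c" "path_image c \<subseteq> punctured_plane" "pathstart c = x0" "cross u (pathfinish c) \<in> \<int>"
    and L: "\<And>t. pathfinish c + t *\<^sub>R V \<in> punctured_plane"
    and z0': "cross u z0' = cross u (pathfinish c)" and L': "\<And>t. z0' + t *\<^sub>R V' \<in> punctured_plane"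
    and k0: "k 0 = 0"
    and k: "\<And>j. \<lfloor>cross (z0' + (real j / \<bar>cross u V\<bar>) *\<^sub>R V') w\<rfloor> = 
        \<lfloor>cross (pathfinish c + (real j / \<bar>cross u V\<bar>) *\<^sub>R V) w\<rfloor> + k j * m"
  shows "path_image (linepath (pathfinish c) z0') \<subseteq> punctured_plane"
    and "rel N (shift (of_int (k j * m) *\<^sub>R u))
      ((c +++ linepath (pathfinish c) z0') +++ linepath z0' (z0' + (real j / \<bar>cross u V\<bar>) *\<^sub>R V') +++ 
         linepath (z0' + (real j / \<bar>cross u V\<bar>) *\<^sub>R V') 
           (pathfinish c + (real j / \<bar>cross u V\<bar>) *\<^sub>R V + of_int (k j * m) *\<^sub>R u))
      (c +++ linepath (pathfinish c) (pathfinish c + (real j / \<bar>cross u V\<bar>) *\<^sub>R V))"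
proof -
  define a where "a = cross u V"
  \<comment> \<open>The direction in which the lines cross the lattice lines; multiplied by
    \<open>e\<close>, the heights increase by 1 from each crossing to the next.\<close>
  define e where "e = sgn a"
  define z0 where "z0 = pathfinish c"
  define z where "z j = z0 + (real j / \<bar>a\<bar>) *\<^sub>R V" for j
  define z' where "z' j = z0' + (real j / \<bar>a\<bar>) *\<^sub>R V'" for j
  \<comment> \<open>Half-way between two successive crossings, hence off the lattice lines, where a
    jump by a multiple of \<open>m u\<close> is available.\<close>
  define y where "y j = z0 + ((real j + 1 / 2) / \<bar>a\<bar>) *\<^sub>R V" for j
  define K where "K j = of_int (k j * m) *\<^sub>R u" for j
  define d where "d j = e * cross u z0 + real j" for j
  have a: "a \<noteq> 0" "cross u V = a" "cross u V' = a" "a \<in> \<int>" using V by (simp_all add: a_def)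
  have e: "e * ((t / \<bar>a\<bar>) * a) = t" "(t / \<bar>a\<bar>) * a = e * t" "e \<in> \<int>" for t
    using a(1) by (auto simp: e_def sgn_if)
  have cr: "e * cross u (z j) = d j" "e * cross u (z' j) = d j" "e * cross u (y j) = d j + 1 / 2"
    "cross u (K j) = 0" for j
    using e(1)[of "real j"] e(1)[of "real j + 1 / 2"] z0'
    by (simp_all add: z_def z'_def y_def d_def a z0_def K_def distrib_left)
  have int: "cross u (z j) \<in> \<int>" "cross u (z' j) \<in> \<int>" "d j \<in> \<int>" for j
    using e(2)[of "real j"] e(3) c(4) z0' unfolding z_def z'_def d_def by (simp_all add: a z0_def)
  have pp: "z j \<in> punctured_plane" "z' j \<in> punctured_plane" for j
    using L L' by (simp_all add: z_def z'_def z0_def)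
  \<comment> \<open>Displaced by \<open>K j\<close>, the \<open>j\<close>-th crossing of the first
    line falls into the same gap \<open>h j\<close> as that of the second. Hence one strip
    \<open>C j\<close> contains the pieces of both lines between two crossings.\<close>
  define h where "h j = \<lfloor>cross (z' j) w\<rfloor>" for j
  have h: "h j = \<lfloor>cross (z j) w\<rfloor> + k j * m" for j
    using k[of j] by (simp add: h_def z_def z'_def a_def z0_def)
  have g1: "of_int (h j) < cross (z' j) w \<and> cross (z' j) w < of_int (h j) + 1" for j
    using floor_gap[OF pp(2) int(2)] by (simp add: h_def)
  have g2: "of_int (h j) < cross (z j + K j) w \<and> cross (z j + K j) w < of_int (h j) + 1" for j
    using floor_gap[OF pp(1) int(1), of j] by (simp add: h K_def cross_u_w)
  define C where "C j = strip u w e (d j) (h j) (h (Suc j))" for j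
  have C: "convex (C j)" "C j \<subseteq> punctured_plane" for j
    unfolding C_def using convex_strip strip_subset_punctured[OF cross_u_w lattice_u lattice_w e(3) int(3)] by blast+
  have dS: "d (Suc j) = d j + 1" for j by (simp add: d_def)
  have inC: "z' j \<in> C j" "z j + K j \<in> C j" "y j + K j \<in> C j" "y j + K (Suc j) \<in> C j" 
     "z (Suc j) + K (Suc j) \<in> C j" "z' (Suc j) \<in> C j" for j
    unfolding C_def strip_def using g1[of j] g2[of j] g1[of "Suc j"] g2[of "Suc j"]
    by (simp_all only: mem_Collect_eq cross_simps cr distrib_left dS) simp_all
  have z0s: "z 0 = z0" "z' 0 = z0'" "K 0 = 0" by (simp_all add: z_def z'_def K_def k0)
  then have seg: "closed_segment z0 z0' \<subseteq> punctured_plane"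
    using closed_segment_subset[OF inC(2) inC(1) C(1), of 0] C(2)[of 0] by simp
  then show im: "path_image (linepath (pathfinish c) z0') \<subseteq> punctured_plane" by (simp add: z0_def)
  have rel: "rel N (shift (K j)) ((c +++ linepath z0 z0') +++ linepath z0' (z' j) +++ linepath (z' j) (z j + K j))
     (c +++ linepath z0 (z j))" for j
  proof (induction j)
    case 0
    \<comment> \<open>The detour from \<open>z0\<close> to \<open>z0'\<close> and back is
      contractible, since this segment lies in the first strip.\<close>
    have "path_class punctured_plane c = path_class punctured_plane ((c +++ linepath z0 z0') +++ linepath z0' z0' +++ linepath z0' z0)"
      using c seg class_join_cancel[of "linepath z0 z0'" punctured_plane "linepath z0 z0"]
      by (simp add: z0_def path_class_join class_join_assoc class_join_lid path_class_rinv[of "linepath _ _", simplified] class_join_rid)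
    moreover have "path_class punctured_plane c = path_class punctured_plane (c +++ linepath z0 z0)"
      using c by (simp add: z0_def path_class_join class_join_rid)
    ultimately have "rel N id ((c +++ linepath z0 z0') +++ linepath z0' z0' +++ linepath z0' z0) (c +++ linepath z0 z0)"
      using rel_cong[OF rel_refl[OF subgroup_N c(1-3)]] by blast
    then show ?case by (simp only: z0s shift_0 add_0_right)
  next
    case (Suc j)
    show ?case
    proof (rule rel_step[OF subgroup_N Suc])
      show "convex (line z0 V)" "convex (line z0' V')" by (rule convex_line)+
      show "line z0 V \<subseteq> punctured_plane" "line z0' V' \<subseteq> punctured_plane" using L L' by (auto simp: line_def z0_def)
      show "z0 \<in> line z0 V" "z j \<in> line z0 V" "y j \<in> line z0 V" "z (Suc j) \<in> line z0 V"
        "z0' \<in> line z0' V'" "z' j \<in> line z0' V'" "z' (Suc j) \<in> line z0' V'"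
        by (simp_all add: in_line z_def y_def z'_def)
      show "convex (C j)" "C j \<subseteq> punctured_plane" by (fact C)+
      show "z' j \<in> C j" "z j + K j \<in> C j" "y j + K j \<in> C j" "y j + K (Suc j) \<in> C j" 
         "z (Suc j) + K (Suc j) \<in> C j" "z' (Suc j) \<in> C j" by (fact inC)+
      show "path c" "pathfinish c = z0" "path (c +++ linepath z0 z0')" "pathfinish (c +++ linepath z0 z0') = z0'"
        using c by (simp_all add: z0_def)
    next
      fix p assume p: "path p" "path_image p \<subseteq> punctured_plane" "pathstart p = x0" "pathfinish p = y j + K j"
      have "e * cross u (pathfinish p) = d j + 1 / 2" using p(4) cr by (simp add: distrib_left)
      moreover have "d j + 1 / 2 \<notin> \<int>"
      proof
        assume "d j + 1 / 2 \<in> \<int>"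
        then have "d j + 1 / 2 - d j \<in> \<int>" using int(3) Ints_diff by blast
        then have "(1 / 2 :: real) \<in> \<int>" by simp
        then show False by (auto elim!: Ints_cases simp: field_simps)
      qed
      ultimately have "cross u (pathfinish p) \<notin> \<int>" using e(3) by (metis Ints_mult)
      from rel_vertical[OF p(1-3) this, of "k (Suc j) - k j"]
      have "rel N (shift (of_int ((k (Suc j) - k j) * m) *\<^sub>R u)) (p +++ linepath (y j + K j) 
         (y j + K j + of_int ((k (Suc j) - k j) * m) *\<^sub>R u)) p"
        by (simp only: p(4))
      moreover have "of_int ((k (Suc j) - k j) * m) *\<^sub>R u = K (Suc j) - K j"
        by (simp add: K_def algebra_simps)
      moreover have "y j + K j + (K (Suc j) - K j) = y j + K (Suc j)" by simp
      ultimately show "rel N (shift (K (Suc j) - K j)) (p +++ linepath (y j + K j) (y j + K (Suc j))) p"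
        by (simp only:)
    qed
  qed
  show "rel N (shift (of_int (k j * m) *\<^sub>R u))
      ((c +++ linepath (pathfinish c) z0') +++ linepath z0' (z0' + (real j / \<bar>cross u V\<bar>) *\<^sub>R V') +++ 
         linepath (z0' + (real j / \<bar>cross u V\<bar>) *\<^sub>R V') 
           (pathfinish c + (real j / \<bar>cross u V\<bar>) *\<^sub>R V + of_int (k j * m) *\<^sub>R u))
      (c +++ linepath (pathfinish c) (pathfinish c + (real j / \<bar>cross u V\<bar>) *\<^sub>R V))"
    using rel[of j] unfolding z_def z'_def K_def z0_def a_def .
qed

text \<open>A segment with vector \<open>2 V\<close> ends after \<open>2 |cross u V|\<close>
  crossings. As the vectors are integral, the displacement accumulated by then is exactly
  \<open>2 V' - 2 V\<close>; so the displaced end of the first loop matches the end of the second,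
  and the return paths agree.\<close>

lemma twist_coset:
  assumes V: "cross u V' = cross u V" "cross u V \<noteq> 0" "V \<in> \<int> \<times> \<int>" "V' \<in> \<int> \<times> \<int>"
    and c: "tail (2 *\<^sub>R V) c" "cross u (pathfinish c) \<in> \<int>"
    and z0': "cross u z0' = cross u (pathfinish c)" and L': "\<And>t. z0' + t *\<^sub>R V' \<in> punctured_plane"
    and G: "shift (2 *\<^sub>R V') \<in> G"
    and k0: "k 0 = 0"
    and k: "\<And>j. \<lfloor>cross (z0' + (real j / \<bar>cross u V\<bar>) *\<^sub>R V') w\<rfloor> = 
        \<lfloor>cross (pathfinish c + (real j / \<bar>cross u V\<bar>) *\<^sub>R V) w\<rfloor> + k j * m"
  shows "\<exists>c'. tail (2 *\<^sub>R V') c' \<and> N #>\<^bsub>pi1\<^esub> seg_loop (2 *\<^sub>R V) c = N #>\<^bsub>pi1\<^esub> seg_loop (2 *\<^sub>R V') c'"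
proof -
  let ?z0 = "pathfinish c"
  have cc: "path c" "path_image c \<subseteq> punctured_plane" "pathstart c = x0" "shift (2 *\<^sub>R V) \<in> G"
    using c by (simp_all add: tail_def)
  have L: "?z0 + t *\<^sub>R V \<in> punctured_plane" for t
  proof -
    have "?z0 + (t / 2) *\<^sub>R 2 *\<^sub>R V \<in> punctured_plane" using c(1) unfolding tail_def by blast
    then show ?thesis by simp
  qed
  have aZ: "cross u V \<in> \<int>" using V lattice_u Ints_cross by blast
  then obtain a where a: "cross u V = of_int a" by (auto elim: Ints_cases)
  have a0: "a \<noteq> 0" using V(2) a by auto
  define J where "J = nat (2 * \<bar>a\<bar>)"
  have J: "real J / \<bar>cross u V\<bar> = 2" using a0 by (simp add: J_def a)
  define K where "K = of_int (k J * m) *\<^sub>R u"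
  note rel = rel_twist[OF V(1,2) aZ cc(1-3) c(2) L z0' L' k0 k]
  let ?c' = "c +++ linepath ?z0 z0'"
  have r: "rel N (shift K) (?c' +++ linepath z0' (z0' + 2 *\<^sub>R V') +++ linepath (z0' + 2 *\<^sub>R V') (?z0 + 2 *\<^sub>R V + K))
    (c +++ linepath ?z0 (?z0 + 2 *\<^sub>R V))"
    using rel(2)[of J] unfolding J K_def .
  have tail': "tail (2 *\<^sub>R V') ?c'"
  proof -
    have "z0' + t *\<^sub>R 2 *\<^sub>R V' \<in> punctured_plane" for t using L'[of "t * 2"] by simp
    then show ?thesis using cc rel(1) G unfolding tail_def by (simp add: subset_path_image_join)
  qed
  have K: "2 *\<^sub>R V + K = 2 *\<^sub>R V'"
  proof -
    obtain p q where pq: "cross V w = of_int p" "cross V' w = of_int q"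
      using V(3,4) lattice_w Ints_cross by (metis Ints_cases)
    \<comment> \<open>The floors agree at the start because \<open>k 0 = 0\<close>; along the whole
      segments they grow by the integers \<open>2 * q\<close> and \<open>2 * p\<close>, which
      determines the total displacement.\<close>
    have "\<lfloor>cross z0' w\<rfloor> = \<lfloor>cross ?z0 w\<rfloor>" using k[of 0] k0 by simp
    moreover have "\<lfloor>cross z0' w + of_int (2 * q)\<rfloor> = \<lfloor>cross ?z0 w + of_int (2 * p)\<rfloor> + k J * m"
      using k[of J] unfolding J by (simp add: pq)
    ultimately have "2 * q = 2 * p + k J * m" by (simp only: floor_add_int[symmetric])
    then have "of_int (k J * m) = 2 * cross V' w - 2 * cross V w" unfolding pq by linarith
    then have "cross (2 *\<^sub>R V + K) w = cross (2 *\<^sub>R V') w" "cross u (2 *\<^sub>R V + K) = cross u (2 *\<^sub>R V')"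
      using V(1) by (simp_all add: K_def cross_u_w)
    then show ?thesis using cross_decomp[OF cross_u_w] by metis
  qed
  let ?s = "reversepath (shift (2 *\<^sub>R V) \<circ> c)"
  have im: "path_image (shift (2 *\<^sub>R V) \<circ> c) \<subseteq> punctured_plane" using cc shift_image by blast
  have s: "N #>\<^bsub>pi1\<^esub> (shift K \<circ> shift (2 *\<^sub>R V), path_class punctured_plane ((?c' +++ linepath z0' (z0' + 2 *\<^sub>R V') +++
       linepath (z0' + 2 *\<^sub>R V') (?z0 + 2 *\<^sub>R V + K)) +++ (shift K \<circ> ?s))) =
     N #>\<^bsub>pi1\<^esub> (shift (2 *\<^sub>R V), path_class punctured_plane ((c +++ linepath ?z0 (?z0 + 2 *\<^sub>R V)) +++ ?s))"
    by (rule rel_coset[OF subgroup_N r]) (use cc im in \<open>simp_all add: pathfinish_compose pathstart_compose\<close>)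
  have 1: "(shift (2 *\<^sub>R V), path_class punctured_plane ((c +++ linepath ?z0 (?z0 + 2 *\<^sub>R V)) +++ ?s)) = seg_loop (2 *\<^sub>R V) c"
    using cc unfolding seg_loop_def by (simp add: path_class_join class_join_assoc pathfinish_compose)
  have Ks: "shift K \<circ> shift (2 *\<^sub>R V) = shift (2 *\<^sub>R V')" "shift K \<circ> ?s = reversepath (shift (2 *\<^sub>R V') \<circ> c)"
     "?z0 + 2 *\<^sub>R V + K = ?z0 + 2 *\<^sub>R V'"
    unfolding path_compose_reversepath shift_comp shift_comp_assoc using K by (simp_all only: add.commute[of K] add.assoc)
  have 2: "path_class punctured_plane ((?c' +++ linepath z0' (z0' + 2 *\<^sub>R V') +++
       linepath (z0' + 2 *\<^sub>R V') (?z0 + 2 *\<^sub>R V')) +++ reversepath (shift (2 *\<^sub>R V') \<circ> c)) = 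
      path_class punctured_plane (?c' +++ linepath z0' (z0' + 2 *\<^sub>R V') +++ reversepath (shift (2 *\<^sub>R V') \<circ> ?c'))"
    using cc by (simp add: path_compose_join reversepath_joinpaths path_class_join class_join_assoc
        pathfinish_compose pathstart_compose shift_linepath)
  have "N #>\<^bsub>pi1\<^esub> seg_loop (2 *\<^sub>R V) c = N #>\<^bsub>pi1\<^esub> seg_loop (2 *\<^sub>R V') ?c'"
    using s unfolding 1 Ks 2 seg_loop_def[of "2 *\<^sub>R V'"] by simp
  then show ?thesis using tail' by blast
qed

end

section \<open>The groups generated by rotations\<close>

text \<open>The product of \<open>BijGroup UNIV\<close> is known to be composition on bijections
  only, so bijectivity travels along in the induction.\<close>

lemma generate_BijGroup_induct:
  assumes f: "f \<in> generate (BijGroup UNIV) S" and S: "\<And>g. g \<in> S \<Longrightarrow> bij g"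
    and "P id" "\<And>g. g \<in> S \<Longrightarrow> P g" "\<And>g. g \<in> S \<Longrightarrow> P (inv_into UNIV g)"
    and "\<And>g h. bij g \<Longrightarrow> bij h \<Longrightarrow> P g \<Longrightarrow> P h \<Longrightarrow> P (g \<circ> h)"
  shows "bij f \<and> P f"
  using f
proof (induction rule: generate.induct)
  case one then show ?case unfolding one_BijGroup_UNIV using assms(3) bij_id by blast
next
  case (incl h) then show ?case using assms by simp
next
  case (inv h) then show ?case 
    unfolding inv_BijGroup_UNIV[OF S[OF inv]] using inv assms(5) S bij_imp_bij_inv by blast
next
  case (eng g h) then show ?case 
    unfolding mult_BijGroup_UNIV[OF conjunct1[OF eng.IH(1)] conjunct1[OF eng.IH(2)]]
    using eng.IH assms(6) bij_comp by blast
qed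

lemma generate_BijGroup_bij:
  assumes "f \<in> generate (BijGroup UNIV) S" "\<And>g. g \<in> S \<Longrightarrow> bij g" shows "bij f"
  using generate_BijGroup_induct[OF assms, of "\<lambda>_. True"] by simp

lemma generate_BijGroup_comp:
  assumes "f \<in> generate (BijGroup UNIV) S" "g \<in> generate (BijGroup UNIV) S" "\<And>g. g \<in> S \<Longrightarrow> bij g"
  shows "f \<circ> g \<in> generate (BijGroup UNIV) S"
  using generate.eng[OF assms(1,2)] mult_BijGroup_UNIV[OF generate_BijGroup_bij[OF assms(1,3)] generate_BijGroup_bij[OF assms(2,3)]]
  by simp

lemma generate_BijGroup_subgroup:
  assumes "\<And>g. g \<in> S \<Longrightarrow> bij g"
  shows "subgroup (generate (BijGroup UNIV) S) (BijGroup UNIV)"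
  using assms by (intro group.generate_is_subgroup group_BijGroup) (auto simp: carrier_BijGroup_UNIV)

lemma generate_BijGroup_inv:
  assumes "f \<in> generate (BijGroup UNIV) S" "\<And>g. g \<in> S \<Longrightarrow> bij g"
  shows "inv_into UNIV f \<in> generate (BijGroup UNIV) S"
  using subgroup.m_inv_closed[OF generate_BijGroup_subgroup[OF assms(2)] assms(1)]
  by (simp add: inv_BijGroup_UNIV generate_BijGroup_bij[OF assms])

lemma bij_shift: "bij (shift w)"
  by (rule o_bij[of "shift (- w)"]) (simp_all add: shift_comp shift_0)

lemma inv_shift: "inv_into UNIV (shift w) = shift (- w)"
  by (rule Hilbert_Choice.inv_equality) simp_all

text \<open>Makes explicit the condition in \<open>line_loop\<close> that \<open>g\<close> generates
  the stabiliser of the line.\<close>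

lemma generate_shift: "generate (BijGroup UNIV) {shift a} = range (\<lambda>k::int. shift (of_int k *\<^sub>R a))"
proof (intro equalityI subsetI)
  fix f assume "f \<in> generate (BijGroup UNIV) {shift a}"
  then have "bij f \<and> (\<exists>k::int. f = shift (of_int k *\<^sub>R a))"
  proof (rule generate_BijGroup_induct)
    show "\<exists>k::int. id = shift (of_int k *\<^sub>R a)" by (rule exI[of _ 0]) (simp add: shift_0)
    fix g assume g: "g \<in> {shift a}"
    show "bij g" using g by (simp add: bij_shift)
    show "\<exists>k::int. g = shift (of_int k *\<^sub>R a)" using g by (intro exI[of _ 1]) (simp only: singleton_iff of_int_1 scaleR_one)
    show "\<exists>k::int. inv_into UNIV g = shift (of_int k *\<^sub>R a)" using g inv_shift[of a] by (intro exI[of _ "- 1"]) (simp only: singleton_iff of_int_minus of_int_1 scaleR_minus_left scaleR_one)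
  next
    fix g h assume "\<exists>k::int. g = shift (of_int k *\<^sub>R a)" "\<exists>k::int. h = shift (of_int k *\<^sub>R a)"
    then obtain k l :: int where "g = shift (of_int k *\<^sub>R a)" "h = shift (of_int l *\<^sub>R a)" by blast
    then show "\<exists>k::int. g \<circ> h = shift (of_int k *\<^sub>R a)"
      by (intro exI[of _ "k + l"]) (simp only: shift_comp of_int_add scaleR_add_left)
  qed
  then show "f \<in> range (\<lambda>k::int. shift (of_int k *\<^sub>R a))" by blast
next
  let ?S = "generate (BijGroup UNIV) {shift a}"
  have b: "\<And>g. g \<in> {shift a} \<Longrightarrow> bij g" by (simp add: bij_shift)
  have nat: "shift (real k *\<^sub>R a) \<in> ?S" for k
  proof (induction k)
    case 0
    show ?case using generate.one[of "BijGroup UNIV" "{shift a}"] unfolding one_BijGroup_UNIV by (simp only: of_nat_0 scaleR_zero_left shift_0)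
  next
    case (Suc k)
    have "shift a \<circ> shift (real k *\<^sub>R a) \<in> ?S"
      by (rule generate_BijGroup_comp[OF generate.incl[OF singletonI] Suc b])
    moreover have "a + real k *\<^sub>R a = real (Suc k) *\<^sub>R a" by (simp add: scaleR_add_left)
    ultimately show ?case by (simp only: shift_comp)
  qed
  fix f assume "f \<in> range (\<lambda>k::int. shift (of_int k *\<^sub>R a))"
  then obtain k :: int where f: "f = shift (of_int k *\<^sub>R a)" by blast
  show "f \<in> ?S"
  proof (cases "k \<ge> 0")
    case True
    then have "real (nat k) *\<^sub>R a = of_int k *\<^sub>R a" by simp
    with nat[of "nat k"] show ?thesis by (simp only: f)
  next
    case False
    have "inv_into UNIV (shift (real (nat (- k)) *\<^sub>R a)) \<in> ?S"
      by (rule generate_BijGroup_inv[OF nat b])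
    moreover have "- (real (nat (- k)) *\<^sub>R a) = of_int k *\<^sub>R a" using False by simp
    ultimately show ?thesis by (simp only: f inv_shift)
  qed
qed

lemma bij_pi_rotation: "bij (pi_rotation a)"
  by (rule o_bij[of "pi_rotation a"]) (auto simp: pi_rotation_def)

text \<open>Two rotations compose to the translation by twice the difference of their centres. The
  instances are the lattice for \<open>H_group\<close> and the half-integral points for
  \<open>H_hat_group\<close>.\<close>

lemma generate_pi_rotations:
  assumes A: "0 \<in> A" "\<And>a b. a \<in> A \<Longrightarrow> b \<in> A \<Longrightarrow> a - b \<in> A"
  shows "generate (BijGroup UNIV) (pi_rotation ` A) = (\<lambda>a. shift (2 *\<^sub>R a)) ` A \<union> pi_rotation ` A"
proof (intro equalityI subsetI)
  have minus: "- a \<in> A" if "a \<in> A" for a using A(2)[OF A(1) that] by simp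
  have plus: "a + b \<in> A" if "a \<in> A" "b \<in> A" for a b using A(2)[OF that(1) minus[OF that(2)]] by simp
  fix f assume "f \<in> generate (BijGroup UNIV) (pi_rotation ` A)"
  then have "bij f \<and> f \<in> (\<lambda>a. shift (2 *\<^sub>R a)) ` A \<union> pi_rotation ` A"
  proof (rule generate_BijGroup_induct)
    have "id = shift (2 *\<^sub>R (0::plane))" by (simp only: scaleR_zero_right shift_0)
    then show "id \<in> (\<lambda>a. shift (2 *\<^sub>R a)) ` A \<union> pi_rotation ` A" using A(1) by blast
    fix g assume "g \<in> pi_rotation ` A"
    then obtain a where a: "a \<in> A" "g = pi_rotation a" by blast
    then show "bij g" "g \<in> (\<lambda>a. shift (2 *\<^sub>R a)) ` A \<union> pi_rotation ` A" by (simp_all add: bij_pi_rotation)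
    have "inv_into UNIV (pi_rotation a) = pi_rotation a"
      by (rule Hilbert_Choice.inv_equality) (simp_all add: pi_rotation_def)
    then show "inv_into UNIV g \<in> (\<lambda>a. shift (2 *\<^sub>R a)) ` A \<union> pi_rotation ` A" using a by simp
  next
    fix g h assume g: "g \<in> (\<lambda>a. shift (2 *\<^sub>R a)) ` A \<union> pi_rotation ` A"
      and h: "h \<in> (\<lambda>a. shift (2 *\<^sub>R a)) ` A \<union> pi_rotation ` A"
    have c: "shift (2 *\<^sub>R a) \<circ> shift (2 *\<^sub>R b) = shift (2 *\<^sub>R (a + b))" 
      "shift (2 *\<^sub>R a) \<circ> pi_rotation b = pi_rotation (a + b)"
      "pi_rotation a \<circ> shift (2 *\<^sub>R b) = pi_rotation (a - b)"
      "pi_rotation a \<circ> pi_rotation b = shift (2 *\<^sub>R (a - b))" for a b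
      by (simp_all add: fun_eq_iff pi_rotation_def scaleR_add_right scaleR_diff_right)
    from g h show "g \<circ> h \<in> (\<lambda>a. shift (2 *\<^sub>R a)) ` A \<union> pi_rotation ` A"
      using A(2) plus by (elim UnE imageE) (simp_all only: c, blast+)
  qed
  then show "f \<in> (\<lambda>a. shift (2 *\<^sub>R a)) ` A \<union> pi_rotation ` A" by blast
next
  fix f assume "f \<in> (\<lambda>a. shift (2 *\<^sub>R a)) ` A \<union> pi_rotation ` A"
  then show "f \<in> generate (BijGroup UNIV) (pi_rotation ` A)"
  proof
    assume "f \<in> (\<lambda>a. shift (2 *\<^sub>R a)) ` A"
    then obtain a where a: "a \<in> A" "f = shift (2 *\<^sub>R a)" by blast
    then have "f = pi_rotation a \<circ> pi_rotation 0" by (simp add: fun_eq_iff pi_rotation_def)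
    moreover have "pi_rotation a \<circ> pi_rotation 0 \<in> generate (BijGroup UNIV) (pi_rotation ` A)"
      by (rule generate_BijGroup_comp) (use a A bij_pi_rotation in \<open>auto intro: generate.incl\<close>)
    ultimately show ?thesis by simp
  qed (rule generate.incl)
qed

lemma lattice_diff: "(u::plane) \<in> \<int> \<times> \<int> \<Longrightarrow> w \<in> \<int> \<times> \<int> \<Longrightarrow> u - w \<in> \<int> \<times> \<int>"
  by (auto simp: mem_Times_iff)

lemma H_group_eq: "H_group = (\<lambda>a. shift (2 *\<^sub>R a)) ` (\<int> \<times> \<int>) \<union> pi_rotation ` (\<int> \<times> \<int>)"
  unfolding H_group_def by (rule generate_pi_rotations) (auto simp: mem_Times_iff)

lemma H_hat_group_eq: "H_hat_group = (\<lambda>a. shift (2 *\<^sub>R a)) ` {a. 2 *\<^sub>R a \<in> \<int> \<times> \<int>} \<union> 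
    pi_rotation ` {a. 2 *\<^sub>R a \<in> \<int> \<times> \<int>}"
  unfolding H_hat_group_def by (rule generate_pi_rotations) (auto simp: mem_Times_iff right_diff_distrib)

text \<open>Each element sends \<open>z\<close> to \<open>z\<close> or \<open>- z\<close> plus a
  vector \<open>2 a\<close> of the lattice, so it preserves the lattice and its complement.\<close>

lemma orbifold_punctured_plane:
  assumes x0: "x0 \<in> punctured_plane" and A: "0 \<in> A" "\<And>a b. a \<in> A \<Longrightarrow> b \<in> A \<Longrightarrow> a - b \<in> A"
    and lat: "\<And>a. a \<in> A \<Longrightarrow> 2 *\<^sub>R a \<in> \<int> \<times> \<int>"
  shows "orbifold punctured_plane (generate (BijGroup UNIV) (pi_rotation ` A)) x0"
proof (rule orbifold.intro)
  show "x0 \<in> punctured_plane" by fact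
  show "subgroup (generate (BijGroup UNIV) (pi_rotation ` A)) (BijGroup UNIV)"
    by (rule generate_BijGroup_subgroup) (auto simp: bij_pi_rotation)
next
  fix g assume "g \<in> generate (BijGroup UNIV) (pi_rotation ` A)"
  then obtain a where a: "a \<in> A" "g = shift (2 *\<^sub>R a) \<or> g = pi_rotation a"
    unfolding generate_pi_rotations[OF A, simplified] by blast
  show "continuous_on punctured_plane g"
    using a(2) by (auto simp: shift_def pi_rotation_def intro!: continuous_intros)
  show "g ` punctured_plane \<subseteq> punctured_plane"
  proof
    fix y assume "y \<in> g ` punctured_plane"
    then obtain z where z: "z \<notin> \<int> \<times> \<int>" "y = g z" by (auto simp: punctured_plane_def)
    have "z = y - 2 *\<^sub>R a \<or> z = 2 *\<^sub>R a - y"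
      using a(2) z by (auto simp: pi_rotation_def)
    then have "y \<notin> \<int> \<times> \<int>"
      using z(1) lattice_diff[OF _ lat[OF a(1)], of y] lattice_diff[OF lat[OF a(1)], of y] by metis
    then show "y \<in> punctured_plane" by (simp add: punctured_plane_def)
  qed
qed

lemma orbifold_H: "x0 \<in> punctured_plane \<Longrightarrow> orbifold punctured_plane H_group x0"
  unfolding H_group_def by (rule orbifold_punctured_plane) (auto simp: mem_Times_iff)

lemma orbifold_H_hat: "x0 \<in> punctured_plane \<Longrightarrow> orbifold punctured_plane H_hat_group x0"
  unfolding H_hat_group_def by (rule orbifold_punctured_plane) (auto simp: mem_Times_iff right_diff_distrib)

section \<open>Slopes of integer vectors\<close>

definition ivec :: "int \<times> int \<Rightarrow> plane" where
  "ivec v = (of_int (fst v), of_int (snd v))"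

text \<open>The value \<open>Infty\<close> at \<open>(0, 0)\<close> is a default; primitive vectors
  exclude it.\<close>

definition slope :: "int \<times> int \<Rightarrow> qhat" where
  "slope v = (if fst v = 0 then Infty else Fin (of_int (snd v) / of_int (fst v)))"

definition idet :: "int \<times> int \<Rightarrow> int \<times> int \<Rightarrow> int" where
  "idet u v = fst u * snd v - snd u * fst v"

definition primitive :: "int \<times> int \<Rightarrow> bool" where
  "primitive v \<longleftrightarrow> coprime (fst v) (snd v)"

definition scale :: "int \<Rightarrow> int \<times> int \<Rightarrow> int \<times> int" where
  "scale k v = (k * fst v, k * snd v)"

lemma cross_ivec: "cross (ivec u) (ivec v) = of_int (idet u v)"
  by (simp add: cross_def ivec_def idet_def)

lemma lattice_eq: "\<int> \<times> \<int> = range ivec"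
proof (intro equalityI subsetI)
  fix p :: plane assume "p \<in> \<int> \<times> \<int>"
  then obtain a b where "fst p = of_int a" "snd p = of_int b" by (auto elim!: Ints_cases)
  then have "p = ivec (a, b)" by (simp add: ivec_def prod_eq_iff)
  then show "p \<in> range ivec" by blast
qed (auto simp: ivec_def)

lemma ivec_lattice: "ivec v \<in> \<int> \<times> \<int>"
  by (simp add: lattice_eq)

lemma primitive_bezout:
  assumes "primitive v" obtains w where "idet v w = 1"
proof -
  obtain x y where "x * fst v + y * snd v = 1"
    using bezout_int[of "fst v" "snd v"] assms by (auto simp: primitive_def coprime_iff_gcd_eq_1)
  then have "idet v (- y, x) = 1" by (simp add: idet_def algebra_simps)
  then show ?thesis using that by blast
qed

lemma idet_1_primitive: "idet v w = 1 \<Longrightarrow> primitive v" and idet_1_primitive': "idet v w = 1 \<Longrightarrow> primitive w"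
proof -
  assume d: "idet v w = 1"
  show "primitive v" unfolding primitive_def
  proof (rule coprimeI)
    fix c assume c: "c dvd fst v" "c dvd snd v"
    have "c dvd idet v w" unfolding idet_def by (intro dvd_diff dvd_mult2 c)
    then show "c dvd 1" using d by simp
  qed
  show "primitive w" unfolding primitive_def
  proof (rule coprimeI)
    fix c assume c: "c dvd fst w" "c dvd snd w"
    have "c dvd idet v w" unfolding idet_def by (intro dvd_diff dvd_mult c)
    then show "c dvd 1" using d by simp
  qed
qed

lemma primitive_parallel:
  assumes v: "primitive v" and "idet v w = 0" obtains k where "w = scale k v"
proof -
  obtain x where x: "idet v x = 1" using primitive_bezout[OF v] .
  have "fst w = idet w x * fst v" "snd w = idet w x * snd v"
    using x assms(2) unfolding idet_def by algebra+
  then have "w = scale (idet w x) v" by (simp add: scale_def prod_eq_iff)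
  then show ?thesis using that by blast
qed

lemma ivec_scale: "ivec (scale k v) = of_int k *\<^sub>R ivec v"
  by (simp add: ivec_def scale_def)

text \<open>The function \<open>cross (ivec v)\<close> is constant on parallels to \<open>v\<close>
  and integral on the lattice. With a Bezout partner of \<open>v\<close>, each of its integral level
  lines is seen to contain a lattice point.\<close>

lemma line_avoids_lattice_iff:
  assumes "primitive v"
  shows "(\<forall>t. z + t *\<^sub>R ivec v \<in> punctured_plane) \<longleftrightarrow> cross (ivec v) z \<notin> \<int>"
proof
  assume *: "\<forall>t. z + t *\<^sub>R ivec v \<in> punctured_plane"
  show "cross (ivec v) z \<notin> \<int>"
  proof
    assume "cross (ivec v) z \<in> \<int>"
    then obtain n where n: "cross (ivec v) z = of_int n" by (auto elim: Ints_cases)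
    obtain x where x: "idet v x = 1" using primitive_bezout[OF assms] .
    have "cross z (ivec x) *\<^sub>R ivec v + of_int n *\<^sub>R ivec x = z"
      using cross_decomp[of "ivec v" "ivec x" z] n x by (simp add: cross_ivec)
    then have "z + (- cross z (ivec x)) *\<^sub>R ivec v = of_int n *\<^sub>R ivec x"
      by (metis add_diff_cancel_left' diff_conv_add_uminus scaleR_minus_left)
    moreover have "of_int n *\<^sub>R ivec x \<in> \<int> \<times> \<int>" by (rule lattice_scale[OF _ ivec_lattice]) simp
    moreover have "z + (- cross z (ivec x)) *\<^sub>R ivec v \<in> punctured_plane" using * by blast
    ultimately show False by (simp add: punctured_plane_def)
  qed
next
  assume *: "cross (ivec v) z \<notin> \<int>"
  show "\<forall>t. z + t *\<^sub>R ivec v \<in> punctured_plane"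
  proof
    fix t
    have "cross (ivec v) (z + t *\<^sub>R ivec v) \<notin> \<int>" using * by simp
    then show "z + t *\<^sub>R ivec v \<in> punctured_plane"
      using Ints_cross[OF ivec_lattice[of v], of "z + t *\<^sub>R ivec v"] by (auto simp: punctured_plane_def)
  qed
qed

lemma line_in_lines_of_slope:
  assumes "primitive v" shows "line z (ivec v) \<in> lines_of_slope (slope v)"
proof (cases "fst v = 0")
  case True
  then have v: "snd v \<noteq> 0" using assms by (auto simp: primitive_def)
  have "line z (ivec v) = {(x, y). x = fst z}"
  proof (intro equalityI subsetI)
    fix p :: plane assume "p \<in> {(x, y). x = fst z}"
    then have "p = z + ((snd p - snd z) / of_int (snd v)) *\<^sub>R ivec v"
      using v True by (auto simp: prod_eq_iff ivec_def)
    then show "p \<in> line z (ivec v)" unfolding line_def by blast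
  qed (auto simp: line_def ivec_def True prod_eq_iff)
  then show ?thesis using True by (auto simp: slope_def)
next
  case False
  define a b :: real where "a = of_int (fst v)" and "b = of_int (snd v)"
  have a: "a \<noteq> 0" using False by (simp add: a_def)
  have r: "real_of_rat (of_int (snd v) / of_int (fst v)) = b / a"
    by (simp add: of_rat_divide a_def b_def)
  have "line z (ivec v) = {(x, y). y = b / a * x + (snd z - b / a * fst z)}"
  proof (intro equalityI subsetI)
    fix p :: plane assume "p \<in> {(x, y). y = b / a * x + (snd z - b / a * fst z)}"
    then have "p = z + ((fst p - fst z) / a) *\<^sub>R ivec v"
      using a by (auto simp: prod_eq_iff ivec_def a_def[symmetric] b_def[symmetric] field_simps)
    then show "p \<in> line z (ivec v)" unfolding line_def by blast
  qed (use a in \<open>auto simp: line_def ivec_def prod_eq_iff a_def[symmetric] b_def[symmetric] field_simps\<close>)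
  then show ?thesis using False by (auto simp: slope_def r)
qed

text \<open>The stabiliser of the line is generated by the translation by \<open>\<kappa> v\<close>:
  a translation in it is a multiple of this one because \<open>v\<close> is primitive, and a
  rotation in it would have its centre, a lattice point, on the line. The values
  \<open>\<kappa> = 2\<close> and \<open>\<kappa> = 1\<close> serve the 4-punctured sphere and the
  punctured torus.\<close>

lemma line_loop_memI:
  assumes K: "\<And>h. h \<in> K \<Longrightarrow> (\<exists>w\<in>\<int> \<times> \<int>. h = shift (\<kappa> *\<^sub>R w)) \<or> (\<exists>w\<in>\<int> \<times> \<int>. h = pi_rotation w)"
    and K': "\<And>w. w \<in> \<int> \<times> \<int> \<Longrightarrow> shift (\<kappa> *\<^sub>R w) \<in> K" and "\<kappa> \<noteq> 0"
    and v: "primitive v" and c: "path c" "path_image c \<subseteq> punctured_plane" "pathstart c = x0"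
    and L: "\<And>t. pathfinish c + t *\<^sub>R ivec v \<in> punctured_plane"
  shows "(shift (\<kappa> *\<^sub>R ivec v), path_class punctured_plane (c +++ linepath (pathfinish c) (pathfinish c + \<kappa> *\<^sub>R ivec v) +++
      reversepath (shift (\<kappa> *\<^sub>R ivec v) \<circ> c))) \<in> line_loop K x0 (slope v)"
proof -
  define z where "z = pathfinish c"
  define g where "g = shift (\<kappa> *\<^sub>R ivec v)"
  have gz: "g (pathfinish c) = z + \<kappa> *\<^sub>R ivec v" by (simp add: g_def z_def)
  have img: "shift (t *\<^sub>R ivec v) ` line z (ivec v) = line z (ivec v)" for t
  proof (intro equalityI subsetI)
    fix p assume "p \<in> line z (ivec v)"
    then obtain s where "p = z + s *\<^sub>R ivec v" by (auto simp: line_def)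
    then have "p = shift (t *\<^sub>R ivec v) (z + (s - t) *\<^sub>R ivec v)" by (simp add: algebra_simps)
    then show "p \<in> shift (t *\<^sub>R ivec v) ` line z (ivec v)" unfolding line_def by blast
  next
    fix p assume "p \<in> shift (t *\<^sub>R ivec v) ` line z (ivec v)"
    then obtain q where "q \<in> line z (ivec v)" "p = q + t *\<^sub>R ivec v" by auto
    then obtain s where "p = z + s *\<^sub>R ivec v + t *\<^sub>R ivec v" unfolding line_def by blast
    then have "p = z + (s + t) *\<^sub>R ivec v" by (simp add: algebra_simps)
    then show "p \<in> line z (ivec v)" unfolding line_def by blast
  qed
  have "generate (BijGroup UNIV) {g} = {h \<in> K. h ` line z (ivec v) = line z (ivec v)}"
    unfolding g_def generate_shift
  proof (intro equalityI subsetI)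
    fix h assume "h \<in> range (\<lambda>k::int. shift (of_int k *\<^sub>R \<kappa> *\<^sub>R ivec v))"
    then obtain k :: int where k: "h = shift (of_int k *\<^sub>R \<kappa> *\<^sub>R ivec v)" by blast
    have e: "of_int k *\<^sub>R \<kappa> *\<^sub>R ivec v = \<kappa> *\<^sub>R of_int k *\<^sub>R ivec v"
      "of_int k *\<^sub>R \<kappa> *\<^sub>R ivec v = (of_int k * \<kappa>) *\<^sub>R ivec v" by simp_all
    have "h \<in> K" unfolding k e(1) by (rule K'[OF lattice_scale[OF _ ivec_lattice]]) simp
    moreover have "h ` line z (ivec v) = line z (ivec v)" unfolding k e(2) by (rule img)
    ultimately show "h \<in> {h \<in> K. h ` line z (ivec v) = line z (ivec v)}" by blast
  next
    fix h assume "h \<in> {h \<in> K. h ` line z (ivec v) = line z (ivec v)}"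
    then have h: "h \<in> K" "h ` line z (ivec v) = line z (ivec v)" by simp_all
    then have "h z \<in> line z (ivec v)" using in_line(2) by blast
    then obtain t where t: "h z = z + t *\<^sub>R ivec v" by (auto simp: line_def)
    show "h \<in> range (\<lambda>k::int. shift (of_int k *\<^sub>R \<kappa> *\<^sub>R ivec v))"
      using K[OF h(1)]
    proof
      assume "\<exists>w\<in>\<int> \<times> \<int>. h = shift (\<kappa> *\<^sub>R w)"
      then obtain w where w: "h = shift (\<kappa> *\<^sub>R ivec w)" by (auto simp: lattice_eq)
      then have "\<kappa> *\<^sub>R ivec w = t *\<^sub>R ivec v" using t by simp
      then have "cross (ivec v) (\<kappa> *\<^sub>R ivec w) = cross (ivec v) (t *\<^sub>R ivec v)" by (rule arg_cong)
      then have "idet v w = 0" using \<open>\<kappa> \<noteq> 0\<close> by (simp add: cross_ivec)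
      then obtain k where "w = scale k v" using primitive_parallel[OF v] by blast
      then have "\<kappa> *\<^sub>R ivec w = of_int k *\<^sub>R \<kappa> *\<^sub>R ivec v" by (simp add: ivec_scale)
      then show ?thesis unfolding w using rangeI[of "\<lambda>k::int. shift (of_int k *\<^sub>R \<kappa> *\<^sub>R ivec v)" k] by metis
    next
      assume "\<exists>w\<in>\<int> \<times> \<int>. h = pi_rotation w"
      then obtain w where w: "w \<in> \<int> \<times> \<int>" "h = pi_rotation w" by blast
      then have "2 *\<^sub>R w = 2 *\<^sub>R (z + (t / 2) *\<^sub>R ivec v)"
        using t by (simp add: pi_rotation_def scaleR_add_right algebra_simps scaleR_2)
      then have "w = z + (t / 2) *\<^sub>R ivec v" by (rule scaleR_left_imp_eq[rotated]) simp
      then have "w \<in> punctured_plane" using L by (simp add: z_def)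
      then show ?thesis using w(1) by (simp add: punctured_plane_def)
    qed
  qed
  moreover have "line z (ivec v) \<subseteq> punctured_plane" using L by (auto simp: line_def z_def)
  moreover have "g \<in> K" unfolding g_def by (rule K'[OF ivec_lattice])
  ultimately have "(g, path_class punctured_plane (c +++ linepath (pathfinish c) (g (pathfinish c)) +++ reversepath (g \<circ> c)))
     \<in> line_loop K x0 (slope v)"
    unfolding line_loop_def using line_in_lines_of_slope[OF v, of z] c in_line(2)[of z "ivec v"]
    by (auto simp: z_def)
  then show ?thesis unfolding gz unfolding g_def z_def .
qed

text \<open>Representatives with an explicit direction vector. \<open>loops_subset_alpha\<close>
  places them in \<open>alpha\<close>, and homotopy in the Heckoid orbifold asks for a single pair
  of representatives.\<close>

definition loops :: "(plane \<Rightarrow> plane) set \<Rightarrow> plane \<Rightarrow> qhat \<Rightarrow> ((plane \<Rightarrow> plane) \<times> (real \<Rightarrow> plane) set) set" where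
  "loops G x0 s = {orbifold.seg_loop punctured_plane (2 *\<^sub>R ivec v) c | v c.
     primitive v \<and> slope v = s \<and> orbifold.tail punctured_plane G x0 (2 *\<^sub>R ivec v) c}"

definition add_scaled :: "int \<times> int \<Rightarrow> int \<Rightarrow> int \<times> int \<Rightarrow> int \<times> int" where
  "add_scaled v k u = (fst v + k * fst u, snd v + k * snd u)"

lemma ivec_add_scaled: "ivec (add_scaled v k u) = ivec v + of_int k *\<^sub>R ivec u"
  by (simp add: ivec_def add_scaled_def)

text \<open>A transvection along \<open>u\<close>. It preserves \<open>idet u\<close>, so a common
  divisor of the new coordinates divides \<open>idet u v\<close> and hence the old
  coordinates.\<close>

lemma primitive_shear:
  assumes "primitive v" shows "primitive (add_scaled v (k * idet u v) u)"
  unfolding primitive_def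
proof (rule coprimeI)
  fix c assume c: "c dvd fst (add_scaled v (k * idet u v) u)" "c dvd snd (add_scaled v (k * idet u v) u)"
  have "idet u v = fst u * snd (add_scaled v (k * idet u v) u) - snd u * fst (add_scaled v (k * idet u v) u)"
    unfolding idet_def add_scaled_def fst_conv snd_conv by algebra
  then have "c dvd idet u v" using c by (metis dvd_diff dvd_mult)
  then have "c dvd fst v" "c dvd snd v"
    using c dvd_add_left_iff[of c "k * idet u v * fst u" "fst v"] dvd_add_left_iff[of c "k * idet u v * snd u" "snd v"]
    by (simp_all add: add_scaled_def)
  then show "c dvd 1" using assms coprime_common_divisor unfolding primitive_def by blast
qed

lemma primitive_reflect: "primitive v \<Longrightarrow> primitive (fst v, 2 * k * fst v - snd v)"
  unfolding primitive_def fst_conv snd_conv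
  by (metis (no_types, opaque_lifting) coprime_minus_right_iff gcd_add_mult coprime_iff_gcd_eq_1 minus_diff_eq
     diff_conv_add_uminus mult.commute add.commute)

text \<open>Quantifying over all representatives on the left makes the relation transitive. Symmetry
  is not built in, so both directions are carried along when it is spread over orbits.\<close>

definition coset_related where
  "coset_related G x0 N s s' \<longleftrightarrow> (\<forall>a\<in>loops G x0 s. \<exists>b\<in>loops G x0 s'.
     N #>\<^bsub>orbifold_pi1 punctured_plane G x0\<^esub> a = N #>\<^bsub>orbifold_pi1 punctured_plane G x0\<^esub> b)"

lemma coset_related_refl: "coset_related G x0 N s s"
  by (auto simp: coset_related_def)

lemma coset_related_trans: "coset_related G x0 N s s' \<Longrightarrow> coset_related G x0 N s' s'' \<Longrightarrow> coset_related G x0 N s s''"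
  unfolding coset_related_def by metis

text \<open>Without representatives \<open>coset_related\<close> would hold vacuously. A line of the
  given direction half-way between lattice lines is joined to the base point, the complement of the
  countable lattice being path-connected.\<close>

lemma loops_nonempty:
  assumes "orbifold punctured_plane G x0" "\<And>v. shift (2 *\<^sub>R ivec v) \<in> G" "primitive v" "slope v = s"
  shows "loops G x0 s \<noteq> {}"
proof -
  interpret orbifold punctured_plane G x0 by fact
  define q :: real where "q = of_int ((fst v)\<^sup>2 + (snd v)\<^sup>2)"
  have q: "q \<noteq> 0"
  proof
    assume "q = 0"
    then have "(fst v)\<^sup>2 + (snd v)\<^sup>2 = 0" by (simp only: q_def of_int_eq_0_iff)
    then show False using assms(3) by (simp add: primitive_def sum_power2_eq_zero_iff)
  qed
  \<comment> \<open>The vector \<open>v\<close> turned by a right angle and divided by twice its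
    squared length, so that its determinant with \<open>v\<close> is 1/2.\<close>
  define z :: plane where "z = (- of_int (snd v) / (2 * q), of_int (fst v) / (2 * q))"
  have "cross (ivec v) z = (of_int (fst v) * of_int (fst v) + of_int (snd v) * of_int (snd v)) / (2 * q)"
    by (simp add: cross_def ivec_def z_def add_divide_distrib)
  also have "of_int (fst v) * of_int (fst v) + of_int (snd v) * of_int (snd v) = q"
    by (simp add: q_def power2_eq_square)
  also have "q / (2 * q) = 1 / 2" using q by simp
  finally have half: "cross (ivec v) z = 1 / 2" .
  have "cross (ivec v) z \<notin> \<int>"
  proof
    assume "cross (ivec v) z \<in> \<int>"
    then obtain i where "(1 / 2 :: real) = of_int i" unfolding half by (auto elim: Ints_cases)
    then have "of_int (2 * i) = (of_int 1 :: real)" by simp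
    then have "2 * i = 1" by (simp only: of_int_eq_iff)
    then show False by presburger
  qed
  then have L: "z + t *\<^sub>R ivec v \<in> punctured_plane" for t using line_avoids_lattice_iff[OF assms(3)] by blast
  have "countable (\<int> \<times> \<int> :: plane set)" by (simp add: lattice_eq)
  then have "path_connected (punctured_plane)"
    unfolding punctured_plane_def Compl_eq_Diff_UNIV[symmetric]
    by (intro path_connected_complement_countable) simp_all
  moreover have "z \<in> punctured_plane" using L[of 0] by simp
  ultimately obtain c where c: "path c" "path_image c \<subseteq> punctured_plane" "pathstart c = x0" "pathfinish c = z"
    using base_in unfolding path_connected_def by blast
  have "tail (2 *\<^sub>R ivec v) c" unfolding tail_def using c assms(2) L by (simp add: L)
  then show ?thesis using assms unfolding loops_def by blast
qed

context twist
begin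

lemma loops_slide:
  assumes a: "a \<in> loops G x0 s" "u = ivec u0" and s: "\<And>v. primitive v \<Longrightarrow> slope v = s \<Longrightarrow> idet u0 v \<noteq> 0"
  obtains v c where "primitive v" "slope v = s" "tail (2 *\<^sub>R ivec v) c" "a = seg_loop (2 *\<^sub>R ivec v) c" 
    "cross u (pathfinish c) = 0"
proof -
  obtain v c where v: "primitive v" "slope v = s" "tail (2 *\<^sub>R ivec v) c" "a = seg_loop (2 *\<^sub>R ivec v) c"
    using a by (auto simp: loops_def)
  define t where "t = - cross u (pathfinish c) / (2 * cross u (ivec v))"
  have "cross u (ivec v) \<noteq> 0" using s[OF v(1,2)] by (simp add: a(2) cross_ivec)
  then have "cross u (pathfinish (c +++ linepath (pathfinish c) (pathfinish c + t *\<^sub>R 2 *\<^sub>R ivec v))) = 0"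
    by (simp add: t_def)
  then show ?thesis using that[OF v(1,2) tail_slide(1)[OF v(3)]] tail_slide(2)[OF v(3)] v(4) by metis
qed

lemma tail_avoids:
  assumes "primitive v" "tail (2 *\<^sub>R ivec v) c" shows "cross (ivec v) (pathfinish c) \<notin> \<int>"
proof -
  have "pathfinish c + t *\<^sub>R ivec v \<in> punctured_plane" for t
  proof -
    have "pathfinish c + (t / 2) *\<^sub>R 2 *\<^sub>R ivec v \<in> punctured_plane" using assms(2) unfolding tail_def by blast
    then show ?thesis by simp
  qed
  then show ?thesis using line_avoids_lattice_iff[OF assms(1)] by blast
qed

text \<open>Both lines start at the same point of a lattice line. At the \<open>j\<close>-th
  crossing, at parameter \<open>j / |d|\<close> for \<open>d = idet u0 v\<close>, they differ by
  \<open>j * l * m * sgn d\<close> times \<open>u\<close>, so their gaps differ by multiples of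
  \<open>m\<close>. If \<open>d = 0\<close>, the shear fixes the slope.\<close>

lemma coset_related_shear:
  assumes u: "u = ivec u0" and G: "\<And>v. shift (2 *\<^sub>R ivec v) \<in> G"
    and s: "\<And>v. primitive v \<Longrightarrow> slope v = s \<Longrightarrow> slope (add_scaled v (l * m * idet u0 v) u0) = s'"
  shows "coset_related G x0 N s s'"
proof (cases "\<exists>v. primitive v \<and> slope v = s \<and> idet u0 v = 0")
  case True
  then have "s' = s" using s by (force simp: add_scaled_def)
  then show ?thesis by (simp add: coset_related_refl)
next
  case False
  then have ne: "\<And>v. primitive v \<Longrightarrow> slope v = s \<Longrightarrow> idet u0 v \<noteq> 0" by blast
  show ?thesis unfolding coset_related_def
  proof
    fix a assume a: "a \<in> loops G x0 s"
    obtain v c where v: "primitive v" "slope v = s" "tail (2 *\<^sub>R ivec v) c" "a = seg_loop (2 *\<^sub>R ivec v) c" 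
        "cross u (pathfinish c) = 0"
      using loops_slide[OF a u ne] .
    define d where "d = idet u0 v"
    define v' where "v' = add_scaled v (l * m * d) u0"
    have v': "primitive v'" "slope v' = s'" unfolding v'_def d_def using primitive_shear[OF v(1)] s[OF v(1,2)] by simp_all
    have V': "ivec v' = ivec v + of_int (l * m * d) *\<^sub>R u" unfolding v'_def u by (rule ivec_add_scaled)
    have d: "cross u (ivec v) = of_int d" "d \<noteq> 0" using ne[OF v(1,2)] by (simp_all add: d_def u cross_ivec)
    have crV': "cross u (ivec v') = of_int d" by (simp add: V' d)
    \<comment> \<open>On the lattice line through the origin \<open>cross u\<close> vanishes, so the
      shear does not change the number that decides whether the line avoids the lattice.\<close>
    have "cross (ivec v') (pathfinish c) \<notin> \<int>" 
      using tail_avoids[OF v(1,3)] v(5) by (simp add: V')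
    then have L': "pathfinish c + t *\<^sub>R ivec v' \<in> punctured_plane" for t
      using line_avoids_lattice_iff[OF v'(1)] by blast
    have "\<exists>c'. tail (2 *\<^sub>R ivec v') c' \<and> N #>\<^bsub>pi1\<^esub> seg_loop (2 *\<^sub>R ivec v) c = N #>\<^bsub>pi1\<^esub> seg_loop (2 *\<^sub>R ivec v') c'"
    proof (rule twist_coset[where k = "\<lambda>j. int j * l * sgn d" and ?z0' = "pathfinish c"])
      fix j
      have "of_int d / \<bar>of_int d :: real\<bar> = of_int (sgn d)" using d(2) by (simp add: sgn_if)
      moreover have "real j / \<bar>of_int d\<bar> * (of_int (l * m * d)) = real j * of_int l * of_int m * (of_int d / \<bar>of_int d\<bar>)"
        by simp
      ultimately have "real j / \<bar>of_int d\<bar> * (of_int (l * m * d)) = of_int (int j * l * sgn d * m)"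
        by simp
      then have "cross (pathfinish c + (real j / \<bar>cross u (ivec v)\<bar>) *\<^sub>R ivec v') w = 
          cross (pathfinish c + (real j / \<bar>cross u (ivec v)\<bar>) *\<^sub>R ivec v) w + of_int (int j * l * sgn d * m)"
        unfolding V' d(1) by (simp only: cross_simps scaleR_add_right scaleR_scaleR cross_u_w)
      then show "\<lfloor>cross (pathfinish c + (real j / \<bar>cross u (ivec v)\<bar>) *\<^sub>R ivec v') w\<rfloor> = 
          \<lfloor>cross (pathfinish c + (real j / \<bar>cross u (ivec v)\<bar>) *\<^sub>R ivec v) w\<rfloor> + int j * l * sgn d * m"
        by (simp only: floor_add_int)
    qed (use v d crV' L' G ivec_lattice in simp_all)
    then show "\<exists>b\<in>loops G x0 s'. N #>\<^bsub>pi1\<^esub> a = N #>\<^bsub>pi1\<^esub> b"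
      using v(4) v' unfolding loops_def by blast
  qed
qed

text \<open>For vertical \<open>u\<close> the gaps are unit intervals on integer vertical lines.
  Reflecting the slope and the starting height changes the number of each gap that is crossed by an
  even amount, which \<open>m = 2\<close> admits.\<close>

lemma coset_related_reflect:
  assumes u: "u = ivec (0, 1)" "w = ivec (-1, 0)" "m = 2" and G: "\<And>v. shift (2 *\<^sub>R ivec v) \<in> G"
    and s: "\<And>v. primitive v \<Longrightarrow> slope v = s \<Longrightarrow> slope (fst v, 2 * k * fst v - snd v) = s'"
  shows "coset_related G x0 N s s'"
proof (cases "s = Infty")
  case True
  have "slope (0, 1) = s" "primitive (0, 1)" using True by (simp_all add: slope_def primitive_def)
  from s[OF this(2,1)] have "s' = s" using True by (simp add: slope_def)
  then show ?thesis by (simp add: coset_related_refl)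
next
  case False
  then have ne: "\<And>v. primitive v \<Longrightarrow> slope v = s \<Longrightarrow> idet (0, 1) v \<noteq> 0" by (auto simp: slope_def idet_def)
  have cu: "cross u z = - fst z" "cross z w = snd z" for z by (simp_all add: u cross_def ivec_def)
  show ?thesis unfolding coset_related_def
  proof
    fix a assume a: "a \<in> loops G x0 s"
    obtain v c where v: "primitive v" "slope v = s" "tail (2 *\<^sub>R ivec v) c" "a = seg_loop (2 *\<^sub>R ivec v) c" 
        "cross u (pathfinish c) = 0"
      using loops_slide[OF a u(1) ne] .
    define v' where "v' = (fst v, 2 * k * fst v - snd v)"
    have v': "primitive v'" "slope v' = s'" unfolding v'_def using primitive_reflect[OF v(1)] s[OF v(1,2)] by simp_all
    define d where "d = fst v"
    have d: "d \<noteq> 0" "cross u (ivec v) = - of_int d" using ne[OF v(1,2)] by (simp_all add: idet_def d_def cu ivec_def)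
    define y0 where "y0 = snd (pathfinish c)"
    have z0: "pathfinish c = (0, y0)" using v(5) by (simp add: cu y0_def prod_eq_iff)
    \<comment> \<open>The second line starts at height \<open>2 * F + 1 - y0\<close>, the mirror
      image of \<open>y0\<close> within its gap between \<open>F\<close> and
      \<open>F + 1\<close>.\<close>
    define F where "F = \<lfloor>y0\<rfloor>"
    have "of_int d * y0 \<notin> \<int>" using tail_avoids[OF v(1,3)] by (simp add: z0 cross_def ivec_def d_def)
    moreover have "of_int d * y0 = of_int (d * (2 * F + 1)) - cross (ivec v') (0, 2 * of_int F + 1 - y0)"
      by (simp add: cross_def ivec_def v'_def d_def algebra_simps)
    ultimately have "cross (ivec v') (0, 2 * of_int F + 1 - y0) \<notin> \<int>"
      by (metis Ints_diff Ints_of_int)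
    then have L': "(0, 2 * of_int F + 1 - y0) + t *\<^sub>R ivec v' \<in> punctured_plane" for t
      using line_avoids_lattice_iff[OF v'(1)] by blast
    define y where "y j = y0 + real j / \<bar>of_int d\<bar> * of_int (snd v)" for j
    have y: "y j \<notin> \<int>" for j
    proof -
      have "pathfinish c + (real j / \<bar>of_int d\<bar> / 2) *\<^sub>R 2 *\<^sub>R ivec v \<in> punctured_plane"
        using v(3) unfolding tail_def by blast
      then have "(real j / \<bar>of_int d\<bar> * of_int d, y j) \<in> punctured_plane"
        by (simp add: z0 y_def ivec_def d_def)
      moreover have "real j / \<bar>of_int d\<bar> * of_int d = of_int (int j * sgn d)" using d(1) by (simp add: sgn_if)
      ultimately show ?thesis unfolding punctured_plane_def by (metis DiffD2 Ints_of_int SigmaI)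
    qed
    \<comment> \<open>The mirrored crossing is an odd integer minus \<open>y j\<close>. As
      \<open>y j\<close> is not an integer, the floor is that odd integer minus 1 minus the floor of
      \<open>y j\<close>, hence of the same parity as the latter.\<close>
    have y': "\<lfloor>2 * of_int F + 1 - y0 + real j / \<bar>of_int d\<bar> * of_int (2 * k * d - snd v)\<rfloor> = 
       \<lfloor>y j\<rfloor> + (F + k * (int j * sgn d) - \<lfloor>y j\<rfloor>) * 2" for j
    proof -
      have "real j / \<bar>of_int d\<bar> * of_int d = of_int (int j * sgn d)" using d(1) by (simp add: sgn_if)
      then have "real j / \<bar>of_int d\<bar> * of_int (2 * k * d - snd v) = of_int (2 * k * (int j * sgn d)) - real j / \<bar>of_int d\<bar> * of_int (snd v)"
        by (simp add: right_diff_distrib) (metis (no_types, lifting) mult.commute mult.left_commute times_divide_eq_left)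
      then have e: "2 * of_int F + 1 - y0 + real j / \<bar>of_int d\<bar> * of_int (2 * k * d - snd v) = 
          of_int (2 * F + 1 + 2 * k * (int j * sgn d)) - y j"
        unfolding y_def by simp
      have "y j \<noteq> of_int \<lfloor>y j\<rfloor>" using y[of j] by (metis Ints_of_int)
      then have "\<lfloor>of_int (2 * F + 1 + 2 * k * (int j * sgn d)) - y j\<rfloor> = 2 * F + 2 * k * (int j * sgn d) - \<lfloor>y j\<rfloor>"
      proof (intro floor_unique)
        have "of_int \<lfloor>y j\<rfloor> < y j" using \<open>y j \<noteq> of_int \<lfloor>y j\<rfloor>\<close> floor_correct[of "y j"] by linarith
        then show "of_int (2 * F + 2 * k * (int j * sgn d) - \<lfloor>y j\<rfloor>) \<le> of_int (2 * F + 1 + 2 * k * (int j * sgn d)) - y j"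
          "of_int (2 * F + 1 + 2 * k * (int j * sgn d)) - y j < of_int (2 * F + 2 * k * (int j * sgn d) - \<lfloor>y j\<rfloor>) + 1"
          using floor_correct[of "y j"] by (simp_all, linarith+)
      qed
      then show ?thesis unfolding e by (simp add: algebra_simps)
    qed
    have "\<exists>c'. tail (2 *\<^sub>R ivec v') c' \<and> N #>\<^bsub>pi1\<^esub> seg_loop (2 *\<^sub>R ivec v) c = N #>\<^bsub>pi1\<^esub> seg_loop (2 *\<^sub>R ivec v') c'"
    proof (rule twist_coset[where k = "\<lambda>j. F + k * (int j * sgn d) - \<lfloor>y j\<rfloor>" and ?z0' = "(0, 2 * of_int F + 1 - y0)"])
      fix j
      show "\<lfloor>cross ((0, 2 * real_of_int F + 1 - y0) + (real j / \<bar>cross u (ivec v)\<bar>) *\<^sub>R ivec v') w\<rfloor> =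
         \<lfloor>cross (pathfinish c + (real j / \<bar>cross u (ivec v)\<bar>) *\<^sub>R ivec v) w\<rfloor> + (F + k * (int j * sgn d) - \<lfloor>y j\<rfloor>) * m"
        using y'[of j] unfolding d(2) cu z0 u(3) y_def by (simp add: ivec_def v'_def d_def)
    qed (use v d L' G ivec_lattice in \<open>simp_all add: cu z0 F_def y_def\<close>, simp_all add: ivec_def v'_def d_def)
    then show "\<exists>b\<in>loops G x0 s'. N #>\<^bsub>pi1\<^esub> a = N #>\<^bsub>pi1\<^esub> b"
      using v(4) v' unfolding loops_def by blast
  qed
qed

end

section \<open>The kernels of the Heckoid groups\<close>

text \<open>The carrier is itself a normal subgroup containing \<open>A\<close>, so the intersection
  runs over a nonempty family.\<close>

lemma normal_closure_normal:
  assumes "group G" "A \<subseteq> carrier G"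
  shows "normal_closure G A \<lhd> G"
proof -
  interpret group G by fact
  have c: "carrier G \<lhd> G"
    unfolding normal_inv_iff using subgroup_self by simp
  show ?thesis unfolding normal_inv_iff
  proof (intro conjI ballI)
    show "subgroup (normal_closure G A) G"
      unfolding normal_closure_def
      by (rule subgroups_Inter) (use c assms(2) in \<open>auto simp: normal_inv_iff\<close>)
    fix x h assume "x \<in> carrier G" "h \<in> normal_closure G A"
    then show "x \<otimes>\<^bsub>G\<^esub> h \<otimes>\<^bsub>G\<^esub> inv\<^bsub>G\<^esub> x \<in> normal_closure G A"
      unfolding normal_closure_def normal_inv_iff by blast
  qed
qed

lemma normal_closure_incl: "a \<in> A \<Longrightarrow> a \<in> normal_closure G A"
  by (auto simp: normal_closure_def)

lemma convex_lines_of_slope: "L \<in> lines_of_slope s \<Longrightarrow> convex L"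
proof (cases s)
  case (Fin t)
  assume "L \<in> lines_of_slope s"
  then obtain c where L: "L = {(x, y). y = of_rat t * x + c}" using Fin by auto
  have "u * (of_rat t * a + c) + v * (of_rat t * b + c) = of_rat t * (u * a + v * b) + c" if "u + v = 1" for u v a b
  proof -
    have "u * (of_rat t * a + c) + v * (of_rat t * b + c) = of_rat t * (u * a + v * b) + (u + v) * c"
      by (simp add: algebra_simps)
    then show ?thesis using that by simp
  qed
  then show ?thesis unfolding L convex_def by auto
next
  case Infty
  assume "L \<in> lines_of_slope s"
  then obtain c where L: "L = {(x, y). x = c}" using Infty by auto
  have "u * c + v * c = c" if "u + v = 1" for u v using that by (metis distrib_right mult_1)
  then show ?thesis unfolding L convex_def by auto
qed

text \<open>A generator of the stabiliser maps the line to itself, and lines are convex, so the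
  segment from a point to its image stays on the line and avoids the punctures.\<close>

lemma line_loop_carrier:
  assumes "orbifold punctured_plane G x0" "K \<subseteq> G" "\<And>g. g \<in> K \<Longrightarrow> bij g"
  shows "line_loop K x0 s \<subseteq> carrier (orbifold_pi1 punctured_plane G x0)"
proof
  interpret orbifold punctured_plane G x0 by fact
  fix a assume "a \<in> line_loop K x0 s"
  then obtain g c L where a: "a = (g, path_class punctured_plane
            (c +++ linepath (pathfinish c) (g (pathfinish c)) +++ reversepath (g \<circ> c)))"
     and L: "L \<in> lines_of_slope s" "L \<subseteq> punctured_plane" "pathfinish c \<in> L"
     and c: "path c" "path_image c \<subseteq> punctured_plane" "pathstart c = x0"
     and g: "g \<in> K" "generate (BijGroup UNIV) {g} = {h \<in> K. h ` L = L}"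
    unfolding line_loop_def by blast
  have "g \<in> {h \<in> K. h ` L = L}" using generate.incl[of g "{g}" "BijGroup UNIV"] g(2) by blast
  then have "g (pathfinish c) \<in> L" using L(3) by blast
  then have "closed_segment (pathfinish c) (g (pathfinish c)) \<subseteq> punctured_plane"
    using closed_segment_subset[OF L(3) _ convex_lines_of_slope[OF L(1)]] L(2) by blast
  then have "lift_path g (c +++ linepath (pathfinish c) (g (pathfinish c)) +++ reversepath (g \<circ> c))"
    using c g(1) assms(2) unfolding lift_path_def
    by (simp add: subsetD path_G path_image_G subset_path_image_join pathstart_compose pathfinish_compose)
  then show "a \<in> carrier pi1" unfolding a by (auto simp: carrier_pi1)
qed

lemma subgroup_nat_pow: "subgroup N G \<Longrightarrow> x \<in> N \<Longrightarrow> x [^]\<^bsub>G\<^esub> (k::nat) \<in> N"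
  by (induction k) (simp_all add: subgroup.one_closed subgroup.m_closed)

text \<open>In the even case \<open>\<kappa> = 2\<close> and \<open>K\<close> is the group of the 4-punctured sphere, in the odd case
  \<open>\<kappa> = 1\<close> and \<open>K\<close> is the lattice of the punctured torus; both give loops with translation part
  \<open>2 n u\<close>.\<close>

lemma twist_kernelI:
  assumes O: "orbifold punctured_plane G x0" and N: "subgroup N (orbifold_pi1 punctured_plane G x0)"
    and u: "idet u w = 1" and "K \<subseteq> G"
    and K: "\<And>h. h \<in> K \<Longrightarrow> (\<exists>w\<in>\<int> \<times> \<int>. h = shift (real \<kappa> *\<^sub>R w)) \<or> (\<exists>w\<in>\<int> \<times> \<int>. h = pi_rotation w)"
    and K': "\<And>w. w \<in> \<int> \<times> \<int> \<Longrightarrow> shift (real \<kappa> *\<^sub>R w) \<in> K" and "\<kappa> \<noteq> 0"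
    and B: "\<And>b. b \<in> line_loop K x0 (slope u) \<Longrightarrow> b [^]\<^bsub>orbifold_pi1 punctured_plane G x0\<^esub> p \<in> N"
  shows "twist G x0 N (ivec u) (ivec w) (int (\<kappa> * p))"
proof -
  interpret orbifold punctured_plane G x0 by fact
  interpret group pi1 by (rule group_pi1)
  have loop: "seg_loop (real (\<kappa> * p * l) *\<^sub>R ivec v) c \<in> N"
    if v: "primitive v" "slope v = slope u" and c: "path c" "path_image c \<subseteq> punctured_plane" "pathstart c = x0"
      "cross (ivec v) (pathfinish c) \<notin> \<int>" for v c l
  proof -
    have av: "pathfinish c + t *\<^sub>R ivec v \<in> punctured_plane" for t
      using line_avoids_lattice_iff[OF v(1)] c(4) by blast
    have "shift (real \<kappa> *\<^sub>R ivec v) \<in> G" using K'[OF ivec_lattice] \<open>K \<subseteq> G\<close> by blast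
    then have t: "tail (real \<kappa> *\<^sub>R ivec v) c" using c av by (simp add: tail_def)
    have "seg_loop (real \<kappa> *\<^sub>R ivec v) c \<in> line_loop K x0 (slope u)"
      unfolding seg_loop_def v(2)[symmetric]
      by (rule line_loop_memI[OF K K' _ v(1) c(1-3) av]) (use \<open>\<kappa> \<noteq> 0\<close> in auto)
    from subgroup_nat_pow[OF N B[OF this]] have "seg_loop (real \<kappa> *\<^sub>R ivec v) c [^]\<^bsub>pi1\<^esub> (p * l) \<in> N"
      using seg_loop_carrier[OF t] by (simp add: nat_pow_pow)
    then show ?thesis unfolding seg_loop_pow[OF t] by (simp add: mult.commute mult.left_commute)
  qed
  have shift: "shift (of_int (int (\<kappa> * p)) *\<^sub>R ivec u) \<in> G"
  proof -
    have "of_int (int p) *\<^sub>R ivec u \<in> \<int> \<times> \<int>" by (rule lattice_scale[OF Ints_of_int ivec_lattice])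
    from subsetD[OF \<open>K \<subseteq> G\<close> K'[OF this]]
    have "shift (real \<kappa> *\<^sub>R (of_int (int p) *\<^sub>R ivec u)) \<in> G" .
    moreover have "real \<kappa> *\<^sub>R (of_int (int p) *\<^sub>R ivec u) = of_int (int (\<kappa> * p)) *\<^sub>R ivec u" by simp
    ultimately show ?thesis by (simp only:)
  qed
  have final: "seg_loop (of_int (l * int (\<kappa> * p)) *\<^sub>R ivec u) c \<in> N"
    if t: "tail (of_int (l * int (\<kappa> * p)) *\<^sub>R ivec u) c" "cross (ivec u) (pathfinish c) \<notin> \<int>" for c l
  proof (cases "l \<ge> 0")
    case True
    then have e: "real (\<kappa> * p * nat l) *\<^sub>R ivec u = of_int (l * int (\<kappa> * p)) *\<^sub>R ivec u" by simp
    have "seg_loop (real (\<kappa> * p * nat l) *\<^sub>R ivec u) c \<in> N"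
      by (rule loop[OF idet_1_primitive[OF u] refl _ _ _ t(2)]) (use t(1) in \<open>simp_all only: tail_def\<close>)
    then show ?thesis by (simp only: e)
  next
    case False
    \<comment> \<open>Negative multiples of \<open>u\<close> are positive multiples of the opposite
      vector, which has the same slope and so gives killed loops as well.\<close>
    define v where "v = (- fst u, - snd u)"
    have v: "primitive v" "slope v = slope u" "ivec v = - ivec u"
      using idet_1_primitive[OF u] by (simp_all add: v_def primitive_def slope_def ivec_def)
    have nc: "cross (ivec v) (pathfinish c) \<notin> \<int>" using t(2) by (simp add: v(3))
    have tc: "path c" "path_image c \<subseteq> punctured_plane" "pathstart c = x0" using t(1) unfolding tail_def by blast+
    have "seg_loop (real (\<kappa> * p * nat (- l)) *\<^sub>R ivec v) c \<in> N"
      by (rule loop[OF v(1,2) tc nc])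
    moreover have "real (\<kappa> * p * nat (- l)) *\<^sub>R ivec v = of_int (l * int (\<kappa> * p)) *\<^sub>R ivec u"
      using False by (simp add: v(3))
    ultimately show ?thesis by (simp only:)
  qed
  show ?thesis
    unfolding twist_def twist_axioms_def
    using O N shift final ivec_lattice u by (simp add: cross_ivec)
qed

text \<open>The carrier \<open>C\<close> is not assumed to be closed, so the conjugating element is
  the identity, whose inverse in the restricted structure is computed directly.\<close>

lemma conj_up_to_inv_refl:
  assumes "group M" "C \<subseteq> carrier M" "\<one>\<^bsub>M\<^esub> \<in> C" "x \<in> C"
  shows "conj_up_to_inv (M\<lparr>carrier := C\<rparr>) x x"
proof -
  interpret group M by fact
  have "inv\<^bsub>M\<lparr>carrier := C\<rparr>\<^esub> \<one>\<^bsub>M\<^esub> = \<one>\<^bsub>M\<^esub>"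
    unfolding m_inv_def using assms(2,3) by (intro the_equality) auto
  then show ?thesis unfolding conj_up_to_inv_def using assms by (intro bexI[of _ "\<one>\<^bsub>M\<^esub>"]) auto
qed

section \<open>Even and odd Heckoid groups treated together\<close>

definition heckoid_deck_group :: "rat \<Rightarrow> (plane \<Rightarrow> plane) set" where
  "heckoid_deck_group n = (if n \<in> \<int> then H_group else H_hat_group)"

definition heckoid_kernel :: "plane \<Rightarrow> rat \<Rightarrow> rat \<Rightarrow> ((plane \<Rightarrow> plane) \<times> (real \<Rightarrow> plane) set) set" where
  "heckoid_kernel x0 r n = (if n \<in> \<int> then even_kernel x0 r (nat \<lfloor>n\<rfloor>) else odd_kernel x0 r (nat \<lfloor>2 * n\<rfloor>))"

lemma H_cases: "h \<in> H_group \<Longrightarrow> (\<exists>w\<in>\<int> \<times> \<int>. h = shift (real 2 *\<^sub>R w)) \<or> (\<exists>w\<in>\<int> \<times> \<int>. h = pi_rotation w)"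
  unfolding H_group_eq of_nat_numeral by blast

lemma shift_H: "w \<in> \<int> \<times> \<int> \<Longrightarrow> shift (real 2 *\<^sub>R w) \<in> H_group"
  unfolding H_group_eq of_nat_numeral by blast

lemma H_subset_H_hat: "H_group \<subseteq> H_hat_group"
proof -
  have "2 *\<^sub>R a \<in> \<int> \<times> \<int>" if "a \<in> \<int> \<times> \<int>" for a :: plane
    using lattice_scale[OF _ that, of 2] by simp
  then show ?thesis unfolding H_group_eq H_hat_group_eq by blast
qed

lemma Z2_cases: "h \<in> Z2_group \<Longrightarrow> (\<exists>w\<in>\<int> \<times> \<int>. h = shift (real 1 *\<^sub>R w)) \<or> (\<exists>w\<in>\<int> \<times> \<int>. h = pi_rotation w)"
  unfolding Z2_group_def shift_def of_nat_1 scaleR_one by blast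

lemma shift_Z2: "w \<in> \<int> \<times> \<int> \<Longrightarrow> shift (real 1 *\<^sub>R w) \<in> Z2_group"
  unfolding Z2_group_def shift_def of_nat_1 scaleR_one by blast

lemma Z2_subset_H_hat: "Z2_group \<subseteq> H_hat_group"
proof
  fix h assume "h \<in> Z2_group"
  then obtain w where w: "w \<in> \<int> \<times> \<int>" "h = shift w" unfolding Z2_group_def shift_def by blast
  have "2 *\<^sub>R ((1 / 2) *\<^sub>R w) = w" by simp
  then have "h = shift (2 *\<^sub>R ((1 / 2) *\<^sub>R w))" "2 *\<^sub>R ((1 / 2) *\<^sub>R w) \<in> \<int> \<times> \<int>" using w by (simp_all only:)
  then show "h \<in> H_hat_group" unfolding H_hat_group_eq
    by (intro UnI1 image_eqI[of _ _ "(1 / 2) *\<^sub>R w"] CollectI)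
qed

lemma bij_H: "g \<in> H_group \<Longrightarrow> bij g" and bij_H_hat: "g \<in> H_hat_group \<Longrightarrow> bij g"
  unfolding H_group_def H_hat_group_def
  by (erule generate_BijGroup_bij, elim imageE, simp only: bij_pi_rotation)+

lemma orbifold_heckoid_deck_group: "x0 \<in> punctured_plane \<Longrightarrow> orbifold punctured_plane (heckoid_deck_group n) x0"
  by (simp add: heckoid_deck_group_def orbifold_H orbifold_H_hat)

lemma shift_heckoid_deck_group: "shift (2 *\<^sub>R ivec v) \<in> heckoid_deck_group n"
  using shift_H[OF ivec_lattice[of v]] H_subset_H_hat unfolding heckoid_deck_group_def of_nat_numeral
  by (simp only: subsetD simp_thms split: if_split)

lemma alpha_carrier_S: "x0 \<in> punctured_plane \<Longrightarrow> alpha x0 s \<subseteq> carrier (pi1_S x0)"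
  unfolding alpha_def by (rule line_loop_carrier[OF orbifold_H]) (simp_all add: bij_H)

lemma beta_carrier_O: "x0 \<in> punctured_plane \<Longrightarrow> beta x0 s \<subseteq> carrier (pi1_O x0)"
  unfolding beta_def
  by (rule line_loop_carrier[OF orbifold_H_hat Z2_subset_H_hat]) (use Z2_subset_H_hat bij_H_hat in auto)

lemma carrier_S_subset_O:
  "x0 \<in> punctured_plane \<Longrightarrow> carrier (pi1_S x0) \<subseteq> carrier (pi1_O x0)"
  using H_subset_H_hat unfolding orbifold_pi1_def by auto

lemma heckoid_kernel_normal:
  assumes "x0 \<in> punctured_plane"
  shows "heckoid_kernel x0 r n \<lhd> orbifold_pi1 punctured_plane (heckoid_deck_group n) x0"
proof (cases "n \<in> \<int>")
  case True
  interpret group "pi1_S x0" by (rule orbifold.group_pi1[OF orbifold_H[OF assms]])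
  have "alpha x0 Infty \<union> (\<lambda>a. a [^]\<^bsub>pi1_S x0\<^esub> nat \<lfloor>n\<rfloor>) ` alpha x0 (Fin r) \<subseteq> carrier (pi1_S x0)"
    using alpha_carrier_S[OF assms, of Infty] alpha_carrier_S[OF assms, of "Fin r"] nat_pow_closed by blast
  from normal_closure_normal[OF group_axioms this] show ?thesis
    using True by (simp add: heckoid_kernel_def heckoid_deck_group_def even_kernel_def)
next
  case False
  interpret group "pi1_O x0" by (rule orbifold.group_pi1[OF orbifold_H_hat[OF assms]])
  have "(\<lambda>b. b [^]\<^bsub>pi1_O x0\<^esub> (2::nat)) ` beta x0 Infty \<union> (\<lambda>b. b [^]\<^bsub>pi1_O x0\<^esub> nat \<lfloor>2 * n\<rfloor>) ` beta x0 (Fin r)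
      \<subseteq> carrier (pi1_O x0)"
    using beta_carrier_O[OF assms, of Infty] beta_carrier_O[OF assms, of "Fin r"] nat_pow_closed by blast
  from normal_closure_normal[OF group_axioms this] show ?thesis
    using False by (simp add: heckoid_kernel_def heckoid_deck_group_def odd_kernel_def)
qed

text \<open>For slope infinity the exponent is 1 in the even case, where the loop itself is killed,
  and 2 in the odd case; either way the translation part is \<open>2 (0, 1)\<close>. The vector
  \<open>(- 1, 0)\<close> completes \<open>(0, 1)\<close> to a pair of determinant 1.\<close>

lemma twist_heckoid:
  assumes x0: "x0 \<in> punctured_plane" and n: "n > 1" "2 * n \<in> \<int>"
    and u: "slope u = Fin r" "idet u w = 1"
  shows "twist (heckoid_deck_group n) x0 (heckoid_kernel x0 r n) (ivec u) (ivec w) \<lfloor>2 * n\<rfloor>"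
    and "twist (heckoid_deck_group n) x0 (heckoid_kernel x0 r n) (ivec (0, 1)) (ivec (- 1, 0)) 2"
proof -
  have N: "subgroup (heckoid_kernel x0 r n) (orbifold_pi1 punctured_plane (heckoid_deck_group n) x0)"
    using heckoid_kernel_normal[OF x0] normal_imp_subgroup by blast
  have s: "slope (0, 1) = Infty" "idet (0, 1) (- 1, 0) = 1" by (simp_all add: slope_def idet_def)
  note O = orbifold_heckoid_deck_group[OF x0]
  show "twist (heckoid_deck_group n) x0 (heckoid_kernel x0 r n) (ivec u) (ivec w) \<lfloor>2 * n\<rfloor>"
  proof (cases "n \<in> \<int>")
    case True
    then obtain i where i: "n = of_int i" by (auto elim: Ints_cases)
    have "\<lfloor>2 * n\<rfloor> = 2 * i" unfolding i by (metis floor_of_int of_int_mult of_int_numeral)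
    then have m: "\<lfloor>2 * n\<rfloor> = int (2 * nat \<lfloor>n\<rfloor>)" using n(1) by (simp add: i)
    show ?thesis
    proof (subst m, rule twist_kernelI[OF O N u(2) _ H_cases shift_H])
      show "H_group \<subseteq> heckoid_deck_group n" using True  by (simp add: heckoid_deck_group_def)
      show "(2::nat) \<noteq> 0" by simp
      fix b assume "b \<in> line_loop H_group x0 (slope u)"
      then have "b [^]\<^bsub>pi1_S x0\<^esub> nat \<lfloor>n\<rfloor> \<in> even_kernel x0 r (nat \<lfloor>n\<rfloor>)"
        unfolding even_kernel_def alpha_def u(1) by (intro normal_closure_incl) blast
      then show "b [^]\<^bsub>orbifold_pi1 punctured_plane (heckoid_deck_group n) x0\<^esub> nat \<lfloor>n\<rfloor> \<in> heckoid_kernel x0 r n"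
        using True by (simp add: heckoid_deck_group_def heckoid_kernel_def)
    qed
  next
    case False
    have m: "\<lfloor>2 * n\<rfloor> = int (1 * nat \<lfloor>2 * n\<rfloor>)" using n(1) by simp
    show ?thesis
    proof (subst m, rule twist_kernelI[OF O N u(2) _ Z2_cases shift_Z2])
      show "Z2_group \<subseteq> heckoid_deck_group n" using False Z2_subset_H_hat by (simp add: heckoid_deck_group_def)
      show "(1::nat) \<noteq> 0" by simp
      fix b assume "b \<in> line_loop Z2_group x0 (slope u)"
      then have "b [^]\<^bsub>pi1_O x0\<^esub> nat \<lfloor>2 * n\<rfloor> \<in> odd_kernel x0 r (nat \<lfloor>2 * n\<rfloor>)"
        unfolding odd_kernel_def beta_def u(1) by (intro normal_closure_incl) blast
      then show "b [^]\<^bsub>orbifold_pi1 punctured_plane (heckoid_deck_group n) x0\<^esub> nat \<lfloor>2 * n\<rfloor> \<in> heckoid_kernel x0 r n"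
        using False by (simp add: heckoid_deck_group_def heckoid_kernel_def)
    qed
  qed
  show "twist (heckoid_deck_group n) x0 (heckoid_kernel x0 r n) (ivec (0, 1)) (ivec (- 1, 0)) 2"
  proof (cases "n \<in> \<int>")
    case True
    have m: "2 = int (2 * 1)" by simp
    interpret G: group "pi1_S x0" by (rule orbifold.group_pi1[OF orbifold_H[OF x0]])
    have p: "b [^]\<^bsub>pi1_S x0\<^esub> (1::nat) = b" if "b \<in> line_loop H_group x0 Infty" for b
    proof -
      have "b \<in> carrier (pi1_S x0)" using that alpha_carrier_S[OF x0, of Infty] unfolding alpha_def by blast
      then show ?thesis by simp
    qed
    show ?thesis
    proof (subst m, rule twist_kernelI[OF O N s(2) _ H_cases shift_H])
      show "H_group \<subseteq> heckoid_deck_group n" using True  by (simp add: heckoid_deck_group_def)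
      show "(2::nat) \<noteq> 0" by simp
      fix b assume b: "b \<in> line_loop H_group x0 (slope (0, 1))"
      then have "b \<in> even_kernel x0 r (nat \<lfloor>n\<rfloor>)"
        unfolding even_kernel_def alpha_def s(1) by (intro normal_closure_incl) blast
      moreover have "b [^]\<^bsub>pi1_S x0\<^esub> (1::nat) = b" using p b unfolding s(1) .
      ultimately show "b [^]\<^bsub>orbifold_pi1 punctured_plane (heckoid_deck_group n) x0\<^esub> (1::nat) \<in> heckoid_kernel x0 r n"
        using True by (simp add: heckoid_deck_group_def heckoid_kernel_def)
    qed
  next
    case False
    have m: "2 = int (1 * 2)" by simp
    show ?thesis
    proof (subst m, rule twist_kernelI[OF O N s(2) _ Z2_cases shift_Z2])
      show "Z2_group \<subseteq> heckoid_deck_group n" using False Z2_subset_H_hat by (simp add: heckoid_deck_group_def)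
      show "(1::nat) \<noteq> 0" by simp
      fix b assume "b \<in> line_loop Z2_group x0 (slope (0, 1))"
      then have "b [^]\<^bsub>pi1_O x0\<^esub> (2::nat) \<in> odd_kernel x0 r (nat \<lfloor>2 * n\<rfloor>)"
        unfolding odd_kernel_def beta_def s(1) by (intro normal_closure_incl) blast
      then show "b [^]\<^bsub>orbifold_pi1 punctured_plane (heckoid_deck_group n) x0\<^esub> (2::nat) \<in> heckoid_kernel x0 r n"
        using False by (simp add: heckoid_deck_group_def heckoid_kernel_def)
    qed
  qed
qed

lemma loops_subset_alpha:
  assumes "x0 \<in> punctured_plane" shows "loops (heckoid_deck_group n) x0 s \<subseteq> alpha x0 s"
proof
  interpret orbifold punctured_plane "heckoid_deck_group n" x0 by (rule orbifold_heckoid_deck_group[OF assms])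
  fix a assume "a \<in> loops (heckoid_deck_group n) x0 s"
  then obtain v c where v: "primitive v" "slope v = s" "tail (2 *\<^sub>R ivec v) c" "a = seg_loop (2 *\<^sub>R ivec v) c"
    unfolding loops_def by blast
  have t: "path c" "path_image c \<subseteq> punctured_plane" "pathstart c = x0"
      "\<forall>t. pathfinish c + t *\<^sub>R 2 *\<^sub>R ivec v \<in> punctured_plane" using v(3) unfolding tail_def by blast+
  have av: "pathfinish c + t *\<^sub>R ivec v \<in> punctured_plane" for t
    using spec[OF t(4), of "t / 2"] by simp
  have "seg_loop (real 2 *\<^sub>R ivec v) c \<in> line_loop H_group x0 (slope v)"
    unfolding seg_loop_def by (rule line_loop_memI[OF H_cases shift_H _ v(1) t(1-3) av]) simp_all
  then show "a \<in> alpha x0 s" by (simp add: v(2,4) alpha_def)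
qed

text \<open>A primitive vertical vector is \<open>(0, 1)\<close> or its negative, so these loops are
  the killed ones themselves, run once in either direction.\<close>

lemma loops_Infty_subset:
  assumes x0: "x0 \<in> punctured_plane" and n: "n > 1" "2 * n \<in> \<int>"
    and u: "slope u = Fin r" "idet u w = 1"
  shows "loops (heckoid_deck_group n) x0 Infty \<subseteq> heckoid_kernel x0 r n"
proof
  interpret twist "heckoid_deck_group n" x0 "heckoid_kernel x0 r n" "ivec (0, 1)" "ivec (- 1, 0)" 2 by (rule twist_heckoid(2)[OF assms])
  fix a assume "a \<in> loops (heckoid_deck_group n) x0 Infty"
  then obtain v c where v: "primitive v" "slope v = Infty" "tail (2 *\<^sub>R ivec v) c" "a = seg_loop (2 *\<^sub>R ivec v) c"
    unfolding loops_def by blast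
  have "fst v = 0" using v(2) by (simp add: slope_def split: if_splits)
  then have e: "2 *\<^sub>R ivec v = of_int (snd v * 2) *\<^sub>R ivec (0, 1)" by (simp add: ivec_def)
  have "\<bar>snd v\<bar> = 1" using v(1) \<open>fst v = 0\<close> by (simp add: primitive_def)
  then have sv: "snd v = 1 \<or> snd v = -1" by linarith
  have "cross (ivec v) (pathfinish c) \<notin> \<int>" by (rule tail_avoids[OF v(1,3)])
  moreover have "cross (ivec v) (pathfinish c) = of_int (snd v) * cross (ivec (0, 1)) (pathfinish c)"
    using \<open>fst v = 0\<close> by (simp add: cross_def ivec_def)
  ultimately have "cross (ivec (0, 1)) (pathfinish c) \<notin> \<int>" by auto
  from seg_loop_u[OF v(3)[unfolded e] this] show "a \<in> heckoid_kernel x0 r n" unfolding v(4) e .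
qed

lemma heckoid_proj_eq: "heckoid_proj x0 r n a = heckoid_kernel x0 r n #>\<^bsub>orbifold_pi1 punctured_plane (heckoid_deck_group n) x0\<^esub> a"
  by (simp add: heckoid_proj_def heckoid_kernel_def heckoid_deck_group_def)

lemma heckoid_group_one: "\<one>\<^bsub>heckoid_group x0 r n\<^esub> = heckoid_kernel x0 r n"
  by (simp add: heckoid_group_def heckoid_kernel_def FactGroup_def)

lemma conj_heckoid_refl:
  assumes x0: "x0 \<in> punctured_plane" and a: "a \<in> alpha x0 s"
  shows "conj_up_to_inv (heckoid_group x0 r n) (heckoid_proj x0 r n a) (heckoid_proj x0 r n a)"
proof -
  let ?M = "orbifold_pi1 punctured_plane (heckoid_deck_group n) x0 Mod heckoid_kernel x0 r n"
  interpret N: normal "heckoid_kernel x0 r n" "orbifold_pi1 punctured_plane (heckoid_deck_group n) x0" by (rule heckoid_kernel_normal[OF x0])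
  have aS: "a \<in> carrier (pi1_S x0)" using a alpha_carrier_S[OF x0] by blast
  have "carrier (pi1_S x0) \<subseteq> carrier (orbifold_pi1 punctured_plane (heckoid_deck_group n) x0)"
    using carrier_S_subset_O[OF x0] by (simp add: heckoid_deck_group_def)
  then have sub: "heckoid_proj x0 r n ` carrier (pi1_S x0) \<subseteq> carrier ?M"
    unfolding heckoid_proj_eq by (auto simp: FactGroup_def RCOSETS_def)
  have one: "heckoid_proj x0 r n \<one>\<^bsub>pi1_S x0\<^esub> = \<one>\<^bsub>?M\<^esub>"
  proof -
    have "\<one>\<^bsub>pi1_S x0\<^esub> = \<one>\<^bsub>orbifold_pi1 punctured_plane (heckoid_deck_group n) x0\<^esub>" by (simp add: orbifold_pi1_def)
    then show ?thesis unfolding heckoid_proj_eq using N.subset by (simp add: FactGroup_def)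
  qed
  have o: "\<one>\<^bsub>pi1_S x0\<^esub> \<in> carrier (pi1_S x0)"
    using orbifold.group_pi1[OF orbifold_H[OF x0]] by (simp add: group.is_monoid)
  \<comment> \<open>The even group has the full quotient as its carrier, the odd one the image of
    the group of the 4-punctured sphere; these are the two extreme choices of
    \<open>C\<close>.\<close>
  have "conj_up_to_inv (?M\<lparr>carrier := C\<rparr>) (heckoid_proj x0 r n a) (heckoid_proj x0 r n a)"
    if "heckoid_proj x0 r n ` carrier (pi1_S x0) \<subseteq> C" "C \<subseteq> carrier ?M" for C
  proof (rule conj_up_to_inv_refl[OF N.factorgroup_is_group that(2)])
    show "\<one>\<^bsub>?M\<^esub> \<in> C" unfolding one[symmetric] using that(1) o by blast
    show "heckoid_proj x0 r n a \<in> C" using that(1) aS by blast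
  qed
  from this[OF sub order_refl] this[OF order_refl sub] show ?thesis
    by (cases "n \<in> \<int>") (simp_all add: heckoid_group_def heckoid_deck_group_def heckoid_kernel_def)
qed

lemma homotopic_heckoidI:
  assumes x0: "x0 \<in> punctured_plane" and n: "n > 1" "2 * n \<in> \<int>"
    and u: "slope u = Fin r" "idet u w = 1"
    and rel: "coset_related (heckoid_deck_group n) x0 (heckoid_kernel x0 r n) s s'" and v: "primitive v" "slope v = s"
  shows "homotopic_in_heckoid x0 r n s s'" "s' = Infty \<Longrightarrow> null_homotopic_in_heckoid x0 r n s"
proof -
  interpret N: normal "heckoid_kernel x0 r n" "orbifold_pi1 punctured_plane (heckoid_deck_group n) x0" by (rule heckoid_kernel_normal[OF x0])
  obtain a where a: "a \<in> loops (heckoid_deck_group n) x0 s"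
    using loops_nonempty[OF orbifold_heckoid_deck_group[OF x0] shift_heckoid_deck_group v] by blast
  then obtain b where b: "b \<in> loops (heckoid_deck_group n) x0 s'" "heckoid_proj x0 r n a = heckoid_proj x0 r n b"
    using rel unfolding coset_related_def heckoid_proj_eq by blast
  note al = subsetD[OF loops_subset_alpha[OF x0]]
  show "homotopic_in_heckoid x0 r n s s'"
    unfolding homotopic_in_heckoid_def
    using al[OF a] al[OF b(1)] conj_heckoid_refl[OF x0 al[OF a], of r] b(2) by metis
  assume "s' = Infty"
  then have "b \<in> heckoid_kernel x0 r n" using b(1) loops_Infty_subset[OF x0 n u] by blast
  then have "heckoid_proj x0 r n b = heckoid_kernel x0 r n"
    unfolding heckoid_proj_eq by (rule N.rcos_const[OF N.is_group])
  then show "null_homotopic_in_heckoid x0 r n s"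
    unfolding null_homotopic_in_heckoid_def heckoid_group_one using al[OF a] b(2) by metis
qed

section \<open>The Farey tessellation in terms of determinants\<close>

text \<open>The coordinate on the ideal boundary that sends \<open>r\<close> to infinity, so that parabolics fixing
  \<open>r\<close> become translations. Its value at \<open>r\<close> itself is the junk value \<open>0\<close>.\<close>

definition chi :: "rat \<Rightarrow> qhat \<Rightarrow> rat" where
  "chi r s = (case s of Fin x \<Rightarrow> 1 / (x - r) | Infty \<Rightarrow> 0)"

definition chi_inv :: "rat \<Rightarrow> rat \<Rightarrow> qhat" where
  "chi_inv r y = (if y = 0 then Infty else Fin (r + 1 / y))"

definition para :: "rat \<Rightarrow> rat \<Rightarrow> qhat \<Rightarrow> qhat" where
  "para r t s = (if s = Fin r then Fin r else chi_inv r (chi r s + t))"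

lemma chi_inv_neq: "chi_inv r y \<noteq> Fin r"
  by (simp add: chi_inv_def)

lemma chi_chi_inv: "chi r (chi_inv r y) = y"
  by (simp add: chi_def chi_inv_def)

lemma chi_inv_chi: "s \<noteq> Fin r \<Longrightarrow> chi_inv r (chi r s) = s"
  by (cases s) (auto simp: chi_def chi_inv_def)

lemma chi_inject: "s \<noteq> Fin r \<Longrightarrow> s' \<noteq> Fin r \<Longrightarrow> chi r s = chi r s' \<Longrightarrow> s = s'"
  by (metis chi_inv_chi)

lemma para_neq: "s \<noteq> Fin r \<Longrightarrow> para r t s \<noteq> Fin r"
  by (simp add: para_def chi_inv_neq)

lemma chi_para: "s \<noteq> Fin r \<Longrightarrow> chi r (para r t s) = chi r s + t"
  by (simp add: para_def chi_chi_inv)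

lemma para_fixes: "para r t (Fin r) = Fin r"
  by (simp add: para_def)

lemma para_para: "para r t (para r t' s) = para r (t' + t) s"
  by (cases "s = Fin r") (simp_all add: para_def chi_inv_neq chi_chi_inv add.assoc)

lemma para_0: "para r 0 s = s"
  by (simp add: para_def chi_inv_chi)

lemma para_comp: "para r t \<circ> para r t' = para r (t' + t)"
  by (rule ext) (simp add: para_para)

lemma bij_para: "bij (para r t)"
  by (rule o_bij[of "para r (- t)"]) (auto simp: para_para para_0 fun_eq_iff)

lemma inv_para: "inv_into UNIV (para r t) = para r (- t)"
  by (rule Hilbert_Choice.inv_equality) (simp_all add: para_para para_0)

lemma idet_add_scaled: "idet u (add_scaled v k u) = idet u v"
  by (simp add: idet_def add_scaled_def algebra_simps)

lemma slope_eq_iff: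
  assumes "slope u = Fin r" "v \<noteq> (0, 0)"
  shows "slope v = Fin r \<longleftrightarrow> idet u v = 0"
proof -
  have u: "fst u \<noteq> 0" "r = of_int (snd u) / of_int (fst u)"
    using assms(1) by (auto simp: slope_def split: if_splits)
  show ?thesis
  proof (cases "fst v = 0")
    case True
    then have "snd v \<noteq> 0" using assms(2) by (auto simp: prod_eq_iff)
    then show ?thesis using True u by (simp add: slope_def idet_def)
  next
    case False
    have "slope v = Fin r \<longleftrightarrow> of_int (snd v) * of_int (fst u) = (of_int (snd u) * of_int (fst v) :: rat)"
      using False u by (simp add: slope_def frac_eq_eq)
    also have "\<dots> \<longleftrightarrow> snd v * fst u = snd u * fst v" by (simp flip: of_int_mult)
    finally show ?thesis by (simp add: idet_def mult.commute)
  qed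
qed

lemma primitive_neq: "primitive v \<Longrightarrow> v \<noteq> (0, 0)"
  by (auto simp: primitive_def)

lemma chi_slope:
  assumes "slope u = Fin r" "idet u v \<noteq> 0"
  shows "chi r (slope v) = of_int (fst u) * of_int (fst v) / of_int (idet u v)"
proof (cases "fst v = 0")
  case True
  then show ?thesis by (simp add: slope_def chi_def)
next
  case False
  have u: "fst u \<noteq> 0" "r = of_int (snd u) / of_int (fst u)"
    using assms(1) by (auto simp: slope_def split: if_splits)
  have "of_int (snd v) / of_int (fst v) - r = of_int (idet u v) / (of_int (fst u) * of_int (fst v))"
    using u False by (simp add: diff_frac_eq idet_def mult.commute)
  then show ?thesis using False by (simp add: slope_def chi_def)
qed

text \<open>By \<open>chi_slope\<close> the coordinate of \<open>slope v\<close> is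
  \<open>fst u * fst v / idet u v\<close>. The shear keeps the denominator and adds
  \<open>k * idet u v * fst u\<close> to \<open>fst v\<close>; this is the origin of the factor
  \<open>(fst u)\<^sup>2\<close>.\<close>

lemma slope_shear:
  assumes u: "slope u = Fin r" and v: "primitive v"
  shows "slope (add_scaled v (k * idet u v) u) = para r (of_int (k * (fst u)\<^sup>2)) (slope v)"
proof (cases "idet u v = 0")
  case True
  then have "slope v = Fin r" using slope_eq_iff[OF u primitive_neq[OF v]] by simp
  then show ?thesis using True by (simp add: para_fixes add_scaled_def)
next
  case False
  let ?v = "add_scaled v (k * idet u v) u"
  have p: "primitive ?v" using primitive_shear[OF v] .
  have d: "idet u ?v = idet u v" by (rule idet_add_scaled)
  have n: "slope v \<noteq> Fin r" "slope ?v \<noteq> Fin r"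
    using False d slope_eq_iff[OF u] primitive_neq[OF v] primitive_neq[OF p] by simp_all
  have "chi r (slope ?v) = chi r (slope v) + of_int (k * (fst u)\<^sup>2)"
    using False unfolding chi_slope[OF u False] chi_slope[OF u, of ?v, unfolded d, OF False]
    by (simp add: add_scaled_def field_simps power2_eq_square)
  then have "chi r (slope ?v) = chi r (para r (of_int (k * (fst u)\<^sup>2)) (slope v))"
    using chi_para[OF n(1)] by simp
  then show ?thesis using chi_inject n para_neq by blast
qed

section \<open>Reflections in Farey edges, acting on slopes\<close>

definition refl_at :: "int \<Rightarrow> qhat \<Rightarrow> qhat" where
  "refl_at k s = (case s of Fin x \<Rightarrow> Fin (2 * of_int k - x) | Infty \<Rightarrow> Infty)"

lemma refl_at_simps [simp]: "refl_at k (Fin x) = Fin (2 * of_int k - x)" "refl_at k Infty = Infty"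
  by (simp_all add: refl_at_def)

lemma hyp_reflection_Infty: "hyp_reflection Infty (Fin (of_int k)) = refl_at k"
proof
  fix s show "hyp_reflection Infty (Fin (of_int k)) s = refl_at k s" by (cases s) simp_all
qed

lemma refl_at_refl_at: "refl_at k (refl_at k s) = s"
  by (cases s) simp_all

lemma bij_refl_at: "bij (refl_at k)"
  by (rule o_bij[of "refl_at k"]) (auto simp: refl_at_refl_at fun_eq_iff)

lemma inv_refl_at: "inv_into UNIV (refl_at k) = refl_at k"
  by (rule Hilbert_Choice.inv_equality) (simp_all add: refl_at_refl_at)

lemma slope_reflect: "slope (fst v, 2 * k * fst v - snd v) = refl_at k (slope v)"
  by (simp add: slope_def diff_divide_distrib)

lemma slope_surj: obtains v where "primitive v" "slope v = s"
proof (cases s)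
  case (Fin x)
  obtain p q where q: "quotient_of x = (p, q)" by (cases "quotient_of x")
  have "coprime p q" "q > 0" "x = of_int p / of_int q"
    using quotient_of_coprime[OF q] quotient_of_denom_pos[OF q] quotient_of_div[OF q] by auto
  then show ?thesis using that[of "(q, p)"] Fin by (simp add: primitive_def slope_def coprime_commute)
next
  case Infty
  then show ?thesis using that[of "(0, 1)"] by (simp add: primitive_def slope_def)
qed

lemma hyp_reflection_commute: "hyp_reflection a b = hyp_reflection b a"
proof
  fix s show "hyp_reflection a b s = hyp_reflection b a s"
    by (cases a; cases b; cases s) (simp_all add: add.commute power2_commute power_divide)
qed

lemma hyp_reflection_fixes: "a \<noteq> b \<Longrightarrow> hyp_reflection a b a = a"
proof (cases a; cases b)
  fix x y assume *: "a \<noteq> b" "a = Fin x" "b = Fin y"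
  then have ne: "x - y \<noteq> 0" by simp
  have e: "x - (x + y) / 2 = (x - y) / 2" "((y - x) / 2)\<^sup>2 = ((x - y) / 2) * ((x - y) / 2)"
    by (simp_all add: field_simps power2_eq_square)
  have "x \<noteq> (x + y) / 2" using e(1) ne by auto
  moreover have "(x + y) / 2 + ((x - y) / 2) * ((x - y) / 2) / ((x - y) / 2) = x"
    using ne by (simp add: field_simps)
  ultimately show ?thesis unfolding * hyp_reflection.simps e by simp
qed auto

definition vplus :: "int \<times> int \<Rightarrow> int \<times> int \<Rightarrow> int \<times> int" where
  "vplus v w = (fst v + fst w, snd v + snd w)"

definition vneg :: "int \<times> int \<Rightarrow> int \<times> int" where
  "vneg v = (- fst v, - snd v)"

lemma slope_vneg: "slope (vneg v) = slope v"
  by (simp add: slope_def vneg_def)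

text \<open>In the basis \<open>v\<close>, \<open>w\<close> the reflection is the linear map that
  fixes \<open>v\<close> and negates \<open>w\<close>. The cases record which of the four slopes are
  infinite.\<close>

lemma hyp_reflection_slope:
  assumes "idet v w = 1"
  shows "hyp_reflection (slope v) (slope w) (slope (vplus v w)) = slope (vplus v (vneg w))"
proof -
  obtain A' B' C' D' where vw: "v = (A', B')" "w = (C', D')" by (cases v, cases w) blast
  define A B C D :: rat where "A = of_int A'" and "B = of_int B'" and "C = of_int C'" and "D = of_int D'"
  have d': "A' * D' - B' * C' = 1" using assms by (simp add: vw idet_def)
  have d: "A * D - B * C = 1" unfolding A_def B_def C_def D_def
    using arg_cong[OF d', of "of_int :: int \<Rightarrow> rat"] by simp
  have z: "A' = 0 \<longleftrightarrow> A = 0" "C' = 0 \<longleftrightarrow> C = 0" "A' + C' = 0 \<longleftrightarrow> A + C = 0" "A' = C' \<longleftrightarrow> A = C"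
    unfolding A_def C_def by (simp_all add: of_int_eq_0_iff flip: of_int_add)
  have s: "slope v = (if A = 0 then Infty else Fin (B / A))" "slope w = (if C = 0 then Infty else Fin (D / C))"
    "slope (vplus v w) = (if A + C = 0 then Infty else Fin ((B + D) / (A + C)))"
    "slope (vplus v (vneg w)) = (if A = C then Infty else Fin ((B - D) / (A - C)))"
    by (simp_all add: slope_def vw vplus_def vneg_def z) (simp_all add: A_def B_def C_def D_def)
  consider "A = 0" "C \<noteq> 0" | "A \<noteq> 0" "C = 0" | "A \<noteq> 0" "C \<noteq> 0" "A + C = 0" | "A \<noteq> 0" "C \<noteq> 0" "A + C \<noteq> 0" "A = C"
    | "A \<noteq> 0" "C \<noteq> 0" "A + C \<noteq> 0" "A \<noteq> C"
    using d by fastforce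
  then show ?thesis
  proof cases
    case 1 then show ?thesis by (simp add: s field_simps)
  next
    case 2 then show ?thesis by (simp add: s field_simps)
  next
    case 3
    then have C: "C = - A" by simp
    show ?thesis using 3(1) unfolding s C by (simp add: diff_divide_distrib)
  next
    case 4
    then show ?thesis by (simp add: s add_divide_distrib)
  next
    case 5
    \<comment> \<open>Inversion in the circle: \<open>m\<close> is its centre, \<open>x\<close> the
      offset of the given point from the centre, \<open>y\<close> the squared radius; the
      determinant 1 simplifies \<open>x\<close> and \<open>y\<close>.\<close>
    have m: "(B / A + D / C) / 2 = (B * C + A * D) / (2 * A * C)" using 5 by (simp add: field_simps)
    have "(B + D) * (2 * A * C) - (B * C + A * D) * (A + C) = (C - A) * (A * D - B * C)" by algebra
    then have x: "(B + D) / (A + C) - (B * C + A * D) / (2 * A * C) = (C - A) / ((A + C) * (2 * A * C))"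
      using 5 d by (simp add: diff_frac_eq)
    have "D / C - B / A = (A * D - B * C) / (A * C)" using 5 by (simp add: field_simps)
    then have y: "((D / C - B / A) / 2)\<^sup>2 = 1 / (2 * A * C)\<^sup>2" using d by (simp add: power_divide power_mult_distrib)
    have "(B * C + A * D) * (C - A) + (A + C) * (A * D - B * C) = (D - B) * (2 * A * C)" by algebra
    then have e: "(B * C + A * D) * (C - A) + (A + C) = (D - B) * (2 * A * C)" using d by simp
    have "(B * C + A * D) / (2 * A * C) + 1 / (2 * A * C)\<^sup>2 / ((C - A) / ((A + C) * (2 * A * C))) =
        ((B * C + A * D) * (C - A) + (A + C)) / ((2 * A * C) * (C - A))"
      using 5 by (simp add: divide_simps power2_eq_square) (simp add: algebra_simps)
    also have "\<dots> = (D - B) / (C - A)" unfolding e using 5 by simp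
    also have "\<dots> = (B - D) / (A - C)" by (metis minus_diff_eq minus_divide_divide)
    finally have f: "(B * C + A * D) / (2 * A * C) + 1 / (2 * A * C)\<^sup>2 / ((C - A) / ((A + C) * (2 * A * C))) = (B - D) / (A - C)" .
    have "(B + D) / (A + C) \<noteq> (B * C + A * D) / (2 * A * C)" using x 5 by auto
    then show ?thesis using 5 by (simp add: s m) (simp only: x y f[unfolded mult.assoc] f)
  qed
qed

section \<open>Farey triangles and edges through pairs of determinant 1\<close>

definition det_triangle :: "qhat set \<Rightarrow> bool" where
  "det_triangle T \<longleftrightarrow> (\<exists>v w. idet v w = 1 \<and> T = {slope v, slope w, slope (vplus v w)})"

lemma vplus_neg: "vplus (vplus v w) (vneg v) = w" "vplus (vneg w) (vplus v w) = v" "vplus w v = vplus v w"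
  by (simp_all add: vplus_def vneg_def)

lemma idet_vplus: "idet (vplus v w) (vneg v) = idet v w" "idet (vneg w) (vplus v w) = idet v w"
   "idet (vneg w) v = idet v w" "idet w (vneg v) = idet v w" "idet v v = 0"
  by (simp_all add: vplus_def vneg_def idet_def algebra_simps)

text \<open>The pairs \<open>v, w\<close> and \<open>v + w, - v\<close> and
  \<open>- w, v + w\<close> describe the same triangle, and each edge joins the slopes of one of
  them. So any edge may be taken as the mirror in \<open>hyp_reflection_slope\<close>.\<close>

lemma det_triangle_pair:
  assumes "det_triangle T" "a \<in> T" "b \<in> T" "a \<noteq> b"
  shows "\<exists>v w. idet v w = 1 \<and> T = {slope v, slope w, slope (vplus v w)} \<and> 
    (a = slope v \<and> b = slope w \<or> a = slope w \<and> b = slope v)"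
proof -
  obtain v w where vw: "idet v w = 1" "T = {slope v, slope w, slope (vplus v w)}"
    using assms(1) by (auto simp: det_triangle_def)
  have 1: "idet (vplus v w) (vneg v) = 1" "T = {slope (vplus v w), slope (vneg v), slope (vplus (vplus v w) (vneg v))}"
    and 2: "idet (vneg w) (vplus v w) = 1" "T = {slope (vneg w), slope (vplus v w), slope (vplus (vneg w) (vplus v w))}"
    unfolding idet_vplus(1,2) vplus_neg(1,2) slope_vneg using vw by auto
  consider "a = slope v \<and> b = slope w \<or> a = slope w \<and> b = slope v" 
    | "a = slope (vplus v w) \<and> b = slope v \<or> a = slope v \<and> b = slope (vplus v w)"
    | "a = slope w \<and> b = slope (vplus v w) \<or> a = slope (vplus v w) \<and> b = slope w"
    using assms(2-4) vw(2) by auto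
  then show ?thesis
  proof cases
    case 1 then show ?thesis using vw by blast
  next
    case 2 then show ?thesis using 1 by (intro exI[of _ "vplus v w"] exI[of _ "vneg v"]) (simp add: slope_vneg)
  next
    case 3 then show ?thesis using 2 by (intro exI[of _ "vneg w"] exI[of _ "vplus v w"]) (simp add: slope_vneg)
  qed
qed

lemma farey_triangle_det: "farey_triangle T \<Longrightarrow> det_triangle T"
proof (induction rule: farey_triangle.induct)
  case base
  show ?case unfolding det_triangle_def
    by (rule exI[of _ "(1, 0)"], rule exI[of _ "(0, 1)"]) (auto simp: idet_def slope_def vplus_def)
next
  case (reflect T a b)
  obtain v w where vw: "idet v w = 1" "T = {slope v, slope w, slope (vplus v w)}" 
     "a = slope v \<and> b = slope w \<or> a = slope w \<and> b = slope v"
    using det_triangle_pair[OF reflect.IH reflect.hyps(2-4)] by blast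
  have r: "hyp_reflection a b = hyp_reflection (slope v) (slope w)" using vw(3) hyp_reflection_commute by auto
  have ne: "slope v \<noteq> slope w" using vw(3) reflect.hyps(4) by auto
  have "hyp_reflection a b ` T = {slope v, slope w, slope (vplus v (vneg w))}"
    unfolding r vw(2) using hyp_reflection_fixes[OF ne] hyp_reflection_fixes[OF ne[symmetric]]
      hyp_reflection_commute[of "slope v" "slope w"] hyp_reflection_slope[OF vw(1)] by simp
  also have "\<dots> = {slope (vneg w), slope v, slope (vplus (vneg w) v)}"
    unfolding slope_vneg vplus_neg(3)[of v "vneg w"] by auto
  finally show ?case unfolding det_triangle_def using vw(1) idet_vplus(3) by metis
qed

lemma farey_edge_det:
  assumes "farey_edge a b" obtains v w where "a = slope v" "b = slope w" "idet v w = 1"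
proof -
  obtain T where T: "farey_triangle T" "a \<in> T" "b \<in> T" "a \<noteq> b" using assms by (auto simp: farey_edge_def)
  obtain v w where vw: "idet v w = 1" "a = slope v \<and> b = slope w \<or> a = slope w \<and> b = slope v"
    using det_triangle_pair[OF farey_triangle_det[OF T(1)] T(2-4)] by blast
  then show ?thesis using that[of v w] that[of w "vneg v"] by (auto simp: slope_vneg idet_vplus)
qed

text \<open>Determinant 1 with a vertical vector forces the denominator 1 or -1. Conversely, the
  triangles with vertex infinity arise from the base triangle by successive reflections in vertical
  edges.\<close>

lemma farey_edge_Infty: "farey_edge Infty a \<longleftrightarrow> (\<exists>k::int. a = Fin (of_int k))"
proof
  assume "farey_edge Infty a"
  then obtain v w where vw: "Infty = slope v" "a = slope w" "idet v w = 1" by (rule farey_edge_det)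
  have v: "fst v = 0" using vw(1) by (auto simp: slope_def split: if_splits)
  then have "- snd v * fst w = 1" using vw(3) by (simp add: idet_def)
  then have "fst w = 1 \<or> fst w = -1" by (metis mult.commute mult_minus_right zmult_eq_1_iff minus_equation_iff)
  then show "\<exists>k::int. a = Fin (of_int k)"
  proof
    assume "fst w = 1" then show ?thesis using vw(2) by (auto simp: slope_def)
  next
    assume "fst w = -1" then show ?thesis using vw(2) by (intro exI[of _ "- snd w"]) (simp add: slope_def)
  qed
next
  assume "\<exists>k::int. a = Fin (of_int k)"
  then obtain k :: int where k: "a = Fin (of_int k)" by blast
  have "farey_triangle {Fin (of_int k), Fin (of_int (k + 1)), Infty}"
  proof (induction k rule: int_induct[where k = 0])
    case base then show ?case using farey_triangle.base by simp
  next
    case (step1 i)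
    have "farey_triangle (hyp_reflection Infty (Fin (of_int (i + 1))) ` {Fin (of_int i), Fin (of_int (i + 1)), Infty})"
      by (rule farey_triangle.reflect[OF step1(2)]) simp_all
    then show ?case unfolding hyp_reflection_Infty by (simp add: insert_commute add.commute)
  next
    case (step2 i)
    have "farey_triangle (hyp_reflection Infty (Fin (of_int i)) ` {Fin (of_int i), Fin (of_int (i + 1)), Infty})"
      by (rule farey_triangle.reflect[OF step2(2)]) simp_all
    then show ?case unfolding hyp_reflection_Infty by (simp add: insert_commute add.commute)
  qed
  then show "farey_edge Infty a" unfolding farey_edge_def k by blast
qed

section \<open>The groups acting on the tessellation\<close>

text \<open>The fixed points are the roots of a quadratic equation. If \<open>r\<close> is its only
  root, then \<open>a - d = 2 * c * r\<close>, and in the coordinate \<open>chi r\<close> the map is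
  the translation by \<open>c / (c * r + d)\<close>.\<close>

lemma farey_parabolic_para:
  assumes "farey_parabolic (Fin r) f" obtains t where "f = para r t"
proof -
  obtain a b c d where det: "a * d - b * c > 0" and f: "f = moebius a b c d" and fx: "{s. f s = s} = {Fin r}"
    using assms unfolding farey_parabolic_def by blast
  have "f Infty \<noteq> Infty" using fx by auto
  then have c: "c \<noteq> 0" by (auto simp: f)
  have "f (Fin r) = Fin r" using fx by auto
  then have r: "c * r + d \<noteq> 0" "(a * r + b) / (c * r + d) = r" by (auto simp: f split: if_splits)
  then have b: "a * r + b = r * (c * r + d)" by (simp add: divide_eq_eq)
  \<comment> \<open>The second root of the fixed point equation, by Vieta.\<close>
  define r' where "r' = (a - d) / c - r"
  have cr': "c * r' = a - d - c * r" using c by (simp add: r'_def field_simps)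
  have "r' * (c * r' + d) = r' * (a - c * r)" unfolding cr' by simp
  also have "\<dots> = a * r' - r * (c * r')" by (simp add: algebra_simps)
  also have "\<dots> = a * r' + b" unfolding cr' using b by (simp add: algebra_simps)
  finally have q: "r' * (c * r' + d) = a * r' + b" .
  \<comment> \<open>At the pole the numerator would vanish too, against the positive
    determinant.\<close>
  have "c * r' + d \<noteq> 0"
  proof
    assume 0: "c * r' + d = 0"
    then have "a * r' + b = 0" using q by simp
    then have "d = - (c * r')" "b = - (a * r')" using 0 by linarith+
    then have "a * d - b * c = 0" by simp
    then show False using det by simp
  qed
  then have "f (Fin r') = Fin r'" using q by (simp add: f nonzero_eq_divide_eq flip: q)
  then have "r' = r" using fx by auto
  then have a: "a = d + 2 * (c * r)" using cr' by simp
  define D where "D = c * r + d"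
  have D: "D \<noteq> 0" using r by (simp add: D_def)
  have "f s = para r (c / D) s" for s
  proof (cases s)
    case Infty
    have "a / c = r + D / c" using c by (simp add: a D_def field_simps)
    then show ?thesis using Infty c D by (simp add: f para_def chi_def chi_inv_def)
  next
    case (Fin x)
    show ?thesis
    proof (cases "x = r")
      case True
      then show ?thesis using Fin \<open>f (Fin r) = Fin r\<close> by (simp add: para_fixes)
    next
      case False
      have e: "c * x + d = c * (x - r) + D" by (simp add: D_def algebra_simps)
      have y: "1 / (x - r) + c / D = (c * x + d) / ((x - r) * D)" unfolding e using False D by (simp add: field_simps)
      have z: "(c * x + d) / ((x - r) * D) = 0 \<longleftrightarrow> c * x + d = 0" using False D by simp
      have n: "a * x + b = r * (c * x + d) + (x - r) * D"
        using b unfolding a D_def by (simp add: algebra_simps)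
      show ?thesis
      proof (cases "c * x + d = 0")
        case True
        then show ?thesis using False by (simp add: Fin f para_def chi_def chi_inv_def y)
      next
        case nz: False
        have "(a * x + b) / (c * x + d) = r + (x - r) * D / (c * x + d)"
          unfolding n using nz by (simp add: add_divide_distrib)
        then show ?thesis using False nz z by (simp add: Fin f para_def chi_def chi_inv_def y)
      qed
    qed
  qed
  then show ?thesis using that[of "c / D"] by blast
qed

lemma slope_eq_primitive:
  assumes v: "primitive v" "primitive v'" and "slope v = slope v'"
  shows "v' = v \<or> v' = vneg v"
proof -
  have "idet v v' = 0"
  proof (cases "fst v = 0")
    case True
    then have "fst v' = 0" using assms(3) by (simp add: slope_def split: if_splits)
    then show ?thesis using True by (simp add: idet_def)
  next
    case False
    then have "slope v = Fin (of_int (snd v) / of_int (fst v))" by (simp add: slope_def)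
    then show ?thesis using slope_eq_iff[of v _ v'] primitive_neq[OF v(2)] assms(3) by auto
  qed
  then obtain k where k: "v' = scale k v" using primitive_parallel[OF v(1)] by blast
  have "k dvd 1"
    using v(2) coprime_common_divisor[of "k * fst v" "k * snd v" k] unfolding k scale_def primitive_def by simp
  then have "k = 1 \<or> k = -1" by auto
  then show ?thesis using k by (auto simp: scale_def vneg_def)
qed

lemma idet_vneg: "idet (vneg v) w = - idet v w" "idet v (vneg w) = - idet v w"
  by (simp_all add: idet_def vneg_def)

lemma farey_edge_idet:
  assumes "farey_edge (slope v) (slope w)" "primitive v" "primitive w"
  shows "\<bar>idet v w\<bar> = 1"
proof -
  obtain v' w' where vw: "slope v = slope v'" "slope w = slope w'" "idet v' w' = 1"
    using farey_edge_det[OF assms(1)] by metis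
  have "v' = v \<or> v' = vneg v" "w' = w \<or> w' = vneg w"
    using slope_eq_primitive vw idet_1_primitive idet_1_primitive' assms by blast+
  then show ?thesis using vw(3) by (auto simp: idet_vneg)
qed

lemma farey_neighbour:
  assumes u: "primitive u" and "farey_edge (slope u) a"
  obtains v where "a = slope v" "idet u v = 1"
proof -
  obtain v where v: "primitive v" "slope v = a" by (rule slope_surj)
  have "\<bar>idet u v\<bar> = 1" using farey_edge_idet[of u v] assms v by simp
  then consider "idet u v = 1" | "idet u (vneg v) = 1" by (auto simp: idet_vneg abs_if split: if_splits)
  then show ?thesis using that v(2) slope_vneg by metis
qed

text \<open>Normalised by \<open>idet u v = 1\<close>, the vectors of two neighbours of
  \<open>r\<close> differ by a multiple of \<open>u\<close>, which is \<open>u\<close> or its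
  negative for consecutive edges because these bound a triangle. The sign, constant along the fan,
  is the sense of the enumeration.\<close>

lemma farey_fan_shift:
  assumes u: "primitive u" "slope u = Fin r" and e: "farey_fan (Fin r) e"
  shows "\<exists>\<epsilon>::int. (\<epsilon> = 1 \<or> \<epsilon> = -1) \<and> (\<forall>m. e m = para r (of_int (\<epsilon> * m * (fst u)\<^sup>2)) (e 0)) \<and> e 0 \<noteq> Fin r"
proof -
  have bij: "bij_betw e UNIV {a. farey_edge (Fin r) a}" and tri: "\<And>i. farey_triangle {Fin r, e i, e (i + 1)}"
    using e by (auto simp: farey_fan_def)
  have inj: "e i = e j \<longleftrightarrow> i = j" for i j using bij by (auto simp: bij_betw_def inj_on_def)
  have "\<exists>v. e i = slope v \<and> idet u v = 1" for i
  proof -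
    have "farey_edge (slope u) (e i)" using bij u(2) by (auto simp: bij_betw_def)
    then show ?thesis using farey_neighbour[OF u(1)] by metis
  qed
  then obtain v where v: "\<And>i. e i = slope (v i)" "\<And>i. idet u (v i) = 1" by metis
  have p: "primitive (v i)" for i using idet_1_primitive'[OF v(2)] .
  have "\<exists>k. v (i + 1) = add_scaled (v i) k u \<and> \<bar>k\<bar> = 1" for i
  proof -
    let ?x = "(fst (v (i + 1)) - fst (v i), snd (v (i + 1)) - snd (v i))"
    have "idet u ?x = 0" using v(2)[of i] v(2)[of "i + 1"] by (simp add: idet_def algebra_simps)
    then obtain k where k: "?x = scale k u" using primitive_parallel[OF u(1)] by blast
    then have s: "v (i + 1) = add_scaled (v i) k u" by (simp add: scale_def add_scaled_def prod_eq_iff)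
    have "e i \<noteq> e (i + 1)" using inj by simp
    then have "farey_edge (e i) (e (i + 1))" using tri[of i] by (auto simp: farey_edge_def)
    then have "\<bar>idet (v i) (v (i + 1))\<bar> = 1" using farey_edge_idet[OF _ p p] by (simp add: v(1))
    moreover have "idet (v i) (v (i + 1)) = - k * idet u (v i)"
      unfolding s by (simp add: idet_def add_scaled_def algebra_simps)
    ultimately show ?thesis using s v(2) by auto
  qed
  then obtain k where k: "\<And>i. v (i + 1) = add_scaled (v i) (k i) u" "\<And>i. \<bar>k i\<bar> = 1" by metis
  \<comment> \<open>A change of sign would lead back to the edge before, although the enumeration is
    injective.\<close>
  have k1: "k (i + 1) = k i" for i
  proof (rule ccontr)
    assume ne: "k (i + 1) \<noteq> k i"
    then have "k (i + 1) = - k i" using k(2)[of i] k(2)[of "i + 1"] by (auto simp: abs_if split: if_splits)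
    then have "v (i + 1 + 1) = v i" using k(1)[of "i + 1"] k(1)[of i] by (simp add: add_scaled_def)
    then have "e (i + 1 + 1) = e i" by (simp add: v(1))
    then show False using inj[of "i + 1 + 1" i] by simp
  qed
  have kc: "k i = k 0" for i
    by (induction i rule: int_induct[where k = 0]) (use k1 in \<open>auto, metis diff_add_cancel\<close>)
  have vm: "v m = add_scaled (v 0) (m * k 0) u" for m
  proof (induction m rule: int_induct[where k = 0])
    case base then show ?case by (simp add: add_scaled_def)
  next
    case (step1 i) then show ?case using k(1)[of i] kc[of i] by (simp add: add_scaled_def algebra_simps)
  next
    case (step2 i) then show ?case using k(1)[of "i - 1"] kc[of "i - 1"] by (auto simp: add_scaled_def algebra_simps prod_eq_iff)
  qed
  have "e m = para r (of_int (k 0 * m * (fst u)\<^sup>2)) (e 0)" for m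
    using slope_shear[OF u(2) p[of 0], of "m * k 0"] vm[of m] v(2)[of 0] by (simp add: v(1) mult.commute)
  moreover have "e 0 \<noteq> Fin r" using slope_eq_iff[OF u(2) primitive_neq[OF p[of 0]]] v by simp
  moreover have "k 0 = 1 \<or> k 0 = -1" using k(2)[of 0] by (auto simp: abs_if split: if_splits)
  ultimately show ?thesis by blast
qed

definition C_gens :: "qhat \<Rightarrow> int \<Rightarrow> (qhat \<Rightarrow> qhat) set" where
  "C_gens r m = {f. farey_parabolic r f \<and> (\<exists>e. farey_fan r e \<and> (\<forall>i. f (e i) = e (i + m)))}"

lemma C_group_eq: "C_group r m = generate (BijGroup UNIV) (C_gens r m)"
  by (simp add: C_group_def C_gens_def)

lemma C_gens_para:
  assumes u: "primitive u" "slope u = Fin r" and f: "f \<in> C_gens (Fin r) m"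
  shows "f = para r (of_int (m * (fst u)\<^sup>2)) \<or> f = para r (- of_int (m * (fst u)\<^sup>2))"
proof -
  obtain e where e: "farey_parabolic (Fin r) f" "farey_fan (Fin r) e" "\<And>i. f (e i) = e (i + m)"
    using f by (auto simp: C_gens_def)
  obtain t where t: "f = para r t" using farey_parabolic_para[OF e(1)] .
  obtain \<epsilon> :: int where \<epsilon>: "\<epsilon> = 1 \<or> \<epsilon> = -1" "\<And>m. e m = para r (of_int (\<epsilon> * m * (fst u)\<^sup>2)) (e 0)" "e 0 \<noteq> Fin r"
    using farey_fan_shift[OF u e(2)] by blast
  have "para r t (e 0) = para r (of_int (\<epsilon> * m * (fst u)\<^sup>2)) (e 0)" using e(3)[of 0] \<epsilon>(2)[of m] t by simp
  then have "t = of_int (\<epsilon> * m * (fst u)\<^sup>2)" using chi_para[OF \<epsilon>(3)] by (metis add_left_cancel)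
  then show ?thesis using \<epsilon>(1) t by auto
qed

lemma generate_para_multiple:
  assumes f: "f \<in> generate (BijGroup UNIV) S" and S: "\<And>g. g \<in> S \<Longrightarrow> \<exists>l::int. g = para r (of_int l * M)"
  shows "\<exists>l::int. f = para r (of_int l * M)"
proof -
  have "bij f \<and> (\<exists>l::int. f = para r (of_int l * M))"
    using f
  proof (rule generate_BijGroup_induct)
    show "\<exists>l::int. id = para r (of_int l * M)" by (rule exI[of _ 0]) (auto simp: para_0 fun_eq_iff)
    fix g assume "g \<in> S"
    then obtain l where l: "g = para r (of_int l * M)" using S by blast
    then show "bij g" "\<exists>l::int. g = para r (of_int l * M)" using bij_para by blast+
    show "\<exists>l::int. inv_into UNIV g = para r (of_int l * M)"
      unfolding l inv_para by (rule exI[of _ "- l"]) simp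
  next
    fix g h assume "\<exists>l::int. g = para r (of_int l * M)" "\<exists>l::int. h = para r (of_int l * M)"
    then obtain k l :: int where "g = para r (of_int k * M)" "h = para r (of_int l * M)" by blast
    then show "\<exists>l::int. g \<circ> h = para r (of_int l * M)"
      unfolding para_comp by (intro exI[of _ "l + k"]) (simp add: distrib_right para_comp)
  qed
  then show ?thesis by blast
qed

lemma para_inject: "para r t = para r t' \<Longrightarrow> t = t'"
proof -
  have "chi r (para r t Infty) = t" for t by (simp add: chi_para) (simp add: chi_def)
  then show "para r t = para r t' \<Longrightarrow> t = t'" by metis
qed

text \<open>The map \<open>f\<close> is a translation by a multiple of \<open>M\<close> and
  generates a group containing the translation by \<open>M\<close>, so the multiple is 1 or -1; the
  coordinates of \<open>r1\<close> and \<open>r2\<close>, negative and positive, decide the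
  sign.\<close>

lemma admissible_shift:
  assumes u: "primitive u" "slope u = Fin r" and m: "\<lfloor>2 * n\<rfloor> > 0" and adm: "admissible_neighbours r n r1 r2"
  defines "M \<equiv> of_int (\<lfloor>2 * n\<rfloor> * (fst u)\<^sup>2)"
  shows "M > 0" "chi r (Fin r2) = chi r (Fin r1) + M" "para r M \<in> C_group (Fin r) \<lfloor>2 * n\<rfloor>"
    "para r (- M) \<in> C_group (Fin r) \<lfloor>2 * n\<rfloor>"
proof -
  let ?m = "\<lfloor>2 * n\<rfloor>"
  obtain f where f: "f \<in> C_group (Fin r) ?m" "generate (BijGroup UNIV) {f} = C_group (Fin r) ?m" "f (Fin r1) = Fin r2"
    and r: "r1 < r" "r < r2"
    using adm unfolding admissible_neighbours_def by blast
  have "fst u \<noteq> 0" using u(2) by (auto simp: slope_def split: if_splits)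
  then have "?m * (fst u)\<^sup>2 > 0" using m by (intro mult_pos_pos) auto
  then show M: "M > 0" unfolding M_def by (simp only: of_int_0_less_iff)
  have gens: "\<exists>l::int. g = para r (of_int l * M)" if "g \<in> C_gens (Fin r) ?m" for g
    using C_gens_para[OF u that] unfolding M_def[symmetric]
  proof
    assume "g = para r M" then show ?thesis by (intro exI[of _ 1]) simp
  next
    assume "g = para r (- M)" then show ?thesis by (intro exI[of _ "-1"]) simp
  qed
  obtain l :: int where l: "f = para r (of_int l * M)"
    using generate_para_multiple[OF _ gens, of f] f(1) unfolding C_group_eq by blast
  have bij: "\<And>g. g \<in> C_gens (Fin r) ?m \<Longrightarrow> bij g" using gens bij_para by metis
  \<comment> \<open>A trivial group could not move \<open>r1\<close> to \<open>r2\<close>, so a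
    parabolic shift exists.\<close>
  have "C_gens (Fin r) ?m \<noteq> {}"
  proof
    assume "C_gens (Fin r) ?m = {}"
    then have "f \<in> generate (BijGroup UNIV) {}" using f(1) unfolding C_group_eq by simp
    then have "bij f \<and> f = id" by (rule generate_BijGroup_induct) (simp_all add: inv_id)
    then show False using f(3) r by simp
  qed
  then obtain g where g: "g \<in> C_gens (Fin r) ?m" by blast
  then have gC: "g \<in> C_group (Fin r) ?m" unfolding C_group_eq by (rule generate.incl)
  have giC: "inv_into UNIV g \<in> C_group (Fin r) ?m"
    using generate_BijGroup_inv[OF gC[unfolded C_group_eq] bij] unfolding C_group_eq .
  from C_gens_para[OF u g] show pC: "para r M \<in> C_group (Fin r) ?m" and "para r (- M) \<in> C_group (Fin r) ?m"
    unfolding M_def[symmetric] using gC giC inv_para[of r M] inv_para[of r "- M"] by auto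
  have "\<exists>j::int. para r M = para r (of_int j * (of_int l * M))"
    by (rule generate_para_multiple[of _ "{f}"]) (use pC f(2) l in \<open>auto intro!: exI[of _ 1]\<close>)
  then obtain j :: int where "M = of_int j * (of_int l * M)" using para_inject by blast
  then have "(of_int (j * l) :: rat) = 1" using M by simp
  then have "j * l = 1" by (simp only: of_int_eq_1_iff)
  then have "l = 1 \<or> l = -1" using zmult_eq_1_iff[of j l] by blast
  moreover have c: "chi r (Fin r2) = chi r (Fin r1) + of_int l * M"
    using chi_para[of "Fin r1" r "of_int l * M"] f(3) r unfolding l by simp
  moreover have "chi r (Fin r1) < 0" "chi r (Fin r2) > 0" using r by (simp_all add: chi_def)
  ultimately show "chi r (Fin r2) = chi r (Fin r1) + M" using M by auto
qed

section \<open>Generators and orbits of the group Gamma\<close>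

lemma Gamma_inf_eq: "Gamma_inf = generate (BijGroup UNIV) (range refl_at)"
proof -
  have "{hyp_reflection Infty a | a. farey_edge Infty a} = range refl_at"
    unfolding farey_edge_Infty by (auto simp: hyp_reflection_Infty image_iff) (metis hyp_reflection_Infty)+
  then show ?thesis by (simp add: Gamma_inf_def)
qed

lemma bij_Gamma_inf: "g \<in> Gamma_inf \<Longrightarrow> bij g"
  unfolding Gamma_inf_eq by (erule generate_BijGroup_bij) (auto simp: bij_refl_at)

lemma bij_C_group: 
  assumes "primitive u" "slope u = Fin r" "g \<in> C_group (Fin r) m" shows "bij g"
  using assms(3) unfolding C_group_eq
  by (rule generate_BijGroup_bij) (use C_gens_para[OF assms(1,2)] bij_para in metis)

text \<open>An equivalence relation that contains the moves of the generators contains every orbit.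
  It is used for joinability, which gives uniqueness, and for equality of cosets, which gives the
  homotopy.\<close>

lemma Gamma_group_equiv:
  assumes u: "primitive u" "slope u = Fin r"
    and refl: "\<And>s. Q s s" and sym: "\<And>s t. Q s t \<Longrightarrow> Q t s" and trans: "\<And>s t v. Q s t \<Longrightarrow> Q t v \<Longrightarrow> Q s v"
    and Qrefl: "\<And>k s. Q s (refl_at k s)" and Qpara: "\<And>s. Q s (para r (of_int (\<lfloor>2 * n\<rfloor> * (fst u)\<^sup>2)) s)"
    and f: "f \<in> Gamma_group r n"
  shows "Q s (f s)"
proof -
  let ?M = "of_int (\<lfloor>2 * n\<rfloor> * (fst u)\<^sup>2) :: rat"
  let ?P = "\<lambda>g. \<forall>s. Q s (g s)"
  have Pcomp: "?P (g \<circ> h)" if "?P g" "?P h" for g h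
    using trans that by (metis comp_apply)
  have Pinv: "?P (inv_into UNIV g)" if "?P g" "bij g" for g
    using sym that by (metis bij_inv_eq_iff)
  have Pneg: "?P (para r (- ?M))"
  proof
    fix s have "Q (para r (- ?M) s) (para r ?M (para r (- ?M) s))" by (rule Qpara)
    then show "Q s (para r (- ?M) s)" using sym by (simp add: para_para para_0)
  qed
  have inf: "bij g \<and> ?P g" if "g \<in> Gamma_inf" for g
    using that unfolding Gamma_inf_eq
    by (rule generate_BijGroup_induct) (use refl Qrefl bij_refl_at Pcomp inv_refl_at in \<open>auto simp: o_def\<close>)
  have gens: "bij g \<and> ?P g" if "g \<in> C_gens (Fin r) \<lfloor>2 * n\<rfloor>" for g
    using C_gens_para[OF u that] Qpara Pneg bij_para by metis
  have C: "bij g \<and> ?P g" if "g \<in> C_group (Fin r) \<lfloor>2 * n\<rfloor>" for g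
    using that unfolding C_group_eq
  proof (rule generate_BijGroup_induct)
    show "?P id" using refl by simp
  qed (use gens Pinv Pcomp in blast)+
  have "bij f \<and> ?P f"
    using f unfolding Gamma_group_def
  proof (rule generate_BijGroup_induct)
    show "?P id" using refl by simp
  qed (use inf C Pinv Pcomp in blast)+
  then show ?thesis by blast
qed

section \<open>The fundamental domain\<close>

lemma para_in_Gamma:
  assumes C: "para r M \<in> C_group (Fin r) \<lfloor>2 * n\<rfloor>" "para r (- M) \<in> C_group (Fin r) \<lfloor>2 * n\<rfloor>"
    and bij: "\<And>g. g \<in> Gamma_inf \<union> C_group (Fin r) \<lfloor>2 * n\<rfloor> \<Longrightarrow> bij g"
  shows "para r (of_int j * M) \<in> Gamma_group r n"
proof (induction j rule: int_induct[where k = 0])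
  case base
  have "para r (of_int 0 * M) = id" by (rule ext) (simp add: para_0)
  then show ?case using generate.one[of "BijGroup UNIV"] unfolding Gamma_group_def one_BijGroup_UNIV by metis
next
  case (step1 i)
  have "para r M \<circ> para r (of_int i * M) \<in> Gamma_group r n"
    using generate_BijGroup_comp[OF generate.incl step1(2)[unfolded Gamma_group_def] bij] C(1) unfolding Gamma_group_def by blast
  moreover have "of_int i * M + M = of_int (i + 1) * M" by (simp add: algebra_simps)
  ultimately show ?case by (simp only: para_comp)
next
  case (step2 i)
  have "para r (- M) \<circ> para r (of_int i * M) \<in> Gamma_group r n"
    using generate_BijGroup_comp[OF generate.incl step2(2)[unfolded Gamma_group_def] bij] C(2) unfolding Gamma_group_def by blast
  moreover have "of_int i * M + - M = of_int (i - 1) * M" by (simp add: algebra_simps)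
  ultimately show ?case by (simp only: para_comp)
qed

lemma refl_at_in_Gamma: "refl_at k \<in> Gamma_group r n"
  unfolding Gamma_group_def Gamma_inf_eq by (intro generate.incl UnI1) blast

lemma Gamma_orbit_step:
  assumes bij: "\<And>g. g \<in> Gamma_inf \<union> C_group (Fin r) \<lfloor>2 * n\<rfloor> \<Longrightarrow> bij g"
    and g: "g \<in> Gamma_group r n" and s: "g s \<in> Gamma_orbit r n s0"
  shows "s \<in> Gamma_orbit r n s0"
proof -
  obtain h where h: "h \<in> Gamma_group r n" "g s = h s0" using s by (auto simp: Gamma_orbit_def)
  note g' = g[unfolded Gamma_group_def] and h' = h(1)[unfolded Gamma_group_def]
  have "inv_into UNIV g \<circ> h \<in> Gamma_group r n"
    unfolding Gamma_group_def by (rule generate_BijGroup_comp[OF generate_BijGroup_inv[OF g' bij] h' bij])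
  moreover have "s = (inv_into UNIV g \<circ> h) s0"
    using h(2) generate_BijGroup_bij[OF g' bij] by (metis bij_inv_eq_iff comp_apply)
  ultimately show ?thesis unfolding Gamma_orbit_def by blast
qed

section \<open>The moves towards the fundamental domain as a rewriting system\<close>

locale fundamental_domain =
  fixes r r1 r2 ri M :: rat and k :: int
  assumes order: "of_int k \<le> r1" "r1 < r" "r < r2" "r2 \<le> of_int k + 1"
    and M: "M > 0" "chi r (Fin r2) = chi r (Fin r1) + M" and ri: "ri \<in> {r1, r2}"
begin

text \<open>In the coordinate \<open>chi r\<close> the complement of \<open>[r1, r2]\<close> is the
  open interval from \<open>chi r (Fin r1)\<close> to \<open>chi r (Fin r2)\<close>, of length
  \<open>M\<close>. Exactly one end is added to get a fundamental interval of the translation by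
  \<open>M\<close>: the removed point \<open>ri\<close> counts as too low if it is
  \<open>r1\<close>, as too high if it is \<open>r2\<close>.\<close>

definition low :: "qhat \<Rightarrow> bool" where
  "low s \<longleftrightarrow> s \<noteq> Fin r \<and> (if ri = r1 then chi r s \<le> chi r (Fin r1) else chi r s < chi r (Fin r1))"

definition high :: "qhat \<Rightarrow> bool" where
  "high s \<longleftrightarrow> s \<noteq> Fin r \<and> (if ri = r1 then chi r s > chi r (Fin r2) else chi r s \<ge> chi r (Fin r2))"

text \<open>The move that brings a point closer to the domain: by the parabolic group if it lies in
  the part of \<open>[r1, r2]\<close> outside the domain, by a reflection if it lies outside \<open>[k, k + 1]\<close>. The two cases
  exclude each other, so that every orbit has at most one point fixed by \<open>step\<close>.\<close>

definition step :: "qhat \<Rightarrow> qhat" where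
  "step s = (if low s then para r M s else if high s then para r (- M) s else 
     (case s of Infty \<Rightarrow> Infty | Fin x \<Rightarrow> 
        if x < of_int k then refl_at k s else if x > of_int k + 1 then refl_at (k + 1) s else s))"

definition joinable :: "qhat \<Rightarrow> qhat \<Rightarrow> bool" where
  "joinable s t \<longleftrightarrow> (\<exists>i j. (step ^^ i) s = (step ^^ j) t)"

text \<open>The two thresholds differ by \<open>M\<close> and are strict on complementary sides, so
  every point is either moved up by \<open>M\<close> itself or is reached when its translate is
  moved down.\<close>

lemma high_para_iff: "s \<noteq> Fin r \<Longrightarrow> high (para r M s) \<longleftrightarrow> \<not> low s"
  using M para_neq[of s r M] by (simp add: low_def high_def chi_para not_le not_less)

lemma low_not_high: "low s \<Longrightarrow> \<not> high s"
  using M by (auto simp: low_def high_def split: if_splits)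

lemma chi_pos: "x < r \<Longrightarrow> chi r (Fin x) < 0" "x > r \<Longrightarrow> chi r (Fin x) > 0"
  by (simp_all add: chi_def)

text \<open>On either side of the pole \<open>r\<close> the coordinate is strictly decreasing,
  whence the reversed inequalities.\<close>

lemma chi_mono:
  assumes "x < r \<and> y < r \<or> x > r \<and> y > r"
  shows "chi r (Fin x) \<le> chi r (Fin y) \<longleftrightarrow> y \<le> x" "chi r (Fin x) < chi r (Fin y) \<longleftrightarrow> y < x"
proof -
  have "chi r (Fin x) - chi r (Fin y) = (y - x) / ((x - r) * (y - r))"
    using assms by (auto simp: chi_def diff_frac_eq)
  moreover have "(x - r) * (y - r) > 0" using assms by (auto simp: zero_less_mult_iff)
  ultimately have "sgn (chi r (Fin x) - chi r (Fin y)) = sgn (y - x)"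
    by (simp add: sgn_divide)
  then show "chi r (Fin x) \<le> chi r (Fin y) \<longleftrightarrow> y \<le> x" "chi r (Fin x) < chi r (Fin y) \<longleftrightarrow> y < x"
    by (auto simp: sgn_if split: if_splits)
qed

text \<open>Points moved by the parabolic group lie in \<open>[r1, r2]\<close>, which is inside
  \<open>[k, k + 1]\<close>; so they are never candidates for a reflection.\<close>

lemma low_high_range:
  assumes "low (Fin x) \<or> high (Fin x)"
  shows "of_int k \<le> x \<and> x \<le> of_int k + 1"
proof -
  have n: "x \<noteq> r" using assms by (auto simp: low_def high_def)
  then consider "x < r" | "x > r" by linarith
  then show ?thesis
  proof cases
    case 1
    then have "\<not> high (Fin x)" using chi_pos(1)[of x] chi_pos(2)[of r2] order by (auto simp: high_def)
    then have "chi r (Fin x) \<le> chi r (Fin r1)" using assms by (auto simp: low_def split: if_splits)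
    then have "r1 \<le> x" using chi_mono(1)[of x r1] 1 order by auto
    then show ?thesis using 1 order by linarith
  next
    case 2
    then have "\<not> low (Fin x)" using chi_pos(2)[of x] chi_pos(1)[of r1] order by (auto simp: low_def)
    then have "chi r (Fin r2) \<le> chi r (Fin x)" using assms by (auto simp: high_def split: if_splits)
    then have "x \<le> r2" using chi_mono(1)[of r2 x] 2 order by auto
    then show ?thesis using 2 order by linarith
  qed
qed

lemma not_low_high_Infty: "\<not> low Infty" "\<not> high Infty"
  using chi_pos(1)[of r1] chi_pos(2)[of r2] order by (auto simp: low_def high_def chi_def)

lemma domain_iff:
  assumes k: "k = \<lfloor>r\<rfloor>"
  shows "s \<in> I_set r r1 r2 ri \<union> {Infty, Fin r} \<longleftrightarrow> 
    \<not> low s \<and> \<not> high s \<and> (\<forall>x. s = Fin x \<longrightarrow> of_int k \<le> x \<and> x \<le> of_int k + 1)"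
proof (cases s)
  case Infty
  then show ?thesis using not_low_high_Infty by simp
next
  case (Fin x)
  have mem: "s \<in> I_set r r1 r2 ri \<union> {Infty, Fin r} \<longleftrightarrow> 
      x = r \<or> (of_int k \<le> x \<and> x \<le> r1 \<or> r2 \<le> x \<and> x \<le> of_int k + 1) \<and> x \<noteq> ri"
    unfolding Fin k by (auto simp: I_set_def)
  consider "x = r" | "x < r" | "x > r" by linarith
  then show ?thesis
  proof cases
    case 1
    then show ?thesis using order unfolding mem by (simp add: Fin low_def high_def)
  next
    case 2
    have h: "\<not> high (Fin x)" using chi_pos(1)[of x] chi_pos(2)[of r2] order 2 by (auto simp: high_def)
    have l: "low (Fin x) \<longleftrightarrow> (if ri = r1 then r1 \<le> x else r1 < x)"
      using chi_mono[of x r1] 2 order by (simp add: low_def)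
    show ?thesis unfolding mem using h l 2 order ri by (auto simp: Fin split: if_splits)
  next
    case 3
    have h: "\<not> low (Fin x)" using chi_pos(2)[of x] chi_pos(1)[of r1] order 3 by (auto simp: low_def)
    have l: "high (Fin x) \<longleftrightarrow> (if ri = r1 then x < r2 else x \<le> r2)"
      using chi_mono[of r2 x] 3 order by (simp add: high_def)
    show ?thesis unfolding mem using h l 3 order ri by (auto simp: Fin split: if_splits)
  qed
qed

lemma joinable_refl: "joinable s s"
  unfolding joinable_def by blast

lemma joinable_sym: "joinable s t \<Longrightarrow> joinable t s"
  unfolding joinable_def by metis

text \<open>As \<open>step\<close> is a function, the successors of \<open>t\<close> form one
  sequence, so after further steps the two common successors meet.\<close>

lemma joinable_trans:
  assumes "joinable s t" "joinable t v" shows "joinable s v"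
proof -
  obtain i j i' j' where e: "(step ^^ i) s = (step ^^ j) t" "(step ^^ i') t = (step ^^ j') v"
    using assms unfolding joinable_def by blast
  have "(step ^^ (i' + i)) s = (step ^^ i') ((step ^^ j) t)" by (simp add: funpow_add e)
  also have "\<dots> = (step ^^ (j + i')) t" by (simp add: add.commute[of j] funpow_add)
  also have "\<dots> = (step ^^ (j + j')) v" by (simp add: funpow_add e)
  finally show ?thesis unfolding joinable_def by blast
qed

lemma joinable_step: "step s = t \<Longrightarrow> joinable s t"
  unfolding joinable_def by (rule exI[of _ 1], rule exI[of _ 0]) simp

lemma joinable_fixed:
  assumes "joinable s t" "step s = s" "step t = t" shows "s = t"
proof -
  have "(step ^^ i) s = s" "(step ^^ i) t = t" for i using assms by (induction i) simp_all
  then show ?thesis using assms(1) unfolding joinable_def by simp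
qed

lemma joinable_para: "joinable s (para r M s)"
proof (cases "s = Fin r")
  case True
  then show ?thesis by (simp add: para_fixes joinable_refl)
next
  case False
  show ?thesis
  proof (cases "low s")
    case True
    then show ?thesis by (intro joinable_step) (simp add: step_def)
  next
    case nl: False
    then have h: "high (para r M s)" using high_para_iff[OF False] by simp
    then have "\<not> low (para r M s)" using low_not_high by blast
    then have "step (para r M s) = s" using h by (simp add: step_def para_para para_0)
    then show ?thesis using joinable_step joinable_sym by blast
  qed
qed

lemma step_below: "x < of_int k \<Longrightarrow> step (Fin x) = refl_at k (Fin x)"
  using low_high_range[of x] by (auto simp: step_def)

lemma step_above: "x > of_int k + 1 \<Longrightarrow> step (Fin x) = refl_at (k + 1) (Fin x)"
  using low_high_range[of x] by (auto simp: step_def)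

lemma joinable_refl_k: "joinable s (refl_at k s)"
proof (cases s)
  case Infty then show ?thesis by (simp add: joinable_refl)
next
  case (Fin x)
  consider "x < of_int k" | "x = of_int k" | "2 * of_int k - x < of_int k" by linarith
  then show ?thesis
  proof cases
    case 1 then show ?thesis using step_below[OF 1] joinable_step Fin by blast
  next
    case 2 then show ?thesis by (simp add: Fin joinable_refl)
  next
    case 3 then have "joinable (refl_at k s) s" using step_below[OF 3] by (intro joinable_step) (simp add: Fin)
    then show ?thesis by (rule joinable_sym)
  qed
qed

lemma joinable_refl_Suc_k: "joinable s (refl_at (k + 1) s)"
proof (cases s)
  case Infty then show ?thesis by (simp add: joinable_refl)
next
  case (Fin x)
  consider "x > of_int k + 1" | "x = of_int k + 1" | "x < of_int k + 1" by linarith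
  then show ?thesis
  proof cases
    case 1 then show ?thesis using step_above[OF 1] joinable_step Fin by blast
  next
    case 2 then show ?thesis by (simp add: Fin joinable_refl)
  next
    case 3
    then have "2 * of_int (k + 1) - x > of_int k + 1" by simp
    from step_above[OF this] have "joinable (refl_at (k + 1) s) s" by (intro joinable_step) (simp add: Fin)
    then show ?thesis by (rule joinable_sym)
  qed
qed

text \<open>The reflections in \<open>k\<close> and \<open>k + 1\<close> generate all others:
  conjugating one of two adjacent mirrors by the other gives the next mirror. Adjacent mirrors are
  therefore treated in pairs.\<close>

lemma joinable_refl_at: "joinable s (refl_at j s)"
proof -
  have "(\<forall>s. joinable s (refl_at j s)) \<and> (\<forall>s. joinable s (refl_at (j + 1) s))"
  proof (induction j rule: int_induct[where k = k])
    case base then show ?case using joinable_refl_k joinable_refl_Suc_k by blast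
  next
    case (step1 i)
    have e: "refl_at (i + 1 + 1) s = refl_at (i + 1) (refl_at i (refl_at (i + 1) s))" for s
      by (cases s) simp_all
    show ?case using step1(2) joinable_trans unfolding e by metis
  next
    case (step2 i)
    have e: "refl_at (i - 1) s = refl_at i (refl_at (i + 1) (refl_at i s))" for s
      by (cases s) simp_all
    show ?case using step2(2) joinable_trans unfolding e by (metis diff_add_cancel)
  qed
  then show ?thesis by blast
qed

lemma step_fixes_domain:
  assumes "k = \<lfloor>r\<rfloor>" "s \<in> I_set r r1 r2 ri \<union> {Infty, Fin r}" shows "step s = s"
  using assms(2) unfolding domain_iff[OF assms(1)] by (cases s) (auto simp: step_def)

lemma normalise_chi: "s \<noteq> Fin r \<Longrightarrow> \<exists>j::int. \<not> low (para r (of_int j * M) s) \<and> \<not> high (para r (of_int j * M) s)"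
proof -
  assume s: "s \<noteq> Fin r"
  define c where "c = chi r (Fin r1)"
  \<comment> \<open>The position in units of \<open>M\<close>, to be shifted into a half-open unit
    interval; the ceiling or the floor is used according to which end belongs to it.\<close>
  define q where "q = (chi r s - c) / M"
  have q: "chi r s = c + q * M" using M by (simp add: q_def)
  have ex: "\<exists>j::int. if ri = r1 then 0 < q + of_int j \<and> q + of_int j \<le> 1 else 0 \<le> q + of_int j \<and> q + of_int j < 1"
  proof (cases "ri = r1")
    case True
    have "0 < q + of_int (1 - \<lceil>q\<rceil>) \<and> q + of_int (1 - \<lceil>q\<rceil>) \<le> 1" using ceiling_correct[of q] by simp
    then show ?thesis using True by metis
  next
    case False
    have "0 \<le> q + of_int (- \<lfloor>q\<rfloor>) \<and> q + of_int (- \<lfloor>q\<rfloor>) < 1" using floor_correct[of q] by simp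
    then show ?thesis using False by metis
  qed
  then obtain j :: int where j: "if ri = r1 then 0 < q + of_int j \<and> q + of_int j \<le> 1 else 0 \<le> q + of_int j \<and> q + of_int j < 1"
    by blast
  have e: "chi r (para r (of_int j * M) s) = c + (q + of_int j) * M"
    unfolding chi_para[OF s] q by (simp add: algebra_simps)
  have p: "0 < x * M \<longleftrightarrow> 0 < x" "0 \<le> x * M \<longleftrightarrow> 0 \<le> x" "x * M \<le> M \<longleftrightarrow> x \<le> 1" "x * M < M \<longleftrightarrow> x < 1" for x
    using M(1) by (simp_all add: zero_less_mult_iff zero_le_mult_iff)
  have "\<not> low (para r (of_int j * M) s) \<and> \<not> high (para r (of_int j * M) s)"
    unfolding low_def high_def e M(2) c_def[symmetric]
    using j p[of "q + of_int j"] by (auto simp: not_le not_less)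
  then show ?thesis by blast
qed

text \<open>Since \<open>idet u v = fst u * fst v * (x - r)\<close> for \<open>x\<close> the slope
  of \<open>v\<close>, and reflections keep \<open>fst v\<close>, the descent amounts to bringing
  \<open>x\<close> closer to \<open>r\<close>. The predicate \<open>P\<close> stands for membership
  in an orbit; only its pull-back along generating moves enters.\<close>

lemma domain_meets_orbit:
  assumes k: "k = \<lfloor>r\<rfloor>" and u: "primitive u" "slope u = Fin r" and Mu: "M = of_int (m * (fst u)\<^sup>2)"
    and P: "\<And>g s s0. g \<in> range refl_at \<or> g \<in> range (\<lambda>j::int. para r (of_int j * M)) \<Longrightarrow> P (g s) s0 \<Longrightarrow> P s s0"
    and P_refl: "\<And>s. P s s"
    and v: "primitive v"
  shows "\<exists>s0. s0 \<in> I_set r r1 r2 ri \<union> {Infty, Fin r} \<and> P (slope v) s0"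
  using v
proof (induction "nat \<bar>idet u v\<bar>" arbitrary: v rule: less_induct)
  case less
  show ?case
  proof (cases "slope v = Fin r")
    case True
    then show ?thesis using P_refl by auto
  next
    case False
    obtain j :: int where j: "\<not> low (para r (of_int j * M) (slope v))" "\<not> high (para r (of_int j * M) (slope v))"
      using normalise_chi[OF False] by blast
    define v' where "v' = add_scaled v (j * m * idet u v) u"
    have v': "primitive v'" "slope v' = para r (of_int j * M) (slope v)" "idet u v' = idet u v"
      unfolding v'_def
      using primitive_shear[OF less.prems, of "j * m" u] slope_shear[OF u(2) less.prems, of "j * m"]
      by (simp_all add: idet_add_scaled Mu mult.assoc)
    have P': "P (slope v) s0" if "P (slope v') s0" for s0 using P[of "para r (of_int j * M)" "slope v" s0] that v'(2) by auto
    show ?thesis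
    proof (cases "slope v' \<in> I_set r r1 r2 ri \<union> {Infty, Fin r}")
      case True
      then show ?thesis using P' P_refl by blast
    next
      case nd: False
      then obtain x where x: "slope v' = Fin x" "x < of_int k \<or> x > of_int k + 1"
        using j unfolding domain_iff[OF k] v'(2) by (metis not_le)
      define l where "l = (if x < of_int k then k else k + 1)"
      define v'' where "v'' = (fst v', 2 * l * fst v' - snd v')"
      have v'': "primitive v''" "slope v'' = refl_at l (slope v')"
        unfolding v''_def using primitive_reflect[OF v'(1)] slope_reflect by auto
      have f: "fst v' \<noteq> 0" "x = of_int (snd v') / of_int (fst v')" using x(1) by (auto simp: slope_def split: if_splits)
      have fu: "fst u \<noteq> 0" "r = of_int (snd u) / of_int (fst u)" using u(2) by (auto simp: slope_def split: if_splits)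
      have d: "of_int (idet u w) = of_int (fst u) * of_int (fst w) * (of_int (snd w) / of_int (fst w) - r)" if "fst w \<noteq> 0" for w
        using that fu by (simp add: idet_def field_simps)
      \<comment> \<open>The points \<open>x\<close> and \<open>r\<close> lie strictly on opposite
        sides of \<open>l\<close>, so the sum of two positive distances is replaced by their
        difference.\<close>
      have "\<bar>2 * of_int l - x - r\<bar> < \<bar>x - r\<bar>"
        using x(2) order unfolding l_def by (auto simp: abs_if)
      moreover define W :: rat where "W = of_int (fst u) * of_int (fst v')"
      moreover have "\<bar>W\<bar> > 0" using fu f by (simp add: W_def)
      ultimately have "\<bar>W\<bar> * \<bar>2 * of_int l - x - r\<bar> < \<bar>W\<bar> * \<bar>x - r\<bar>" by (intro mult_strict_left_mono)
      moreover have "of_int (idet u v') = W * (x - r)" using d[of v'] f by (simp add: W_def)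
      moreover have "of_int (snd v'') / of_int (fst v'') = 2 * of_int l - x"
        unfolding v''_def using f by (simp add: diff_divide_distrib)
      then have "of_int (idet u v'') = W * (2 * of_int l - x - r)" 
        using d[of v''] f(1) unfolding W_def by (simp add: v''_def)
      ultimately have "\<bar>of_int (idet u v'') :: rat\<bar> < \<bar>of_int (idet u v')\<bar>"
        by (simp add: abs_mult)
      then have "\<bar>idet u v''\<bar> < \<bar>idet u v\<bar>" unfolding v'(3)[symmetric] by (simp flip: of_int_abs)
      then have "nat \<bar>idet u v''\<bar> < nat \<bar>idet u v\<bar>" by linarith
      then obtain s0 where "s0 \<in> I_set r r1 r2 ri \<union> {Infty, Fin r}" "P (slope v'') s0"
        using less.hyps v''(1) by blast
      then show ?thesis using P[of "refl_at l" "slope v'" s0] P' v''(2) by auto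
    qed
  qed
qed

end

theorem theorem3p1:
  fixes r n r1 r2 ri :: rat and x0 :: plane and s :: qhat
  assumes "r \<notin> \<int>"
    and "n > 1" and "2 * n \<in> \<int>"
    and "admissible_neighbours r n r1 r2" and "ri \<in> {r1, r2}"
    and "x0 \<in> punctured_plane"
  shows "(\<exists>!s0. s0 \<in> I_set r r1 r2 ri \<union> {Infty, Fin r} \<and> s \<in> Gamma_orbit r n s0) \<and>
         (\<forall>s0. s0 \<in> I_set r r1 r2 ri \<union> {Infty, Fin r} \<and> s \<in> Gamma_orbit r n s0 \<longrightarrow>
            homotopic_in_heckoid x0 r n s s0 \<and>
            (s0 = Infty \<longrightarrow> null_homotopic_in_heckoid x0 r n s))"
proof -
  let ?D = "I_set r r1 r2 ri \<union> {Infty, Fin r}" and ?m = "\<lfloor>2 * n\<rfloor>"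
  let ?related = "coset_related (heckoid_deck_group n) x0 (heckoid_kernel x0 r n)"
  obtain u where u: "primitive u" "slope u = Fin r" by (rule slope_surj)
  obtain w where w: "idet u w = 1" using primitive_bezout[OF u(1)] .
  define M :: rat where "M = of_int (?m * (fst u)\<^sup>2)"
  have m: "?m > 0" using assms(2) by simp
  note shift = admissible_shift[OF u m assms(4), folded M_def]
  have order: "of_int \<lfloor>r\<rfloor> \<le> r1" "r1 < r" "r < r2" "r2 \<le> of_int \<lfloor>r\<rfloor> + 1"
    using assms(4) unfolding admissible_neighbours_def by blast+
  interpret domain: fundamental_domain r r1 r2 ri M "\<lfloor>r\<rfloor>"
    by unfold_locales (fact order shift assms(5))+
  have bij: "bij g" if "g \<in> Gamma_inf \<union> C_group (Fin r) ?m" for g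
    using that bij_Gamma_inf bij_C_group[OF u] by blast
  obtain v where v: "primitive v" "slope v = s" by (rule slope_surj)
  have "\<exists>s0. s0 \<in> ?D \<and> slope v \<in> Gamma_orbit r n s0"
  proof (rule domain.domain_meets_orbit[OF refl u M_def _ _ v(1)])
    fix g t s0 
    assume "g \<in> range refl_at \<or> g \<in> range (\<lambda>j::int. para r (of_int j * M))" and t: "g t \<in> Gamma_orbit r n s0"
    then have g: "g \<in> Gamma_group r n" using refl_at_in_Gamma para_in_Gamma[OF shift(3,4) bij] by blast
    show "t \<in> Gamma_orbit r n s0" by (rule Gamma_orbit_step[where g = g and s = t, OF bij g t])
  next
    fix t have "id \<in> Gamma_group r n"
      using generate.one[of "BijGroup UNIV"] unfolding Gamma_group_def one_BijGroup_UNIV by blast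
    then show "t \<in> Gamma_orbit r n t" unfolding Gamma_orbit_def by (metis id_apply image_eqI)
  qed
  then obtain s0 where s0: "s0 \<in> ?D" "s \<in> Gamma_orbit r n s0" using v(2) by blast
  \<comment> \<open>Two points of the domain whose orbits contain \<open>s\<close> are thereby
    joinable with each other; both are fixed by \<open>step\<close>, so they are equal.\<close>
  have joinable: "domain.joinable t s" if t: "s \<in> Gamma_orbit r n t" for t
  proof -
    obtain f where f: "f \<in> Gamma_group r n" "s = f t" using t by (auto simp: Gamma_orbit_def)
    show ?thesis unfolding f(2)
    proof (rule Gamma_group_equiv[OF u _ _ _ _ _ f(1), where Q = domain.joinable])
      show "domain.joinable x (para r (of_int (?m * (fst u)\<^sup>2)) x)" for x
        using domain.joinable_para[of x] by (simp only: M_def)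
    qed (fact domain.joinable_refl domain.joinable_refl_at | erule domain.joinable_sym | erule (1) domain.joinable_trans)+
  qed
  have unique: "t = s0" if "t \<in> ?D" "s \<in> Gamma_orbit r n t" for t
  proof (rule domain.joinable_fixed)
    show "domain.joinable t s0"
      using joinable[OF that(2)] joinable[OF s0(2)] domain.joinable_sym domain.joinable_trans by blast
  qed (use domain.step_fixes_domain that(1) s0(1) in blast)+
  note twist_u = twist_heckoid(1)[OF assms(6,2,3) u(2) w] and twist_Infty = twist_heckoid(2)[OF assms(6,2,3) u(2) w]
  have related_refl_at: "?related t (refl_at k t)" for k t
    by (rule twist.coset_related_reflect[OF twist_Infty refl refl refl shift_heckoid_deck_group]) (auto simp: slope_reflect)
  have related_para: "?related t (para r (of_int (l * ?m * (fst u)\<^sup>2)) t)" for l t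
    by (rule twist.coset_related_shear[OF twist_u refl shift_heckoid_deck_group]) (use slope_shear[OF u(2)] in blast)
  have related: "?related s t" if t: "s \<in> Gamma_orbit r n t" for t
  proof -
    obtain f where f: "f \<in> Gamma_group r n" "s = f t" using t by (auto simp: Gamma_orbit_def)
    have "?related t (f t) \<and> ?related (f t) t"
    proof (rule Gamma_group_equiv[OF u _ _ _ _ _ f(1), where Q = "\<lambda>s t. ?related s t \<and> ?related t s"])
      show "?related x (refl_at k x) \<and> ?related (refl_at k x) x" for k x
        using related_refl_at[of x k] related_refl_at[of "refl_at k x" k] by (simp add: refl_at_refl_at)
      \<comment> \<open>The backward direction is the shear with \<open>l = -1\<close>, applied to
        the translated point.\<close>
      show "?related x (para r (of_int (?m * (fst u)\<^sup>2)) x) \<and> ?related (para r (of_int (?m * (fst u)\<^sup>2)) x) x" for x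
        using related_para[of x 1] related_para[of "para r (of_int (?m * (fst u)\<^sup>2)) x" "-1"]
        by (simp add: para_para para_0)
    qed (use coset_related_refl coset_related_trans in blast)+
    then show ?thesis using f(2) by blast
  qed
  have "homotopic_in_heckoid x0 r n s t" "t = Infty \<Longrightarrow> null_homotopic_in_heckoid x0 r n s"
    if "s \<in> Gamma_orbit r n t" for t
    using homotopic_heckoidI[OF assms(6,2,3) u(2) w related[OF that] v] by blast+
  then show ?thesis using s0 unique by blast
qed

end
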